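(* Let $p$ be a prime, let $n\geq 3$ be an integer, and let $G$ be a group of order $p^n$ with $G\not\cong C_{p^n}$. (i) If $p$ is odd, then $\alpha(G)\geq\alpha(C_p\times C_{p^{n-1}})=\alpha(M(p^n))$, and $\alpha(G)=\alpha(C_p\times C_{p^{n-1}})$ if and only if $G\cong C_p\times C_{p^{n-1}}$ or $G\cong M(p^n)$. (ii) If $p=2$, then: - if $n=3$, $\alpha(G)\geq\alpha(Q_8)$, with equality if and only if $G\cong Q_8$; - if $n=4$, $\alpha(G)\geq\alpha(C_2\times C_8)=\alpha(M(16))=\alpha(Q_{16})$, with equality if and only if $G$ is isomorphic to $C_2\times C_8$, $M(16)$ or $Q_{16}$; - if $n\geq 5$, $\alpha(G)\geq\alpha(C_2\times C_{2^{n-1}})=\alpha(M(2^n))$, with equality if and only if $G\cong C_2\times C_{2^{n-1}}$ or $G\cong M(2^n)$.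
   Context: For a finite group $G$, $C(G)$ denotes the set of cyclic subgroups of $G$ (including the trivial subgroup), and $\alpha(G)=\frac{|C(G)|}{|G|}$. $C_m$ denotes the cyclic group of order $m$. For a prime $p$, with $n\geq 3$ if $p$ is odd and $n\geq 4$ if $p=2$, the modular $p$-group of order $p^n$ is $M(p^n)=\langle x,y \mid x^{p^{n-1}}=y^p=1,\ x^y=x^{1+p^{n-2}}\rangle$, where $x^y=y^{-1}xy$. For $n\geq 3$, $Q_{2^n}$ is the generalized quaternion group of order $2^n$, $Q_{2^n}=\langle x,y \mid x^{2^{n-1}}=1,\ y^2=x^{2^{n-2}},\ yxy^{-1}=x^{-1}\rangle$. *)

theory Defs
  imports
    Complex_Main
    "HOL-Algebra.Elementary_Groups"
    "HOL-Computational_Algebra.Primes"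
begin

definition cyclic_subgroups :: "('a, 'b) monoid_scheme \<Rightarrow> 'a set set" where
  "cyclic_subgroups G = {H. subgroup H G \<and> cyclic_group (G\<lparr>carrier := H\<rparr>)}"

definition alpha :: "('a, 'b) monoid_scheme \<Rightarrow> real" where
  "alpha G = real (card (cyclic_subgroups G)) / real (order G)"

text \<open>Groups given by generators and relations. A word is a list of letters; the letter
  \<open>(g, True)\<close> stands for the generator \<open>g\<close> and \<open>(g, False)\<close> for its formal inverse.
  A relation \<open>u = v\<close> is the pair of words \<open>(u, v)\<close>. The group generated by all of \<open>'g\<close>
  subject to the relations \<open>R\<close> is the set of words modulo the least congruence that
  contains \<open>R\<close> and cancels adjacent inverse letters.\<close>

type_synonym 'g word = "('g \<times> bool) list"

inductive word_eq :: "('g word \<times> 'g word) set \<Rightarrow> 'g word \<Rightarrow> 'g word \<Rightarrow> bool"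
  for R :: "('g word \<times> 'g word) set" where
  word_eq_refl: "word_eq R u u"
| word_eq_sym: "word_eq R u v \<Longrightarrow> word_eq R v u"
| word_eq_trans: "word_eq R u v \<Longrightarrow> word_eq R v w \<Longrightarrow> word_eq R u w"
| word_eq_append: "word_eq R u u' \<Longrightarrow> word_eq R v v' \<Longrightarrow> word_eq R (u @ v) (u' @ v')"
| word_eq_cancel: "word_eq R [(g, b), (g, \<not> b)] []"
| word_eq_rel: "(u, v) \<in> R \<Longrightarrow> word_eq R u v"

definition word_rel :: "('g word \<times> 'g word) set \<Rightarrow> ('g word \<times> 'g word) set" where
  "word_rel R = {(u, v). word_eq R u v}"

text \<open>The multiplication below is the set of all words equal to some product of
  representatives, which is the class of the product of any two representatives
  (\<open>presented_group_mult\<close>).\<close>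

definition presented_group :: "('g word \<times> 'g word) set \<Rightarrow> 'g word set monoid" where
  "presented_group R =
    \<lparr>carrier = UNIV // word_rel R,
     monoid.mult = (\<lambda>A B. word_rel R `` {u @ v | u v. u \<in> A \<and> v \<in> B}),
     one = word_rel R `` {[]}\<rparr>"

lemma equiv_word_rel: "equiv UNIV (word_rel R)"
  by (rule equivI)
    (auto simp: word_rel_def refl_on_def sym_def trans_def
      intro: word_eq_refl word_eq_sym word_eq_trans)

lemma presented_group_mult:
  "word_rel R `` {u} \<otimes>\<^bsub>presented_group R\<^esub> word_rel R `` {v} = word_rel R `` {u @ v}"
  by (auto simp: presented_group_def word_rel_def
      intro: word_eq_refl word_eq_sym word_eq_trans word_eq_append)

lemma word_eq_left_inverse:
  "word_eq R (rev (map (\<lambda>(g, b). (g, \<not> b)) w) @ w) []"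
proof (induction w)
  case Nil
  show ?case by (simp add: word_eq_refl)
next
  case (Cons a w)
  obtain g b where a: "a = (g, b)" by force
  let ?w = "rev (map (\<lambda>(g, b). (g, \<not> b)) w)"
  have "word_eq R ([(g, \<not> b), (g, b)] @ w) ([] @ w)"
    using word_eq_cancel[of R g "\<not> b"] by (intro word_eq_append word_eq_refl) simp
  then have "word_eq R (?w @ [(g, \<not> b), (g, b)] @ w) (?w @ w)"
    by (intro word_eq_append word_eq_refl) simp
  then show ?case using Cons a by (auto intro: word_eq_trans)
qed

lemma group_presented_group: "group (presented_group R)"
proof (rule groupI)
  have carrier: "A \<in> carrier (presented_group R) \<longleftrightarrow> (\<exists>u. A = word_rel R `` {u})" for A
    by (auto simp: presented_group_def quotient_def)
  have one: "\<one>\<^bsub>presented_group R\<^esub> = word_rel R `` {[]}"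
    by (simp add: presented_group_def)
  show "\<one>\<^bsub>presented_group R\<^esub> \<in> carrier (presented_group R)"
    unfolding carrier one by blast
  fix A assume "A \<in> carrier (presented_group R)"
  then obtain u where A: "A = word_rel R `` {u}" unfolding carrier by blast
  show "\<one>\<^bsub>presented_group R\<^esub> \<otimes>\<^bsub>presented_group R\<^esub> A = A"
    by (simp add: A one presented_group_mult)
  show "\<exists>B\<in>carrier (presented_group R). B \<otimes>\<^bsub>presented_group R\<^esub> A = \<one>\<^bsub>presented_group R\<^esub>"
  proof (intro bexI)
    let ?B = "word_rel R `` {rev (map (\<lambda>(g, b). (g, \<not> b)) u)}"
    show "?B \<in> carrier (presented_group R)" unfolding carrier by blast
    show "?B \<otimes>\<^bsub>presented_group R\<^esub> A = \<one>\<^bsub>presented_group R\<^esub>"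
      unfolding A one presented_group_mult
      by (rule equiv_class_eq[OF equiv_word_rel]) (simp add: word_rel_def word_eq_left_inverse)
  qed
  fix B assume "B \<in> carrier (presented_group R)"
  then obtain v where B: "B = word_rel R `` {v}" unfolding carrier by blast
  show "A \<otimes>\<^bsub>presented_group R\<^esub> B \<in> carrier (presented_group R)"
    unfolding carrier A B presented_group_mult by blast
  fix C assume "C \<in> carrier (presented_group R)"
  then obtain w where C: "C = word_rel R `` {w}" unfolding carrier by blast
  show "A \<otimes>\<^bsub>presented_group R\<^esub> B \<otimes>\<^bsub>presented_group R\<^esub> C
      = A \<otimes>\<^bsub>presented_group R\<^esub> (B \<otimes>\<^bsub>presented_group R\<^esub> C)"
    by (simp add: A B C presented_group_mult)
qed

datatype two_gens = Gen_x | Gen_y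

abbreviation word_x :: "two_gens word" where "word_x \<equiv> [(Gen_x, True)]"
abbreviation word_x_inv :: "two_gens word" where "word_x_inv \<equiv> [(Gen_x, False)]"
abbreviation word_y :: "two_gens word" where "word_y \<equiv> [(Gen_y, True)]"
abbreviation word_y_inv :: "two_gens word" where "word_y_inv \<equiv> [(Gen_y, False)]"

definition word_pow :: "'g word \<Rightarrow> nat \<Rightarrow> 'g word" where
  "word_pow w k = concat (replicate k w)"

text \<open>\<open>modular_group p n\<close> is $M(p^n)$; it is meant for a prime \<open>p\<close> with \<open>n \<ge> 3\<close> if \<open>p\<close> is
  odd and \<open>n \<ge> 4\<close> if \<open>p = 2\<close>.\<close>

definition modular_group :: "nat \<Rightarrow> nat \<Rightarrow> two_gens word set monoid" where
  "modular_group p n = presented_group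
    {(word_pow word_x (p ^ (n - 1)), []),
     (word_pow word_y p, []),
     (word_y_inv @ word_x @ word_y, word_pow word_x (1 + p ^ (n - 2)))}"

text \<open>\<open>quaternion_group n\<close> is $Q_{2^n}$ (order \<open>2 ^ n\<close>, not index \<open>n\<close>), for \<open>n \<ge> 3\<close>.\<close>

definition quaternion_group :: "nat \<Rightarrow> two_gens word set monoid" where
  "quaternion_group n = presented_group
    {(word_pow word_x (2 ^ (n - 1)), []),
     (word_pow word_y 2, word_pow word_x (2 ^ (n - 2))),
     (word_y @ word_x @ word_y_inv, word_x_inv)}"

end

theory Submission
  imports Defs "HOL-Algebra.Group_Action" "HOL-Algebra.Multiplicative_Group" "HOL-Number_Theory.Residues"
begin

text \<open>For a group of order \<open>p ^ n\<close> let \<open>N k\<close> be the number of solutions of \<open>g ^ (p ^ k) = 1\<close>. A cyclic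
  subgroup of order \<open>p ^ (k + 1)\<close> has \<open>p ^ k * (p - 1)\<close> generators, so the number of cyclic subgroups is
  \<open>1 + (\<Sum>k<n. (N (k + 1) - N k) / (p ^ k * (p - 1)))\<close> (\<open>card_cyclic_subgroups\<close>). The weights decrease with \<open>k\<close>,
  and \<open>N 0 = 1\<close> and \<open>N n = p ^ n\<close> are fixed. Abel summation therefore shows that fewer solutions mean
  fewer cyclic subgroups: if \<open>N k \<ge> p ^ (k + 1)\<close> for \<open>0 < k < n\<close>, there are at least
  \<open>(n - 1) * p + 2\<close> of them, and this number is attained only if all these bounds are equalities
  (\<open>card_cyclic_subgroups_ge\<close>).
  
  If a noncyclic group has two subgroups of order \<open>p\<close>, it has a noncyclic subgroup of order \<open>p\<^sup>2\<close>.
  Above it there are subgroups of every order \<open>p ^ (k + 1)\<close>, because a proper subgroup of a \<open>p\<close>-group always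
  has index \<open>p\<close> in some larger one. Containing the small one, they are not cyclic, so their elements satisfy
  \<open>g ^ (p ^ k) = 1\<close>. This gives the bounds \<open>N k \<ge> p ^ (k + 1)\<close> (\<open>card_roots_of_one_ge\<close>). When they are
  equalities, counting yields an element \<open>x\<close> of order \<open>p ^ (n - 1)\<close> and an element \<open>y\<close> of order \<open>p\<close> outside
  \<open>\<langle>x\<rangle>\<close>. Then \<open>x y = y x ^ r\<close> with \<open>r ^ p = 1\<close> modulo \<open>p ^ (n - 1)\<close>. Either \<open>r = 1\<close> modulo \<open>p ^ (n - 2)\<close>, and
  replacing \<open>y\<close> by a power leaves only \<open>r = 1\<close> and \<open>r = 1 + p ^ (n - 2)\<close>, or \<open>p = 2\<close> and \<open>r = -1\<close> modulo \<open>2 ^ (n - 2)\<close>,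
  in which case there are too many involutions if \<open>n \<ge> 4\<close> (\<open>split_metacyclic_if_minimal_roots\<close>).
  
  If there is a single subgroup of order \<open>p\<close>, the group is cyclic or generalized quaternion
  (\<open>cyclic_or_quaternion_if_few_roots\<close>). To see this, take a largest normal cyclic subgroup \<open>A\<close>; it is its own
  centralizer. An element \<open>y\<close> outside \<open>A\<close> with \<open>y ^ p\<close> in \<open>A\<close> can be multiplied by an element of \<open>A\<close> so as
  to become a new solution of \<open>g ^ p = 1\<close>, unless \<open>p = 2\<close> and \<open>y\<close> inverts \<open>A\<close>. Since \<open>-1\<close> is not a square modulo \<open>4\<close>,
  all elements outside \<open>A\<close> then invert \<open>A\<close>, so \<open>A\<close> has index \<open>2\<close>. The generalized quaternion group of order
  \<open>2 ^ n\<close> has \<open>n + 2 ^ (n - 2)\<close> cyclic subgroups. Compared with \<open>2 * n\<close>, this is smaller for \<open>n = 3\<close>, equal for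
  \<open>n = 4\<close> and larger for \<open>n \<ge> 5\<close>, which is the reason for the three cases with \<open>p = 2\<close>.
  
  All groups that occur in the conclusion are generated by two elements with \<open>x ^ m = 1\<close>, \<open>y ^ p = x ^ s\<close> and
  \<open>x y = y x ^ r\<close>. A group of order \<open>p * m\<close> of this kind is determined by \<open>(p, m, r, s)\<close>
  (\<open>metacyclic_iso\<close>), and an explicit model on pairs of numbers shows that the groups given by generators and
  relations really have this order.\<close>

section \<open>Powers modulo prime powers\<close>

text \<open>With \<open>r = 1 + p * c\<close> the sum is \<open>p + p * c * (p * (p - 1) div 2)\<close> modulo \<open>p\<^sup>2\<close>. The second term vanishes
  because \<open>p\<close> divides \<open>p * (p - 1) div 2\<close> for odd \<open>p\<close>, and because \<open>c\<close> is even for \<open>p = 2\<close>. The sum matters as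
  the exponent of \<open>x\<close> in \<open>(y x) ^ p\<close> when \<open>x y = y x ^ r\<close>.\<close>

lemma sum_powers_eq_prime_times_unit:
  fixes p r :: nat
  assumes p: "prime p" and r: "[r = 1] (mod p)" and r4: "p = 2 \<Longrightarrow> [r = 1] (mod 4)"
  shows "\<exists>u. (\<Sum>t<p. r ^ t) = p * u \<and> coprime u p"
proof -
  have p2: "p \<ge> 2" using p by (rule prime_ge_2_nat)
  have "r \<ge> 1" using r p2 by (cases "r = 0") (auto simp: cong_def)
  then obtain c where c: "r = 1 + p * c"
    using r by (metis cong_to_1_nat dvdE le_add_diff_inverse)
  have pow: "[r ^ t = 1 + t * (p * c)] (mod p ^ 2)" for t
  proof (induction t)
    case (Suc t)
    have "[r * r ^ t = (1 + p * c) * (1 + t * (p * c))] (mod p ^ 2)"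
      using Suc by (intro cong_mult) (auto simp: c)
    also have "(1 + p * c) * (1 + t * (p * c)) = (1 + Suc t * (p * c)) + p ^ 2 * (t * c * c)"
      by (simp add: algebra_simps power2_eq_square)
    also have "[\<dots> = 1 + Suc t * (p * c)] (mod p ^ 2)"
      by (simp add: cong_def)
    finally show ?case by simp
  qed auto
  have "[(\<Sum>t<p. r ^ t) = (\<Sum>t<p. 1 + t * (p * c))] (mod p ^ 2)"
    by (intro cong_sum pow)
  also have "(\<Sum>t<p. 1 + t * (p * c)) = p + (p * c) * (\<Sum>t<p. t)"
    by (subst sum.distrib) (simp add: sum_distrib_left mult.commute)
  also have "(\<Sum>t<p. t) = p * (p - 1) div 2"
    using gauss_sum_nat[of "p - 1"] p2 
    by (metis (no_types, lifting) Suc_1 Suc_diff_1 atLeast0AtMost lessThan_Suc_atMost mult.commute not_gr_zero not_less_eq_eq zero_le)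
  also have "[p + (p * c) * (p * (p - 1) div 2) = p] (mod p ^ 2)"
  proof -
    have "p dvd c * (p * (p - 1) div 2)"
    proof (cases "p = 2")
      case True
      have "4 dvd r - 1" using r4[OF True] \<open>r \<ge> 1\<close> by (meson cong_to_1_nat)
      then show ?thesis using True c by (auto simp: dvd_def)
    next
      case False
      then have "odd p" using p p2 prime_odd_nat by force
      then have "p * (p - 1) div 2 = p * ((p - 1) div 2)" by (simp add: div_mult_swap)
      then show ?thesis by simp
    qed
    then have "p ^ 2 dvd (p * c) * (p * (p - 1) div 2)"
      by (simp add: power2_eq_square mult.assoc)
    then show ?thesis by (simp add: cong_def dvd_eq_mod_eq_0 mod_add_right_eq[symmetric])
  qed
  finally have sum: "[(\<Sum>t<p. r ^ t) = p] (mod p ^ 2)" .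
  then have "p dvd (\<Sum>t<p. r ^ t)"
    by (metis cong_dvd_iff dvd_refl dvd_triv_left cong_dvd_modulus_nat power2_eq_square)
  then obtain u where u: "(\<Sum>t<p. r ^ t) = p * u" by blast
  have "[p * u = p * 1] (mod p * p)" using sum u by (simp add: power2_eq_square)
  then have "[u = 1] (mod p)" using p2 by (simp add: cong_def mult_mod_right[symmetric])
  then have "coprime u p" using cong_imp_coprime[of 1 u p] by (simp add: cong_sym_eq)
  then show ?thesis using u by blast
qed

text \<open>A form of lifting the exponent: \<open>r ^ p - 1\<close> is \<open>r - 1\<close> times the sum of the previous lemma, which contributes exactly
  one factor \<open>p\<close>.\<close>

lemma cong_1_if_prime_power_cong_1:
  fixes p r m :: nat
  assumes p: "prime p" and r: "[r = 1] (mod p)" and r4: "p = 2 \<Longrightarrow> [r = 1] (mod 4)"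
    and rp: "[r ^ p = 1] (mod p ^ Suc m)"
  shows "[r = 1] (mod p ^ m)"
proof -
  have p2: "p \<ge> 2" using p by (rule prime_ge_2_nat)
  have r1: "r \<ge> 1" using r p2 by (cases "r = 0") (auto simp: cong_def)
  obtain u where u: "(\<Sum>t<p. r ^ t) = p * u" "coprime u p"
    using sum_powers_eq_prime_times_unit[OF p r r4] by blast
  have "int (r ^ p - 1) = int ((r - 1) * (p * u))"
    using power_diff_1_eq[of "int r" p] r1 u(1)[symmetric] by (simp add: of_nat_diff)
  then have "r ^ p - 1 = (r - 1) * (p * u)" by (simp only: of_nat_eq_iff)
  moreover have "p ^ Suc m dvd r ^ p - 1" using rp cong_to_1_nat by blast
  ultimately have "p * p ^ m dvd p * ((r - 1) * u)" by (simp add: algebra_simps)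
  then have "p ^ m dvd (r - 1) * u" using p2 by simp
  then have "p ^ m dvd r - 1"
    using u(2) by (metis coprime_commute coprime_dvd_mult_left_iff coprime_power_left_iff)
  then show ?thesis using r1 by (simp add: cong_altdef_nat)
qed

lemma cong_1_if_pow_prime_cong_1:
  fixes p r :: nat
  assumes "prime p" "[r ^ p = 1] (mod p ^ k)" "k > 0"
  shows "[r = 1] (mod p)"
proof -
  have rp: "[r ^ p = 1] (mod p)"
    using assms(2,3) by (metis cong_dvd_modulus_nat dvd_power)
  have "\<not> p dvd r"
  proof
    assume "p dvd r"
    then have "p dvd r ^ p" using assms(1) by (simp add: prime_dvd_power_iff prime_gt_0_nat)
    then have "p dvd 1" using rp cong_dvd_iff by blast
    then show False using assms(1) by simp
  qed
  then have "[r ^ (p - 1) = 1] (mod p)" using fermat_theorem assms(1) by blast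
  then have "[r ^ (p - 1) * r = 1 * r] (mod p)" by (rule cong_mult) simp
  then have "[r ^ p = r] (mod p)"
    using assms(1) by (simp add: prime_gt_0_nat flip: power_Suc2)
  then show ?thesis using rp by (metis cong_sym cong_trans)
qed

text \<open>In \<open>r\<^sup>2 - 1 = (r - 1) * (r + 1)\<close> the first factor is twice an odd number.\<close>

lemma dvd_Suc_if_square_cong_1:
  fixes r k :: nat
  assumes r: "r mod 4 = 3" and rr: "[r ^ 2 = 1] (mod 2 ^ Suc k)"
  shows "2 ^ k dvd r + 1"
proof -
  obtain q where q: "r = 4 * q + 3" using r by (metis mult_div_mod_eq)
  have "2 * 2 ^ k dvd r ^ 2 - 1" using cong_to_1_nat[OF rr] by simp
  also have "r ^ 2 - 1 = 2 * ((r + 1) * (2 * q + 1))"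
    using q by (simp add: algebra_simps power2_eq_square)
  finally have "2 ^ k dvd (r + 1) * (2 * q + 1)"
    by (subst (asm) dvd_times_left_cancel_iff) auto
  moreover have "coprime (2 ^ k) (2 * q + 1)" by simp
  ultimately show ?thesis using coprime_dvd_mult_left_iff by blast
qed

lemma one_plus_pow_cong:
  fixes p e a t :: nat
  assumes "e > 0"
  shows "[(1 + a * p ^ e) ^ t = 1 + t * a * p ^ e] (mod p ^ Suc e)"
proof (induction t)
  case (Suc t)
  have "[(1 + a * p ^ e) * (1 + a * p ^ e) ^ t = (1 + a * p ^ e) * (1 + t * a * p ^ e)] (mod p ^ Suc e)"
    using Suc by (intro cong_mult) auto
  also have "(1 + a * p ^ e) * (1 + t * a * p ^ e) = (1 + Suc t * a * p ^ e) + p ^ e * p ^ e * (t * a * a)"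
    by (simp add: algebra_simps)
  also have "p ^ e * p ^ e = p ^ Suc e * p ^ (e - 1)"
    using assms by (cases e) auto
  also have "[1 + Suc t * a * p ^ e + p ^ Suc e * p ^ (e - 1) * (t * a * a) = 1 + Suc t * a * p ^ e] (mod p ^ Suc e)"
    unfolding cong_def mult.assoc by (rule mod_mult_self2)
  finally show ?case by simp
qed simp

lemma card_multiples_below:
  fixes d q :: nat
  assumes "d > 0"
  shows "card {i. i < d * q \<and> d dvd i} = q"
proof -
  have "{i. i < d * q \<and> d dvd i} = (*) d ` {..<q}" using assms by auto
  then show ?thesis using assms by (simp add: card_image inj_on_def)
qed

section \<open>Powers, cyclic subgroups and the normal form $y^j x^i$\<close>

definition roots_of_one :: "('a, 'b) monoid_scheme \<Rightarrow> nat \<Rightarrow> 'a set" where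
  "roots_of_one G m = {g \<in> carrier G. g [^]\<^bsub>G\<^esub> m = \<one>\<^bsub>G\<^esub>}"

context group
begin

lemma finite_if_prime_power_order:
  "prime p \<Longrightarrow> order G = p ^ n \<Longrightarrow> finite (carrier G)"
  by (metis order_gt_0_iff_finite prime_gt_0_nat zero_less_power)

lemma inv_eq_pow:
  assumes "a \<in> carrier G" "a [^] k = \<one>" "k > 0"
  shows "inv a = a [^] (k - 1 :: nat)"
proof (rule inv_equality)
  have "a [^] (k - 1) \<otimes> a = a [^] Suc (k - 1)" by simp
  then show "a [^] (k - 1) \<otimes> a = \<one>" using assms(2,3) by simp
qed (use assms in auto)

lemma ord_pos: "finite (carrier G) \<Longrightarrow> x \<in> carrier G \<Longrightarrow> ord x > 0"
  using ord_ge_1 by fastforce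

lemma subgroup_generate_singleton: "x \<in> carrier G \<Longrightarrow> subgroup (generate G {x}) G"
  by (rule generate_is_subgroup) simp

lemma generate_singleton_subset: "subgroup H G \<Longrightarrow> x \<in> H \<Longrightarrow> generate G {x} \<subseteq> H"
  by (rule generate_subgroup_incl) auto

lemma mem_generate_singleton_iff:
  "finite (carrier G) \<Longrightarrow> x \<in> carrier G \<Longrightarrow> g \<in> generate G {x} \<longleftrightarrow> (\<exists>k::nat. g = x [^] k)"
  by (simp add: generate_pow_on_finite_carrier)

lemma pow_cong:
  assumes "x \<in> carrier G" "x [^] m = \<one>" "[a = b] (mod m)"
  shows "x [^] a = x [^] (b::nat)"
proof -
  have *: "x [^] a = x [^] (a mod m)" for a :: nat
  proof -
    have "x [^] (m * (a div m) + a mod m) = (x [^] m) [^] (a div m) \<otimes> x [^] (a mod m)"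
      using assms(1) by (simp add: nat_pow_mult nat_pow_pow)
    then show ?thesis using assms(1,2) by simp
  qed
  show ?thesis using assms(3) *[of a] *[of b] by (simp add: cong_def)
qed

lemma pow_eq_iff_cong:
  assumes "finite (carrier G)" "x \<in> carrier G"
  shows "x [^] (a::nat) = x [^] (b::nat) \<longleftrightarrow> [a = b] (mod ord x)"
proof
  assume "x [^] a = x [^] b"
  then have "x [^] int a = x [^] int b" by (simp add: int_pow_int)
  then have "int (ord x) dvd int b - int a" using assms int_pow_eq by blast
  then show "[a = b] (mod ord x)"
    by (metis cong_iff_dvd_diff cong_int_iff cong_sym)
qed (use assms pow_cong pow_ord_eq_1 in blast)

lemma card_roots_of_one_in_cyclic:
  assumes fin: "finite (carrier G)" and x: "x \<in> carrier G" and m: "m dvd ord x"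
  shows "card {g \<in> generate G {x}. g [^] m = \<one>} = m"
proof -
  obtain d where d: "ord x = m * d" using m by blast
  have pos: "m > 0" "d > 0" using ord_pos[OF fin x] d by auto
  have "{g \<in> generate G {x}. g [^] m = \<one>} = (\<lambda>i. x [^] (d * i)) ` {..<m}"
  proof (intro equalityI subsetI)
    fix g assume "g \<in> {g \<in> generate G {x}. g [^] m = \<one>}"
    then obtain k :: nat where k: "g = x [^] k" "g [^] m = \<one>"
      using mem_generate_singleton_iff[OF fin x] by auto
    then have "ord x dvd k * m" using x pow_eq_id by (simp add: nat_pow_pow)
    then have "d dvd k" using d pos by (simp add: mult.commute)
    then obtain i where i: "k = d * i" by blast
    have "[d * i = d * (i mod m)] (mod d * m)"
      unfolding cong_def mult_mod_right[symmetric] by simp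
    then have "[d * i = d * (i mod m)] (mod ord x)" unfolding d by (simp only: mult.commute)
    then have "g = x [^] (d * (i mod m))" using k i pow_eq_iff_cong[OF fin x] by simp
    then show "g \<in> (\<lambda>i. x [^] (d * i)) ` {..<m}" using pos by auto
  next
    fix g assume "g \<in> (\<lambda>i. x [^] (d * i)) ` {..<m}"
    then obtain i where "g = x [^] (d * i)" by blast
    then have "g [^] m = x [^] (ord x * i)" using x d by (simp add: nat_pow_pow mult_ac)
    then have "g [^] m = \<one>" using x by (simp add: pow_eq_id)
    then show "g \<in> {g \<in> generate G {x}. g [^] m = \<one>}"
      using \<open>g = _\<close> mem_generate_singleton_iff[OF fin x] x by auto
  qed
  moreover have "inj_on (\<lambda>i. x [^] (d * i)) {..<m}"
  proof (rule inj_onI)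
    fix i j assume *: "i \<in> {..<m}" "j \<in> {..<m}" "x [^] (d * i) = x [^] (d * j)"
    then have "[d * i = d * j] (mod d * m)"
      using pow_eq_iff_cong[OF fin x] d by (simp add: mult.commute)
    then show "i = j" using * pos unfolding cong_def mult_mod_right[symmetric] by simp
  qed
  ultimately show ?thesis by (simp add: card_image)
qed

lemma finite_subset_is_subgroup:
  assumes "finite (carrier G)" "K \<subseteq> carrier G" "\<one> \<in> K"
    and "\<And>a b. a \<in> K \<Longrightarrow> b \<in> K \<Longrightarrow> a \<otimes> b \<in> K"
  shows "subgroup K G"
proof (rule subgroupI)
  fix a assume a: "a \<in> K"
  then have aG: "a \<in> carrier G" using assms(2) by blast
  have pow: "a [^] (k::nat) \<in> K" for k by (induction k) (use assms(3,4) a in auto)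
  have "inv a = a [^] (ord a - 1)"
    by (rule inv_eq_pow[OF aG pow_ord_eq_1[OF aG] ord_pos[OF assms(1) aG]])
  then show "inv a \<in> K" using pow by simp
qed (use assms in auto)

lemma pow_mem_subgroup:
  assumes "subgroup H G" "h \<in> H"
  shows "h [^] (k::nat) \<in> H"
proof -
  interpret subgroup H G by fact
  show ?thesis by (induction k) (use assms in auto)
qed

lemma mult_pow_comm: "x \<in> carrier G \<Longrightarrow> x \<otimes> x [^] (k::nat) = x [^] k \<otimes> x"
  by (metis nat_pow_Suc nat_pow_Suc2)

lemma pow_generates_if_coprime:
  assumes fin: "finite (carrier G)" and x: "x \<in> carrier G" and l: "coprime l (ord x)"
  shows "x \<in> generate G {x [^] (l::nat)}"
proof -
  obtain v where "[l * v = 1] (mod ord x)" using cong_solve_coprime_nat[OF l] by auto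
  then have "(x [^] l) [^] v = x"
    using pow_eq_iff_cong[OF fin x, of "l * v" 1] x by (simp add: nat_pow_pow)
  then have "\<exists>k::nat. x = (x [^] l) [^] k" by metis
  then show ?thesis using mem_generate_singleton_iff[OF fin, of "x [^] l"] x by blast
qed

lemma coset_mem_cancel:
  assumes "subgroup H G" "h \<in> H" "g \<in> carrier G" "g \<otimes> h \<in> H"
  shows "g \<in> H"
proof -
  interpret subgroup H G by fact
  have "g = (g \<otimes> h) \<otimes> inv h" using assms by (simp add: m_assoc)
  then show ?thesis using assms by (metis m_closed m_inv_closed)
qed

lemma normal_generate_singletonI:
  assumes fin: "finite (carrier G)" and b: "b \<in> carrier G"
    and conj: "\<And>g. g \<in> carrier G \<Longrightarrow> g \<otimes> b \<otimes> inv g \<in> generate G {b}"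
  shows "generate G {b} \<lhd> G"
proof -
  have "g \<otimes> h \<otimes> inv g \<in> generate G {b}" if g: "g \<in> carrier G" and h: "h \<in> generate G {b}" for g h
  proof -
    obtain i :: nat where i: "h = b [^] i" using h mem_generate_singleton_iff[OF fin b] by auto
    have "g \<otimes> b [^] i \<otimes> inv g = (g \<otimes> b \<otimes> inv g) [^] i" for i :: nat
    proof (induction i)
      case (Suc i)
      have "g \<otimes> b [^] Suc i \<otimes> inv g = (g \<otimes> b [^] i \<otimes> inv g) \<otimes> (g \<otimes> b \<otimes> inv g)"
        using g b by (simp add: m_assoc flip: m_assoc[of "inv g" g])
      then show ?case using Suc by simp
    qed (use g in auto)
    then show ?thesis
      using pow_mem_subgroup[OF subgroup_generate_singleton[OF b] conj[OF g]] i by simp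
  qed
  then show ?thesis
    using subgroup_generate_singleton[OF b] by (auto simp: normal_inv_iff)
qed

lemma pow_mult_swap:
  assumes "x \<in> carrier G" "y \<in> carrier G" "x \<otimes> y = y \<otimes> x [^] (r::nat)"
  shows "x [^] (i::nat) \<otimes> y [^] (j::nat) = y [^] j \<otimes> x [^] (i * r ^ j)"
proof -
  have one: "x [^] (i::nat) \<otimes> y = y \<otimes> x [^] (i * r)" for i
  proof (induction i)
    case (Suc i)
    have "x [^] Suc i \<otimes> y = x [^] i \<otimes> (x \<otimes> y)" using assms(1,2) by (simp add: m_assoc)
    also have "\<dots> = (x [^] i \<otimes> y) \<otimes> x [^] r" using assms by (simp add: m_assoc)
    also have "\<dots> = y \<otimes> x [^] (i * r + r)" using assms(1,2) Suc by (simp add: m_assoc nat_pow_mult)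
    finally show ?case by (simp add: add.commute)
  qed (use assms in auto)
  show ?thesis
  proof (induction j)
    case (Suc j)
    have "x [^] i \<otimes> y [^] Suc j = (x [^] i \<otimes> y [^] j) \<otimes> y" using assms(1,2) by (simp add: m_assoc)
    also have "\<dots> = y [^] j \<otimes> (x [^] (i * r ^ j) \<otimes> y)" using assms(1,2) Suc by (simp add: m_assoc)
    also have "\<dots> = y [^] Suc j \<otimes> x [^] (i * r ^ Suc j)"
      using assms(1,2) by (simp add: one m_assoc mult.commute mult.left_commute)
    finally show ?case .
  qed (use assms in auto)
qed

lemma normal_form_mult:
  assumes "x \<in> carrier G" "y \<in> carrier G" "x \<otimes> y = y \<otimes> x [^] (r::nat)"
  shows "(y [^] (j::nat) \<otimes> x [^] (i::nat)) \<otimes> (y [^] (j'::nat) \<otimes> x [^] (i'::nat))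
    = y [^] (j + j') \<otimes> x [^] (i * r ^ j' + i')"
proof -
  have "(y [^] j \<otimes> x [^] i) \<otimes> (y [^] j' \<otimes> x [^] i') = y [^] j \<otimes> (x [^] i \<otimes> y [^] j') \<otimes> x [^] i'"
    using assms(1,2) by (simp add: m_assoc)
  also have "\<dots> = (y [^] j \<otimes> y [^] j') \<otimes> (x [^] (i * r ^ j') \<otimes> x [^] i')"
    using assms(1,2) by (simp add: pow_mult_swap[OF assms] m_assoc)
  finally show ?thesis using assms(1,2) by (simp add: nat_pow_mult)
qed

lemma normal_form_pow:
  assumes "x \<in> carrier G" "y \<in> carrier G" "x \<otimes> y = y \<otimes> x [^] (r::nat)"
  shows "(y \<otimes> x [^] (i::nat)) [^] (k::nat) = y [^] k \<otimes> x [^] (i * (\<Sum>t<k. r ^ t))"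
proof (induction k)
  case (Suc k)
  have "(\<Sum>t<Suc k. r ^ t) = (\<Sum>t<k. r ^ t) * r + 1"
    by (subst sum.lessThan_Suc_shift) (simp add: sum_distrib_left mult.commute)
  then show ?case
    using normal_form_mult[OF assms, of k "i * (\<Sum>t<k. r ^ t)" 1 i] Suc assms(1,2)
    by (simp add: algebra_simps)
qed (use assms in auto)

text \<open>By \<open>normal_form_pow\<close>, \<open>(y * x ^ i) ^ p = x ^ (p * (j + i * u))\<close> with \<open>u\<close> prime to \<open>p\<close>, so a suitable \<open>i\<close>
  makes the exponent divisible by \<open>p ^ k\<close>. This is the source of all the additional elements of order \<open>p\<close> below.\<close>

lemma ex_pow_prime_eq_one_in_coset:
  assumes p: "prime p" and xy: "x \<in> carrier G" "y \<in> carrier G" "x \<otimes> y = y \<otimes> x [^] (r::nat)"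
    and r: "[r = 1] (mod p)" and r4: "p = 2 \<Longrightarrow> [r = 1] (mod 4)"
    and x: "x [^] (p ^ k) = \<one>" and y: "y [^] p = x [^] (p * j)"
  shows "\<exists>i::nat. (y \<otimes> x [^] i) [^] p = \<one>"
proof -
  obtain u where u: "(\<Sum>t<p. r ^ t) = p * u" "coprime u p"
    using sum_powers_eq_prime_times_unit[OF p r r4] by blast
  have "coprime u (p ^ k)" using u(2) by simp
  then obtain v where v: "[u * v = 1] (mod p ^ k)" using cong_solve_coprime_nat[of u "p ^ k"] by auto
  have "p ^ k > 0" using p by (simp add: prime_gt_0_nat)
  \<comment> \<open>Modulo \<open>p ^ k\<close> the number \<open>v\<close> is the inverse of \<open>u\<close> and \<open>p ^ k - 1\<close> is \<open>-1\<close>, so \<open>i * u = -j\<close>.\<close>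
  define i where "i = v * (j * (p ^ k - 1))"
  have "[j + i * u = j + j * (p ^ k - 1) * (u * v)] (mod p ^ k)"
    by (simp add: i_def algebra_simps)
  also have "[j + j * (p ^ k - 1) * (u * v) = j + j * (p ^ k - 1) * 1] (mod p ^ k)"
    by (intro cong_add cong_mult cong_refl v)
  also have "j + j * (p ^ k - 1) * 1 = j * p ^ k"
    using \<open>p ^ k > 0\<close> by (metis Suc_diff_1 mult.right_neutral mult_Suc_right)
  finally have "p ^ k dvd j + i * u" by (simp add: cong_def dvd_eq_mod_eq_0)
  then obtain c where c: "j + i * u = p ^ k * c" by blast
  have "(y \<otimes> x [^] i) [^] p = x [^] (p * j) \<otimes> x [^] (i * (p * u))"
    by (simp add: normal_form_pow[OF xy] u y)
  also have "\<dots> = x [^] (p * (j + i * u))" using xy by (simp add: nat_pow_mult algebra_simps)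
  also have "\<dots> = (x [^] (p ^ k)) [^] (c * p)" 
    unfolding c using xy by (simp add: nat_pow_pow algebra_simps)
  finally show ?thesis using x by auto
qed

end

section \<open>Actions of groups of prime power order\<close>

text \<open>Every orbit has prime power size, so the orbits with more than one element make up a multiple of \<open>p\<close>.\<close>

lemma prime_dvd_card_fixed_points:
  fixes P (structure) and f :: "'a \<Rightarrow> 'b \<Rightarrow> 'b"
  assumes P: "group P" "order P = p ^ e" and p: "prime p" and X: "finite X" "p dvd card X"
    and closed: "\<And>g x. g \<in> carrier P \<Longrightarrow> x \<in> X \<Longrightarrow> f g x \<in> X"
    and one: "\<And>x. x \<in> X \<Longrightarrow> f \<one> x = x"
    and mult: "\<And>g h x. g \<in> carrier P \<Longrightarrow> h \<in> carrier P \<Longrightarrow> x \<in> X \<Longrightarrow> f (g \<otimes> h) x = f g (f h x)"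
  shows "p dvd card {x \<in> X. \<forall>g\<in>carrier P. f g x = x}"
proof -
  interpret group P by fact
  define \<phi> where "\<phi> = (\<lambda>g. restrict (f g) X)"
  have inv: "f (inv g) (f g x) = x" if "g \<in> carrier P" "x \<in> X" for g x
    using mult[of "inv g" g x] that one by simp
  have inv': "f g (f (inv g) x) = x" if "g \<in> carrier P" "x \<in> X" for g x
    using mult[of g "inv g" x] that one by simp
  have bij: "\<phi> g \<in> Bij X" if g: "g \<in> carrier P" for g
  proof -
    have "bij_betw (f g) X X"
      by (rule bij_betwI[where g = "f (inv g)"]) (use g inv inv' closed in auto)
    then show ?thesis by (simp add: Bij_def \<phi>_def)
  qed
  have "\<phi> (g \<otimes> h) = compose X (\<phi> g) (\<phi> h)" if "g \<in> carrier P" "h \<in> carrier P" for g h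
    using that mult closed by (auto simp: \<phi>_def compose_def fun_eq_iff)
  then have "group_hom P (BijGroup X) \<phi>"
    by (intro group_hom.intro group_hom_axioms.intro is_group group_BijGroup homI)
       (auto simp: BijGroup_def bij)
  then interpret act: group_action P X \<phi> by (rule group_action.intro)
  let ?F = "{x \<in> X. \<forall>g\<in>carrier P. f g x = x}"
  let ?O = "{B \<in> orbits P X \<phi>. card B \<noteq> 1}"
  have orbit: "orbit P \<phi> x = (\<lambda>g. f g x) ` carrier P" if "x \<in> X" for x
    using that by (auto simp: orbit_def \<phi>_def)
  have finO: "finite (carrier P)"
    using P(2) p by (metis order_gt_0_iff_finite prime_gt_0_nat zero_less_power)
  have fixed: "card (orbit P \<phi> x) = 1 \<longleftrightarrow> x \<in> ?F" if x: "x \<in> X" for x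
  proof
    assume "card (orbit P \<phi> x) = 1"
    then obtain y where "orbit P \<phi> x = {y}" by (auto simp: card_1_singleton_iff)
    then have y: "f g x = y" if "g \<in> carrier P" for g using that orbit[OF x] by blast
    from y[of \<one>] one x have "y = x" by auto
    with y x show "x \<in> ?F" by auto
  next
    assume "x \<in> ?F"
    then have "orbit P \<phi> x = {x}" using orbit[OF x] by force
    then show "card (orbit P \<phi> x) = 1" by simp
  qed
  have un: "\<Union>?O = X - ?F"
  proof (intro equalityI subsetI)
    fix x assume "x \<in> \<Union>?O"
    then obtain z where z: "z \<in> X" "x \<in> orbit P \<phi> z" "card (orbit P \<phi> z) \<noteq> 1"
      by (auto simp: orbits_def)
    then have x: "x \<in> X" using orbit closed by auto
    have "orbit P \<phi> x = orbit P \<phi> z"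
      using act.disjoint_union[of "orbit P \<phi> x" "orbit P \<phi> z"] act.orbit_refl[OF x] x z
      by (auto simp: orbits_def)
    then show "x \<in> X - ?F" using fixed[OF x] x z by auto
  next
    fix x assume "x \<in> X - ?F"
    then show "x \<in> \<Union>?O"
      using fixed[of x] act.orbit_refl[of x] by (auto simp: orbits_def)
  qed
  have "p dvd card (\<Union>?O)"
  proof (rule dvd_partition)
    show "finite (\<Union>?O)" using un X by simp
    show "\<forall>c\<in>?O. p dvd card c"
    proof
      fix c assume "c \<in> ?O"
      then obtain x where x: "x \<in> X" "c = orbit P \<phi> x" "card c \<noteq> 1" by (auto simp: orbits_def)
      have "card c dvd p ^ e"
        using act.orbit_stabilizer_theorem[OF x(1)] P(2) x(2) by (metis dvd_triv_left)
      then obtain i where "card c = p ^ i" using p by (auto simp: divides_primepow_nat)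
      then show "p dvd card c" using x(3) by (cases i) auto
    qed
    show "\<forall>c1\<in>?O. \<forall>c2\<in>?O. c1 \<noteq> c2 \<longrightarrow> c1 \<inter> c2 = {}"
      using act.disjoint_union by blast
  qed
  moreover have "card X = card (\<Union>?O) + card ?F"
    unfolding un using card_Diff_subset[of ?F X] card_mono[of X ?F] X(1) by simp
  ultimately have "p dvd card (\<Union>?O) + card ?F" using X(2) by (simp only:)
  with \<open>p dvd card (\<Union>?O)\<close> show ?thesis by (rule dvd_add_right_iff[THEN iffD1])
qed

context group
begin

lemma ex_prime_power_pow_leaving:
  assumes "order G = p ^ n" "subgroup H G" "g \<in> carrier G" "g \<notin> H"
  shows "\<exists>j. g [^] (p ^ j) \<notin> H \<and> (g [^] (p ^ j)) [^] p \<in> H"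
proof -
  have "g [^] (p ^ n) \<in> H" using assms by (metis pow_order_eq_1 subgroup.one_closed)
  moreover have "g [^] (p ^ 0) \<notin> H" using assms by simp
  ultimately obtain k where "g [^] (p ^ k) \<notin> H" "g [^] (p ^ Suc k) \<in> H"
    using ex_least_nat_less[of "\<lambda>j. g [^] (p ^ j) \<in> H" n] by blast
  then show ?thesis using assms(3) by (intro exI[of _ k]) (simp add: nat_pow_pow mult.commute)
qed

text \<open>\<open>H\<close> acts on its own right cosets by multiplication. The number of cosets is a multiple of \<open>p\<close>, and so is the number of
  fixed ones; one of them is \<open>H\<close>, hence there is another one \<open>H g\<close>. That \<open>H g\<close> is fixed means that \<open>g\<close>
  normalizes \<open>H\<close>, and then so do the powers of \<open>g\<close>, among which one has its \<open>p\<close>-th power in \<open>H\<close>.\<close>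

lemma ex_normalizing_outside_proper_subgroup:
  assumes p: "prime p" and G: "order G = p ^ n" and H: "subgroup H G" "H \<noteq> carrier G"
  shows "\<exists>g \<in> carrier G - H. g [^] p \<in> H \<and> (\<forall>h\<in>H. inv g \<otimes> h \<otimes> g \<in> H)"
proof -
  interpret H: subgroup H G by fact
  have fin: "finite (carrier G)" by (rule finite_if_prime_power_order[OF p G])
  have lag: "card (rcosets H) * card H = p ^ n" using lagrange[OF H(1)] G by simp
  then obtain e where e: "card H = p ^ e"
    using p by (metis divides_primepow_nat dvd_triv_right)
  obtain d where d: "card (rcosets H) = p ^ d"
    using p lag by (metis divides_primepow_nat dvd_triv_left)
  have "d \<noteq> 0"
  proof
    assume "d = 0"
    then have "card H = card (carrier G)" using lag d G by (simp add: order_def)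
    then show False using H fin by (metis card_subset_eq H.subset)
  qed
  then have pX: "p dvd card (rcosets H)" by (simp add: d)
  have finX: "finite (rcosets H)"
    using d p by (intro card_ge_0_finite) (simp add: prime_gt_0_nat)
  let ?F = "{K \<in> rcosets H. \<forall>h\<in>carrier (G\<lparr>carrier := H\<rparr>). K #> inv h = K}"
  have "p dvd card ?F"
  proof (rule prime_dvd_card_fixed_points[where e = e])
    show "group (G\<lparr>carrier := H\<rparr>)" using H(1) by (rule subgroup_imp_group)
    show "order (G\<lparr>carrier := H\<rparr>) = p ^ e" by (simp add: order_def e)
    show "finite (rcosets H)" by fact
  next
    fix g x assume "g \<in> carrier (G\<lparr>carrier := H\<rparr>)" "x \<in> rcosets H"
    then show "x #> inv g \<in> rcosets H"
      by (auto simp: RCOSETS_def coset_mult_assoc H.subset)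
  next
    fix x assume "x \<in> rcosets H"
    then show "x #> inv \<one>\<^bsub>G\<lparr>carrier := H\<rparr>\<^esub> = x"
      using H.rcosets_carrier[OF is_group] by simp
  next
    fix g h x assume *: "g \<in> carrier (G\<lparr>carrier := H\<rparr>)" "h \<in> carrier (G\<lparr>carrier := H\<rparr>)" "x \<in> rcosets H"
    then show "x #> inv (g \<otimes>\<^bsub>G\<lparr>carrier := H\<rparr>\<^esub> h) = x #> inv h #> inv g"
      using H.rcosets_carrier[OF is_group *(3)] by (simp add: coset_mult_assoc inv_mult_group)
  qed (use p pX in auto)
  moreover have "H \<in> ?F"
    using H.subgroup_in_rcosets[OF is_group] coset_join2[OF _ H(1)] by auto
  moreover have "finite ?F"
    using finX by simp
  ultimately have "?F \<noteq> {H}"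
    using p by (metis card_1_singleton_iff is_singletonI is_singleton_altdef nat_dvd_1_iff_1 not_prime_1)
  with \<open>H \<in> ?F\<close> obtain K where K: "K \<in> ?F" "K \<noteq> H" by blast
  then obtain g where g: "g \<in> carrier G" "K = H #> g" by (auto simp: RCOSETS_def)
  have gH: "g \<notin> H" using K g coset_join2[OF g(1) H(1)] by auto
  define N where "N = {g \<in> carrier G. \<forall>h\<in>H. g \<otimes> h \<otimes> inv g \<in> H}"
  have gN: "g \<in> N"
  proof -
    have "g \<otimes> h \<otimes> inv g \<in> H" if h: "h \<in> H" for h
    proof -
      have "inv h \<in> H" using h by simp
      then have "H #> g #> inv (inv h) = H #> g" using K g by auto
      then have "H #> (g \<otimes> h) = H #> g" using h g by (simp add: coset_mult_assoc H.subset)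
      then show ?thesis
        using g h by (metis H.mem_carrier H.rcos_module_imp is_group m_closed rcos_self H(1))
    qed
    then show ?thesis using g by (simp add: N_def)
  qed
  have "g [^] (k::nat) \<in> N" for k
  proof (induction k)
    case (Suc k)
    have "g [^] Suc k \<otimes> h \<otimes> inv (g [^] Suc k) \<in> H" if h: "h \<in> H" for h
    proof -
      have "g [^] Suc k \<otimes> h \<otimes> inv (g [^] Suc k) = g [^] k \<otimes> (g \<otimes> h \<otimes> inv g) \<otimes> inv (g [^] k)"
        using g h by (simp add: inv_mult_group m_assoc)
      then show ?thesis using Suc gN h by (auto simp: N_def)
    qed
    then show ?case using g by (simp add: N_def)
  qed (auto simp: N_def)
  then obtain a where a: "a \<in> N" "a \<notin> H" "a [^] p \<in> H"
    using ex_prime_power_pow_leaving[OF G H(1) g(1) gH] by blast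
  then have aG: "a \<in> carrier G" by (simp add: N_def)
  have "inv a \<notin> H" using a(2) aG by (metis H.m_inv_closed inv_inv)
  moreover have "(inv a) [^] p \<in> H" using a(3) aG by (metis H.m_inv_closed nat_pow_inv)
  ultimately show ?thesis using a(1) aG by (intro bexI[of _ "inv a"]) (auto simp: N_def)
qed

text \<open>A nontrivial normal subgroup of a \<open>p\<close>-group contains a central element of order \<open>p\<close>; here this is applied to
  \<open>C / A\<close> in \<open>G / A\<close>, but stated with elements of \<open>G\<close>. The group \<open>G\<close> acts by conjugation on the cosets
  of \<open>A\<close> in \<open>C\<close>, and the fixed points are counted as before.\<close>

lemma ex_central_mod_normal:
  assumes p: "prime p" and G: "order G = p ^ n" and A: "A \<lhd> G" and C: "C \<lhd> G" and AC: "A \<subset> C"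
  shows "\<exists>b \<in> C - A. b [^] p \<in> A \<and> (\<forall>g\<in>carrier G. g \<otimes> b \<otimes> inv g \<in> A #> b)"
proof -
  interpret A: normal A G by fact
  interpret C: normal C G by fact
  have fin: "finite (carrier G)" by (rule finite_if_prime_power_order[OF p G])
  have finC: "finite C" using fin C.subset finite_subset by blast
  let ?X = "(\<lambda>c. A #> c) ` C"
  have lagC: "card C dvd p ^ n" using lagrange[OF C.subgroup_axioms] G by (metis dvd_triv_right)
  have "group (G\<lparr>carrier := C\<rparr>)" by (rule subgroup_imp_group) (rule C.subgroup_axioms)
  moreover have "subgroup A (G\<lparr>carrier := C\<rparr>)"
    by (rule subgroup_incl) (use A.subgroup_axioms C.subgroup_axioms AC in auto)
  ultimately have "card (rcosets\<^bsub>G\<lparr>carrier := C\<rparr>\<^esub> A) * card A = card C"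
    using group.lagrange by (fastforce simp: order_def)
  moreover have "rcosets\<^bsub>G\<lparr>carrier := C\<rparr>\<^esub> A = ?X" by (auto simp: RCOSETS_def r_coset_def)
  ultimately have lag: "card ?X * card A = card C" by simp
  then have "card ?X dvd p ^ n" using lagC by (metis dvd_trans dvd_triv_left)
  then obtain d where d: "card ?X = p ^ d" using p by (auto simp: divides_primepow_nat)
  have "d \<noteq> 0"
  proof
    assume "d = 0"
    then have "card A = card C" using lag d by simp
    then show False using AC finC psubset_card_mono by (metis less_irrefl)
  qed
  then have pX: "p dvd card ?X" by (simp add: d)
  have act: "g <# (A #> c) #> inv g = A #> (g \<otimes> c \<otimes> inv g)"
    if "g \<in> carrier G" "c \<in> carrier G" for g c
  proof -
    have "g <# (A #> c) #> inv g = (g <# A) #> c #> inv g"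
      using that by (simp add: coset_assoc A.subset)
    also have "g <# A = A #> g" using A.coset_eq that by simp
    finally show ?thesis using that by (simp add: coset_mult_assoc A.subset m_assoc)
  qed
  let ?F = "{K \<in> ?X. \<forall>g\<in>carrier G. g <# K #> inv g = K}"
  have "p dvd card ?F"
  proof (rule prime_dvd_card_fixed_points[where e = n])
    fix g x assume "g \<in> carrier G" "x \<in> ?X"
    then show "g <# x #> inv g \<in> ?X"
      using act C.inv_op_closed2 C.mem_carrier by (auto simp: image_iff)
  next
    fix x assume "x \<in> ?X"
    then show "\<one> <# x #> inv \<one> = x" using act[of \<one>] C.mem_carrier by auto
  next
    fix g h x assume *: "g \<in> carrier G" "h \<in> carrier G" "x \<in> ?X"
    show "g \<otimes> h <# x #> inv (g \<otimes> h) = g <# (h <# x #> inv h) #> inv g"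
    proof -
      obtain c where "c \<in> C" "x = A #> c" using *(3) by blast
      then have c: "c \<in> carrier G" "x = A #> c" using C.mem_carrier by auto
      have "(g \<otimes> h) \<otimes> c \<otimes> inv (g \<otimes> h) = g \<otimes> (h \<otimes> c \<otimes> inv h) \<otimes> inv g"
        using * c(1) by (simp add: inv_mult_group m_assoc)
      then show ?thesis using * c act by simp
    qed
  qed (use p pX G finC is_group in auto)
  moreover have AF: "A \<in> ?F"
  proof -
    have "A = A #> \<one>" by (simp add: A.subset)
    moreover have "g <# (A #> \<one>) #> inv g = A #> \<one>" if "g \<in> carrier G" for g
      using act[OF that one_closed] that by simp
    ultimately show ?thesis using C.one_closed by auto
  qed
  moreover have "finite ?F" using finC by simp
  ultimately have "?F \<noteq> {A}"
    using p by (metis card_1_singleton_iff is_singletonI is_singleton_altdef nat_dvd_1_iff_1 not_prime_1)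
  with AF obtain K where K: "K \<in> ?F" "K \<noteq> A" by blast
  then obtain b where b: "b \<in> C" "K = A #> b" by auto
  then have bG: "b \<in> carrier G" using C.mem_carrier by auto
  have bA: "b \<notin> A" using K b coset_join2[OF bG A.subgroup_axioms] by auto
  define N where "N = {b \<in> C. \<forall>g\<in>carrier G. g \<otimes> b \<otimes> inv g \<in> A #> b}"
  have NC: "c \<in> N \<Longrightarrow> c \<in> C" for c by (simp add: N_def)
  have bN: "b \<in> N"
  proof -
    have "g \<otimes> b \<otimes> inv g \<in> A #> b" if g: "g \<in> carrier G" for g
    proof -
      have "A #> (g \<otimes> b \<otimes> inv g) = A #> b" using K b g act[OF g bG] by auto
      then show ?thesis using g bG A.subgroup_axioms
        by (metis inv_closed m_closed rcos_self)
    qed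
    then show ?thesis using b by (simp add: N_def)
  qed
  have bk: "b [^] (k::nat) \<in> N" for k
  proof (induction k)
    case 0
    then show ?case using A.one_closed rcos_self[OF one_closed A.subgroup_axioms]
      by (auto simp: N_def)
  next
    case (Suc k)
    have "g \<otimes> b [^] Suc k \<otimes> inv g \<in> A #> b [^] Suc k" if g: "g \<in> carrier G" for g
    proof -
      have "g \<otimes> b [^] Suc k \<otimes> inv g = (g \<otimes> b [^] k \<otimes> inv g) \<otimes> (g \<otimes> b \<otimes> inv g)"
        using g bG by (simp add: m_assoc flip: m_assoc[of "inv g" g])
      moreover have "(g \<otimes> b [^] k \<otimes> inv g) \<otimes> (g \<otimes> b \<otimes> inv g) \<in> (A #> b [^] k) <#> (A #> b)"
        using Suc bN g by (auto simp: N_def set_mult_def)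
      ultimately show ?thesis using bG by (simp add: A.rcos_sum)
    qed
    then show ?case using b NC[OF Suc] by (auto simp: N_def)
  qed
  obtain j where "b [^] (p ^ j) \<notin> A" "(b [^] (p ^ j)) [^] p \<in> A"
    using ex_prime_power_pow_leaving[OF G A.subgroup_axioms bG bA] by blast
  then show ?thesis using bk[of "p ^ j"] by (auto simp: N_def)
qed

end

section \<open>Extending a subgroup by an element of its normalizer\<close>

context group
begin

text \<open>Modulo \<open>p\<close> the exponent \<open>d\<close> is invertible, so \<open>g\<close> would be recovered from \<open>g ^ d\<close> and \<open>g ^ p\<close>.\<close>

lemma pow_notin_subgroup:
  fixes p d :: nat
  assumes p: "prime p" and H: "subgroup H G" and g: "g \<in> carrier G" "g \<notin> H" "g [^] p \<in> H"
    and d: "\<not> p dvd d"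
  shows "g [^] d \<notin> H"
proof
  interpret H: subgroup H G by fact
  assume gd: "g [^] d \<in> H"
  have pow: "h [^] (k::nat) \<in> H" if "h \<in> H" for h k
    by (induction k) (use that in auto)
  have "coprime d p" using p d by (metis coprime_commute prime_imp_coprime)
  then obtain a where a: "[d * a = 1] (mod p)" using cong_solve_coprime_nat[of d p] by auto
  have "d * a > 0" using a p by (intro gr0I) (auto simp: cong_def dest: prime_gt_1_nat)
  then obtain b where "d * a - 1 = p * b" using a cong_to_1_nat by blast
  with \<open>d * a > 0\<close> have b: "d * a = 1 + p * b" by linarith
  have "(g [^] d) [^] a = g \<otimes> (g [^] p) [^] b"
    using g(1) b nat_pow_mult[of g 1 "p * b"] by (simp add: nat_pow_pow)
  then have "g = (g [^] d) [^] a \<otimes> inv ((g [^] p) [^] b)"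
    using g(1) by (simp add: inv_solve_right' m_assoc)
  moreover have "\<dots> \<in> H" using pow[OF gd] pow[OF g(3)] by simp
  ultimately show False using g(2) by simp
qed

text \<open>Cosets of \<open>H\<close> by the powers of \<open>g\<close> form a subgroup since \<open>g\<close> normalizes \<open>H\<close>, and the first \<open>p\<close> of them are
  distinct since no smaller positive power of \<open>g\<close> lies in \<open>H\<close>.\<close>

lemma subgroup_extension:
  assumes p: "prime p" and fin: "finite (carrier G)" and H: "subgroup H G"
    and g: "g \<in> carrier G" "g \<notin> H" "g [^] p \<in> H"
    and norm: "\<And>h. h \<in> H \<Longrightarrow> inv g \<otimes> h \<otimes> g \<in> H"
  defines "K \<equiv> (\<lambda>(j, h). g [^] j \<otimes> h) ` ({..<p} \<times> H)"
  shows "subgroup K G" and "card K = p * card H"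
proof -
  interpret H: subgroup H G by fact
  have p0: "p > 0" using p by (rule prime_gt_0_nat)
  have pow: "h [^] (k::nat) \<in> H" if "h \<in> H" for h k
    by (induction k) (use that in auto)
  have swap: "\<exists>h'\<in>H. h \<otimes> g [^] (j::nat) = g [^] j \<otimes> h'" if "h \<in> H" for h j
    using that
  proof (induction j)
    case (Suc j)
    then obtain h' where h': "h' \<in> H" "h \<otimes> g [^] j = g [^] j \<otimes> h'" by blast
    have "h \<otimes> g [^] Suc j = (h \<otimes> g [^] j) \<otimes> g" using Suc g by (simp add: m_assoc)
    also have "\<dots> = g [^] Suc j \<otimes> (inv g \<otimes> h' \<otimes> g)"
      using h' g by (simp add: m_assoc) (simp add: r_inv flip: m_assoc)
    finally show ?case using norm[OF h'(1)] by blast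
  qed (auto intro!: bexI[of _ h])
  have memK: "g [^] (j::nat) \<otimes> h \<in> K" if h: "h \<in> H" for j h
  proof -
    have "g [^] j = g [^] (p * (j div p) + j mod p)" by simp
    also have "\<dots> = g [^] (j mod p + p * (j div p))" by (simp only: add.commute)
    also have "\<dots> = g [^] (j mod p) \<otimes> (g [^] p) [^] (j div p)"
      using g by (simp add: nat_pow_mult nat_pow_pow)
    finally have "g [^] j \<otimes> h = g [^] (j mod p) \<otimes> ((g [^] p) [^] (j div p) \<otimes> h)"
      using g h by (simp add: m_assoc)
    moreover have "(g [^] p) [^] (j div p) \<otimes> h \<in> H" using pow g h by simp
    ultimately show ?thesis using p0 by (force simp: K_def)
  qed
  show "subgroup K G"
  proof (rule finite_subset_is_subgroup[OF fin])
    show "K \<subseteq> carrier G" using g by (auto simp: K_def)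
    show "\<one> \<in> K" using memK[OF H.one_closed, of 0] by simp
    fix a b assume "a \<in> K" "b \<in> K"
    then obtain i h j k where ab: "h \<in> H" "k \<in> H" "a = g [^] (i::nat) \<otimes> h" "b = g [^] (j::nat) \<otimes> k"
      by (auto simp: K_def)
    obtain h' where h': "h' \<in> H" "h \<otimes> g [^] j = g [^] j \<otimes> h'" using swap[OF ab(1)] by blast
    have "a \<otimes> b = g [^] i \<otimes> (h \<otimes> g [^] j) \<otimes> k" using ab g by (simp add: m_assoc)
    also have "\<dots> = g [^] (i + j) \<otimes> (h' \<otimes> k)"
      using h' ab g by (simp add: m_assoc flip: nat_pow_mult)
    finally show "a \<otimes> b \<in> K" using memK h'(1) ab(2) by simp
  qed
  have aux: "False" if "i < j" "j < p" "h \<in> H" "k \<in> H" "g [^] i \<otimes> h = g [^] j \<otimes> k" for i j :: nat and h k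
  proof -
    have "g [^] i \<otimes> h = g [^] i \<otimes> (g [^] (j - i) \<otimes> k)"
      using that g by (simp add: nat_pow_mult flip: m_assoc)
    then have "h = g [^] (j - i) \<otimes> k" using that g by simp
    then have "g [^] (j - i) = h \<otimes> inv k" using that g by (simp add: inv_solve_right)
    moreover have "\<not> p dvd j - i" using that by (simp add: nat_dvd_not_less)
    ultimately show False using pow_notin_subgroup[OF p H g] that by (metis H.m_closed H.m_inv_closed)
  qed
  have "inj_on (\<lambda>(j, h). g [^] j \<otimes> h) ({..<p} \<times> H)"
  proof (rule inj_onI, clarify)
    fix i h j k assume *: "i < p" "h \<in> H" "j < p" "k \<in> H" "g [^] i \<otimes> h = g [^] j \<otimes> k"
    then have "i = j" using aux[of i j h k] aux[of j i k h] by (metis linorder_neqE_nat)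
    then show "i = j \<and> h = k" using * g by auto
  qed
  then show "card K = p * card H" by (simp add: K_def card_image card_cartesian_product)
qed

text \<open>The elements \<open>y ^ j * x ^ i\<close> already form a subgroup of order \<open>p * ord x\<close>.\<close>

lemma carrier_eq_normal_forms:
  assumes p: "prime p" and G: "order G = p * ord x" "finite (carrier G)"
    and xy: "x \<in> carrier G" "y \<in> carrier G" "x \<otimes> y = y \<otimes> x [^] (r::nat)"
    and y: "y \<notin> generate G {x}" "y [^] p \<in> generate G {x}"
    and g: "g \<in> carrier G"
  shows "\<exists>(j::nat) (i::nat). g = y [^] j \<otimes> x [^] i"
proof -
  let ?H = "generate G {x}"
  let ?K = "(\<lambda>(j, h). y [^] j \<otimes> h) ` ({..<p} \<times> ?H)"
  have norm: "inv y \<otimes> h \<otimes> y \<in> ?H" if h: "h \<in> ?H" for h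
  proof -
    obtain i :: nat where i: "h = x [^] i" using h mem_generate_singleton_iff[OF G(2) xy(1)] by blast
    have "inv y \<otimes> h \<otimes> y = inv y \<otimes> (x [^] i \<otimes> y [^] (1::nat))"
      using i xy by (simp add: m_assoc)
    also have "\<dots> = x [^] (i * r)" using xy by (subst pow_mult_swap[OF xy]) (simp flip: m_assoc)
    finally show ?thesis using mem_generate_singleton_iff[OF G(2) xy(1)] by blast
  qed
  have "subgroup ?K G" "card ?K = p * card ?H"
    using subgroup_extension[OF p G(2) subgroup_generate_singleton[OF xy(1)] xy(2) y norm] by auto
  then have "?K = carrier G"
    using G generate_pow_card[OF xy(1)]
    by (intro card_subset_eq) (auto simp: order_def dest: subgroup.subset)
  then have "g \<in> ?K" using g by simp
  then obtain j h where h: "h \<in> ?H" "g = y [^] (j::nat) \<otimes> h" by auto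
  then obtain i :: nat where "h = x [^] i" using mem_generate_singleton_iff[OF G(2) xy(1)] by auto
  then show ?thesis using h by auto
qed

end

section \<open>Groups with a single subgroup of prime order\<close>

text \<open>The order is not part of the definition, because for a presented group it has to be derived from it. The
  conjugation relation is written as \<open>x y = y x ^ r\<close> so that it moves powers of \<open>y\<close> to the left.\<close>

definition metacyclic_gens ::
    "('a, 'b) monoid_scheme \<Rightarrow> nat \<Rightarrow> nat \<Rightarrow> nat \<Rightarrow> nat \<Rightarrow> 'a \<Rightarrow> 'a \<Rightarrow> bool" where
  "metacyclic_gens G p m r s x y \<longleftrightarrow> x \<in> carrier G \<and> y \<in> carrier G \<and>
     x [^]\<^bsub>G\<^esub> m = \<one>\<^bsub>G\<^esub> \<and> y [^]\<^bsub>G\<^esub> p = x [^]\<^bsub>G\<^esub> s \<and> x \<otimes>\<^bsub>G\<^esub> y = y \<otimes>\<^bsub>G\<^esub> x [^]\<^bsub>G\<^esub> r \<and>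
     (\<forall>g\<in>carrier G. \<exists>(j::nat) (i::nat). g = y [^]\<^bsub>G\<^esub> j \<otimes>\<^bsub>G\<^esub> x [^]\<^bsub>G\<^esub> i)"

context group
begin

text \<open>The subgroup \<open>\<langle>x\<rangle>\<close> alone provides \<open>p\<close> solutions.\<close>

lemma few_roots_subset_cyclic:
  assumes p: "prime p" and fin: "finite (carrier G)" and few: "card (roots_of_one G p) \<le> p"
    and x: "x \<in> carrier G" "p dvd ord x"
  shows "roots_of_one G p \<subseteq> generate G {x}"
proof -
  let ?R = "{g \<in> generate G {x}. g [^] p = \<one>}"
  have sub: "?R \<subseteq> roots_of_one G p"
    using subgroup.mem_carrier[OF subgroup_generate_singleton[OF x(1)]] by (auto simp: roots_of_one_def)
  have "?R = roots_of_one G p"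
    using few card_roots_of_one_in_cyclic[OF fin x] fin
    by (intro card_seteq[OF _ sub]) (auto simp: roots_of_one_def)
  then show ?thesis by blast
qed

text \<open>Otherwise some \<open>b\<close> in the centralizer is central modulo \<open>\<langle>x\<rangle>\<close>, with \<open>b ^ p\<close> in \<open>\<langle>x\<rangle>\<close>. If \<open>b ^ p\<close>
  generates \<open>\<langle>x\<rangle>\<close>, then \<open>\<langle>b\<rangle>\<close> is a larger normal cyclic subgroup. If not, \<open>b ^ p\<close> is the \<open>p\<close>-th power of an
  element of \<open>\<langle>x\<rangle>\<close>, and dividing \<open>b\<close> by it gives a solution of \<open>g ^ p = 1\<close> outside \<open>\<langle>x\<rangle>\<close>.\<close>

lemma centralizer_eq_if_maximal_normal_cyclic:
  assumes p: "prime p" and G: "order G = p ^ n" and few: "card (roots_of_one G p) \<le> p"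
    and x: "x \<in> carrier G" "generate G {x} \<lhd> G"
    and max: "\<And>z. z \<in> carrier G \<Longrightarrow> generate G {z} \<lhd> G \<Longrightarrow> ord z \<le> ord x"
    and c: "c \<in> carrier G" "x \<otimes> c = c \<otimes> x"
  shows "c \<in> generate G {x}"
proof (rule ccontr)
  assume cA: "c \<notin> generate G {x}"
  let ?A = "generate G {x}"
  have fin: "finite (carrier G)" by (rule finite_if_prime_power_order[OF p G])
  have subA: "subgroup ?A G" by (rule subgroup_generate_singleton[OF x(1)])
  have xA: "x \<in> ?A" by (simp add: generate.incl)
  define C where "C = {g \<in> carrier G. x \<otimes> g = g \<otimes> x}"
  have commute: "x [^] (i::nat) \<otimes> g = g \<otimes> x [^] i" if "g \<in> C" for i g
    using that x(1) pow_mult_swap[of x g 1 i 1] by (simp add: C_def)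
  have AC: "?A \<subseteq> C"
    using x(1)
    by (auto simp: C_def mem_generate_singleton_iff[OF fin x(1)] mult_pow_comm)
  have subC: "subgroup C G"
  proof (rule finite_subset_is_subgroup[OF fin])
    fix a b assume "a \<in> C" "b \<in> C"
    then show "a \<otimes> b \<in> C" using x(1) by (auto simp: C_def m_assoc) (metis m_assoc)
  qed (use x in \<open>auto simp: C_def\<close>)
  have "C \<lhd> G"
  proof (rule normal_inv_iff[THEN iffD2], intro conjI ballI)
    fix g h assume g: "g \<in> carrier G" and h: "h \<in> C"
    have hG: "h \<in> carrier G" using h by (simp add: C_def)
    have "inv g \<otimes> x \<otimes> g \<in> ?A" using normal.inv_op_closed1[OF x(2) g xA] .
    then obtain i :: nat where i: "inv g \<otimes> x \<otimes> g = x [^] i"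
      using mem_generate_singleton_iff[OF fin x(1)] by auto
    have xg: "x \<otimes> g = g \<otimes> x [^] i" using i g x(1)
      by (metis inv_solve_left m_assoc inv_closed m_closed)
    have "x [^] i \<otimes> inv g = inv g \<otimes> x"
      using i g x(1) by (metis inv_closed m_assoc m_closed r_inv r_one)
    then have "x \<otimes> (g \<otimes> h \<otimes> inv g) = g \<otimes> h \<otimes> inv g \<otimes> x"
      using xg commute[OF h, of i] g hG x(1) by (metis inv_closed m_assoc m_closed nat_pow_closed)
    then show "g \<otimes> h \<otimes> inv g \<in> C" using g hG by (simp add: C_def)
  qed (rule subC)
  moreover have "?A \<subset> C" using AC c cA by (auto simp: C_def)
  ultimately obtain b where b: "b \<in> C" "b \<notin> ?A" "b [^] p \<in> ?A"
    "\<And>g. g \<in> carrier G \<Longrightarrow> g \<otimes> b \<otimes> inv g \<in> ?A #> b"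
    using ex_central_mod_normal[OF p G x(2)] by blast
  then have bG: "b \<in> carrier G" by (simp add: C_def)
  have subB: "subgroup (generate G {b}) G" by (rule subgroup_generate_singleton[OF bG])
  have bB: "b \<in> generate G {b}" by (simp add: generate.incl)
  have "x \<in> generate G {b}"
  proof (rule ccontr)
    assume xB: "x \<notin> generate G {b}"
    obtain k where k: "ord x = p ^ k"
      using ord_dvd_group_order[OF x(1)] G p by (auto simp: divides_primepow_nat)
    have "x \<noteq> \<one>" using xB subgroup.one_closed[OF subB] by auto
    then have "k \<noteq> 0" using k ord_eq_1[OF x(1)] by auto
    then have "p dvd ord x" using k by simp
    obtain l :: nat where l: "b [^] p = x [^] l"
      using b(3) mem_generate_singleton_iff[OF fin x(1)] by auto
    have "p dvd l"
    proof (rule ccontr)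
      assume "\<not> p dvd l"
      then have "coprime l (ord x)" using p k by (metis coprime_commute coprime_power_right_iff prime_imp_coprime)
      then have "x \<in> generate G {b [^] p}" using pow_generates_if_coprime[OF fin x(1)] l by simp
      moreover have "generate G {b [^] p} \<subseteq> generate G {b}"
        by (intro generate_singleton_subset[OF subB] pow_mem_subgroup[OF subB bB])
      ultimately show False using xB by blast
    qed
    then obtain j where "l = p * j" by blast
    then obtain i :: nat where "(b \<otimes> x [^] i) [^] p = \<one>"
      using ex_pow_prime_eq_one_in_coset[OF p x(1) bG, of 1 k j] commute[OF b(1), of 1] l k pow_ord_eq_1[OF x(1)] x(1)
      by auto
    then have "b \<otimes> x [^] i \<in> ?A"
      using few_roots_subset_cyclic[OF p fin few x(1) \<open>p dvd ord x\<close>] bG x(1)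
      by (auto simp: roots_of_one_def)
    then show False using coset_mem_cancel[OF subA _ bG] pow_mem_subgroup[OF subA xA] b(2) by blast
  qed
  then have AB: "?A \<subseteq> generate G {b}" by (rule generate_singleton_subset[OF subB])
  have "generate G {b} \<lhd> G"
  proof (rule normal_generate_singletonI[OF fin bG])
    fix g assume "g \<in> carrier G"
    then obtain a where "a \<in> ?A" "g \<otimes> b \<otimes> inv g = a \<otimes> b"
      using b(4) by (force simp: r_coset_def)
    then show "g \<otimes> b \<otimes> inv g \<in> generate G {b}"
      using AB subgroup.m_closed[OF subB _ bB] by auto
  qed
  then have "ord b \<le> ord x" using max bG by blast
  moreover have "card ?A < card (generate G {b})"
    using AB b(2) bB fin subgroup.subset[OF subB] finite_subset by (intro psubset_card_mono) auto
  ultimately show False using generate_pow_card x(1) bG by simp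
qed

text \<open>As \<open>y\<close> does not commute with \<open>x\<close>, the power \<open>y ^ p\<close> does not generate \<open>\<langle>x\<rangle>\<close>. Since \<open>r ^ p = 1\<close>, always
  \<open>r = 1\<close> modulo \<open>p\<close>. For odd \<open>p\<close>, and for \<open>p = 2\<close> with \<open>r = 1\<close> modulo \<open>4\<close>, \<open>ex_pow_prime_eq_one_in_coset\<close> then
  gives a solution of \<open>g ^ p = 1\<close> outside \<open>\<langle>x\<rangle>\<close>, of which there is none. So \<open>p = 2\<close> and \<open>r = 3\<close> modulo \<open>4\<close>. As \<open>y\<^sup>2\<close>
  commutes with \<open>y\<close>, it has order at most \<open>2\<close>, and it is not \<open>1\<close>. Finally \<open>r = -1\<close> modulo \<open>2 ^ (k - 1)\<close>, and if not also modulo \<open>2 ^ k\<close>, then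
  \<open>y x\<close> would be a further involution.\<close>

lemma outside_self_centralizing_cyclic:
  assumes p: "prime p" and fin: "finite (carrier G)" and few: "card (roots_of_one G p) \<le> p"
    and x: "x \<in> carrier G" "ord x = p ^ k" "k > 0"
    and cent: "\<And>c. c \<in> carrier G \<Longrightarrow> x \<otimes> c = c \<otimes> x \<Longrightarrow> c \<in> generate G {x}"
    and y: "y \<in> carrier G" "y \<notin> generate G {x}" "y [^] p \<in> generate G {x}"
    and r: "x \<otimes> y = y \<otimes> x [^] (r::nat)"
  shows "p = 2" "k \<ge> 2" "y [^] (2::nat) = x [^] ((2::nat) ^ (k - 1))" "[r + 1 = 0] (mod 2 ^ k)"
proof -
  let ?A = "generate G {x}"
  have subA: "subgroup ?A G" by (rule subgroup_generate_singleton[OF x(1)])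
  have xA: "x [^] (i::nat) \<in> ?A" for i
    using mem_generate_singleton_iff[OF fin x(1)] by blast
  have pord: "p dvd ord x" using x by simp
  have no_root: "(y \<otimes> x [^] (i::nat)) [^] p \<noteq> \<one>" for i
  proof
    assume "(y \<otimes> x [^] i) [^] p = \<one>"
    then have "y \<otimes> x [^] i \<in> ?A"
      using few_roots_subset_cyclic[OF p fin few x(1) pord] y(1) x(1)
      by (auto simp: roots_of_one_def)
    then show False using coset_mem_cancel[OF subA xA y(1)] y(2) by blast
  qed
  have not1: "\<not> [r = 1] (mod p ^ k)"
  proof
    assume "[r = 1] (mod p ^ k)"
    then have "x [^] r = x [^] (1::nat)" by (simp only: pow_eq_iff_cong[OF fin x(1)] x(2))
    then have "x [^] r = x" using x(1) by (simp only: nat_pow_eone)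
    then have "x \<otimes> y = y \<otimes> x" using r by (simp only:)
    then show False using cent[OF y(1)] y(2) by blast
  qed
  obtain l :: nat where l: "y [^] p = x [^] l"
    using y(3) mem_generate_singleton_iff[OF fin x(1)] by auto
  have "p dvd l"
  proof (rule ccontr)
    assume "\<not> p dvd l"
    then have "coprime l (ord x)" using p x(2) by (metis coprime_commute coprime_power_right_iff prime_imp_coprime)
    then have "x \<in> generate G {y [^] p}" using pow_generates_if_coprime[OF fin x(1)] l by simp
    then obtain i :: nat where "x = (y [^] p) [^] i"
      using mem_generate_singleton_iff[OF fin, of "y [^] p"] y(1) by auto
    then have "x \<otimes> y = y \<otimes> x" using y(1) by (simp add: nat_pow_pow mult_pow_comm)
    then show False using cent y by blast
  qed
  then obtain j where j: "l = p * j" by blast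
  have "x [^] (1::nat) = x [^] (r ^ p)"
  proof -
    have "x [^] l \<otimes> x = x [^] l \<otimes> x [^] (r ^ p)"
      using pow_mult_swap[OF x(1) y(1) r, of 1 p] x(1) by (simp add: l mult_pow_comm)
    then show ?thesis using x(1) by simp
  qed
  then have rp: "[r ^ p = 1] (mod p ^ k)"
    using pow_eq_iff_cong[OF fin x(1)] x(2) by (metis cong_sym)
  then have r1: "[r = 1] (mod p)" using cong_1_if_pow_prime_cong_1[OF p _ x(3)] by blast
  have bad: "\<not> (p = 2 \<longrightarrow> [r = 1] (mod 4))"
  proof
    assume "p = 2 \<longrightarrow> [r = 1] (mod 4)"
    then obtain i :: nat where "(y \<otimes> x [^] i) [^] p = \<one>"
      using ex_pow_prime_eq_one_in_coset[OF p x(1) y(1) r r1, of k j] l j x(2) pow_ord_eq_1[OF x(1)]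
      by auto
    then show False using no_root by blast
  qed
  then show p2: "p = 2" by blast
  have r3: "r mod 4 = 3"
  proof -
    have "r mod 2 = 1" "r mod 4 \<noteq> 1" using r1 bad p2 by (auto simp: cong_def)
    then show ?thesis by presburger
  qed
  show k2: "k \<ge> 2"
  proof (rule ccontr)
    assume "\<not> k \<ge> 2"
    then have "k = 1" using x(3) by simp
    then show False using r1 not1 by simp
  qed
  obtain q where q: "r = 4 * q + 3" using r3 by (metis mult_div_mod_eq)
  have pk: "(2::nat) ^ k = 2 * 2 ^ (k - 1)" using k2 by (cases k) auto
  have "[l = l * r] (mod 2 ^ k)"
  proof -
    have "y \<otimes> x [^] l = y \<otimes> x [^] (l * r)"
      using pow_mult_swap[OF x(1) y(1) r, of l 1] y(1) mult_pow_comm[OF y(1), of p]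
      by (simp add: l)
    then have "x [^] l = x [^] (l * r)" using x(1) y(1) by simp
    then show ?thesis using pow_eq_iff_cong[OF fin x(1)] x(2) p2 by simp
  qed
  moreover have "l \<le> l * r" using q by simp
  ultimately have "2 ^ k dvd l * r - l" using cong_altdef_nat cong_sym by blast
  also have "l * r - l = 2 * (l * (2 * q + 1))" using q by (simp add: algebra_simps)
  finally have "2 ^ (k - 1) dvd l * (2 * q + 1)"
    unfolding pk by (subst (asm) dvd_times_left_cancel_iff) auto
  moreover have odd: "coprime (2 ^ (k - 1)) (2 * q + 1)" by simp
  ultimately have "2 ^ (k - 1) dvd l" using coprime_dvd_mult_left_iff by blast
  then obtain c where c: "l = 2 ^ (k - 1) * c" by blast
  have "odd c"
  proof
    assume "even c"
    then have "2 ^ k dvd l" using c pk by auto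
    then have "y [^] p = \<one>" using l x p2 by (simp add: pow_eq_id)
    then show False using no_root[of 0] y(1) by simp
  qed
  then obtain d where d: "c = 2 * d + 1" by (elim oddE)
  have "[l = 2 ^ (k - 1)] (mod 2 ^ k)"
    unfolding c d pk by (simp add: algebra_simps cong_def)
  then show y2: "y [^] (2::nat) = x [^] ((2::nat) ^ (k - 1))"
    using pow_eq_iff_cong[OF fin x(1)] x(2) l p2 by metis
  have "2 ^ (k - 1) dvd r + 1"
    using dvd_Suc_if_square_cong_1[OF r3, of "k - 1"] rp p2 k2 by simp
  then obtain e where e: "r + 1 = 2 ^ (k - 1) * e" by blast
  have "even e"
  proof (rule ccontr)
    assume "odd e"
    then obtain d where d: "e = 2 * d + 1" by (elim oddE)
    have "(y \<otimes> x [^] (1::nat)) [^] (2::nat) = y [^] (2::nat) \<otimes> x [^] (r + 1)"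
      unfolding normal_form_pow[OF x(1) y(1) r] by (simp add: numeral_2_eq_2)
    also have "\<dots> = x [^] (2 ^ (k - 1) + (r + 1))" unfolding y2 using x(1) by (simp only: nat_pow_mult)
    also have "2 ^ (k - 1) + (r + 1) = 2 ^ k * (d + 1)" unfolding e d pk by (simp add: algebra_simps)
    also have "x [^] (2 ^ k * (d + 1)) = \<one>" using x p2 by (simp add: pow_eq_id)
    finally show False using no_root[of 1] p2 by simp
  qed
  then have "2 ^ k dvd r + 1" unfolding e pk by auto
  then show "[r + 1 = 0] (mod 2 ^ k)" by (simp add: cong_0_iff)
qed

lemma ex_conj_exponent:
  assumes "finite (carrier G)" "x \<in> carrier G" "generate G {x} \<lhd> G" "y \<in> carrier G"
  shows "\<exists>r::nat. x \<otimes> y = y \<otimes> x [^] r"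
proof -
  have "inv y \<otimes> x \<otimes> y \<in> generate G {x}"
    using normal.inv_op_closed1[OF assms(3,4)] by (simp add: generate.incl)
  then obtain r :: nat where "inv y \<otimes> x \<otimes> y = x [^] r"
    using mem_generate_singleton_iff assms(1,2) by auto
  then have "x \<otimes> y = y \<otimes> x [^] r"
    using assms(2,4) by (metis inv_solve_left m_assoc inv_closed m_closed)
  then show ?thesis by blast
qed

text \<open>Let \<open>\<langle>x\<rangle>\<close> be a normal cyclic subgroup of largest order. By \<open>outside_self_centralizing_cyclic\<close> it is the whole group
  unless \<open>p = 2\<close>, and elements outside it whose square lies inside invert \<open>x\<close>. If the square of some outside element were not inside, a power of that square would
  invert \<open>x\<close>, making \<open>-1\<close> a square modulo \<open>4\<close>. So all outside elements invert \<open>x\<close>, any two of them differ by an element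
  that commutes with \<open>x\<close>, and \<open>\<langle>x\<rangle>\<close> has index \<open>2\<close>.\<close>

lemma cyclic_or_quaternion_if_few_roots:
  assumes p: "prime p" and G: "order G = p ^ n" and few: "card (roots_of_one G p) \<le> p"
  shows "(\<exists>x\<in>carrier G. ord x = p ^ n) \<or>
    p = 2 \<and> n \<ge> 3 \<and> (\<exists>x y. metacyclic_gens G 2 (2 ^ (n - 1)) (2 ^ (n - 1) - 1) (2 ^ (n - 2)) x y)"
proof -
  have fin: "finite (carrier G)" by (rule finite_if_prime_power_order[OF p G])
  have "\<one> \<in> carrier G \<and> generate G {\<one>} \<lhd> G" using one_is_normal by (simp add: generate_one)
  moreover have "\<forall>z. z \<in> carrier G \<and> generate G {z} \<lhd> G \<longrightarrow> ord z < Suc (order G)"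
    using ord_dvd_group_order fin by (simp add: dvd_imp_le order_gt_0_iff_finite less_Suc_eq_le)
  ultimately have "\<exists>x. (x \<in> carrier G \<and> generate G {x} \<lhd> G) \<and>
      (\<forall>z. z \<in> carrier G \<and> generate G {z} \<lhd> G \<longrightarrow> ord z \<le> ord x)"
    by (rule Lattices_Big.ex_has_greatest_nat)
  then obtain x where x: "x \<in> carrier G" "generate G {x} \<lhd> G"
    and max: "\<And>z. z \<in> carrier G \<Longrightarrow> generate G {z} \<lhd> G \<Longrightarrow> ord z \<le> ord x" by blast
  let ?A = "generate G {x}"
  have subA: "subgroup ?A G" by (rule subgroup_generate_singleton[OF x(1)])
  have xA: "x [^] (i::nat) \<in> ?A" for i
    using mem_generate_singleton_iff[OF fin x(1)] by blast
  obtain k where k: "ord x = p ^ k" "k \<le> n"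
    using ord_dvd_group_order[OF x(1)] G p by (auto simp: divides_primepow_nat)
  have cent: "c \<in> ?A" if "c \<in> carrier G" "x \<otimes> c = c \<otimes> x" for c
    by (rule centralizer_eq_if_maximal_normal_cyclic[OF p G few x max that])
  show ?thesis
  proof (cases "?A = carrier G")
    case True
    then have "ord x = p ^ n" using G generate_pow_card[OF x(1)] by (simp add: order_def)
    then show ?thesis using x(1) by blast
  next
    case False
    have "k > 0"
    proof (rule ccontr)
      assume "\<not> k > 0"
      then have "x = \<one>" using k(1) ord_eq_1[OF x(1)] by simp
      then show False using cent False subgroup.subset[OF subA] by auto
    qed
    have key: "p = 2 \<and> k \<ge> 2 \<and> y [^] (2::nat) = x [^] ((2::nat) ^ (k - 1)) \<and>
        (\<forall>r::nat. x \<otimes> y = y \<otimes> x [^] r \<longrightarrow> [r + 1 = 0] (mod 2 ^ k))"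
      if y: "y \<in> carrier G" "y \<notin> ?A" "y [^] p \<in> ?A" for y
    proof -
      note out = outside_self_centralizing_cyclic[OF p fin few x(1) k(1) \<open>k > 0\<close> _ y, OF cent]
      obtain r :: nat where r: "x \<otimes> y = y \<otimes> x [^] r" using ex_conj_exponent[OF fin x y(1)] by blast
      show ?thesis
        using out(1-3)[OF _ _ r] out(4) by simp
    qed
    obtain g where g: "g \<in> carrier G" "g \<notin> ?A"
      using False subgroup.subset[OF subA] by blast
    obtain j where "g [^] (p ^ j) \<notin> ?A" "(g [^] (p ^ j)) [^] p \<in> ?A"
      using ex_prime_power_pow_leaving[OF G subA g] by blast
    then have p2: "p = 2" and k2: "k \<ge> 2" using key[of "g [^] (p ^ j)"] g(1) by auto
    have square: "g [^] (2::nat) \<in> ?A" if g: "g \<in> carrier G" "g \<notin> ?A" for g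
    proof (rule ccontr)
      assume notA: "g [^] (2::nat) \<notin> ?A"
      then obtain j where j: "(g [^] (2::nat)) [^] ((2::nat) ^ j) \<notin> ?A" "((g [^] (2::nat)) [^] ((2::nat) ^ j)) [^] (2::nat) \<in> ?A"
        using ex_prime_power_pow_leaving[OF G subA, of "g [^] (2::nat)"] g(1) p2 by auto
      \<comment> \<open>Now \<open>f\<^sup>2\<close> inverts \<open>x\<close>.\<close>
      define f where "f = g [^] ((2::nat) ^ j)"
      have f: "f \<in> carrier G" using g by (simp add: f_def)
      have "(g [^] (2::nat)) [^] ((2::nat) ^ j) = f [^] (2::nat)"
        using g by (simp add: f_def nat_pow_pow mult.commute)
      then have f2: "f [^] (2::nat) \<notin> ?A" "(f [^] (2::nat)) [^] (2::nat) \<in> ?A" using j by auto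
      obtain r :: nat where r: "x \<otimes> f = f \<otimes> x [^] r" using ex_conj_exponent[OF fin x f] by blast
      then have "x \<otimes> f [^] (2::nat) = f [^] (2::nat) \<otimes> x [^] (r ^ 2)"
        using pow_mult_swap[OF x(1) f r, of 1 2] x(1) by simp
      then have "[r ^ 2 + 1 = 0] (mod 2 ^ k)" using key[of "f [^] (2::nat)"] f f2 p2 by blast
      moreover have "(4::nat) dvd 2 ^ k" using k2 le_imp_power_dvd[of 2 k "2::nat"] by simp
      ultimately have "4 dvd r ^ 2 + 1" by (metis cong_0_iff dvd_trans)
      moreover have "\<not> 4 dvd r ^ 2 + 1"
      proof (cases "even r")
        case True
        then obtain m where "r = 2 * m" by blast
        then have "r ^ 2 + 1 = 4 * m ^ 2 + 1" by (simp add: power2_eq_square)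
        then show ?thesis by presburger
      next
        case False
        then obtain m where "r = 2 * m + 1" by (elim oddE)
        then have "r ^ 2 + 1 = 4 * (m ^ 2 + m) + 2" by (simp add: power2_eq_square algebra_simps)
        then show ?thesis by presburger
      qed
      ultimately show False by blast
    qed
    obtain r :: nat where r: "x \<otimes> g = g \<otimes> x [^] r" using ex_conj_exponent[OF fin x g(1)] by blast
    have g2: "g [^] (2::nat) = x [^] ((2::nat) ^ (k - 1))" and r0: "[r + 1 = 0] (mod 2 ^ k)"
      using key[OF g] square[OF g] p2 r by auto
    have coset: "\<exists>j<2. \<exists>h\<in>?A. a = g [^] (j::nat) \<otimes> h" if a: "a \<in> carrier G" for a
    proof (cases "a \<in> ?A")
      case True
      then show ?thesis using a by (intro exI[of _ 0] conjI bexI[of _ a]) auto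
    next
      case False
      obtain q :: nat where q: "x \<otimes> a = a \<otimes> x [^] q" using ex_conj_exponent[OF fin x a] by blast
      have q0: "[q + 1 = 0] (mod 2 ^ k)" using key[OF a False] square[OF a False] p2 q by auto
      \<comment> \<open>Both \<open>g\<close> and \<open>a\<close> invert \<open>x\<close>, so \<open>inv g * a\<close> commutes with \<open>x\<close>.\<close>
      have "inv g \<otimes> a \<in> ?A"
      proof (rule cent)
        have "[r = q] (mod 2 ^ k)" 
          using cong_trans[OF r0 cong_sym[OF q0]] by (simp only: cong_add_rcancel_nat)
        then have rq: "x [^] r = x [^] q" using pow_eq_iff_cong[OF fin x(1)] k(1) p2 by simp
        have "g \<otimes> (x [^] r \<otimes> (inv g \<otimes> a)) = (x \<otimes> g) \<otimes> (inv g \<otimes> a)"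
          using r x(1) g(1) a by (simp add: m_assoc)
        also have "\<dots> = a \<otimes> x [^] r"
          using q rq x(1) g(1) a by (simp add: m_assoc) (simp add: q flip: m_assoc)
        finally have comm: "x [^] r \<otimes> (inv g \<otimes> a) = (inv g \<otimes> a) \<otimes> x [^] r"
          using x(1) g(1) a by (metis inv_closed inv_solve_left m_assoc m_closed nat_pow_closed)
        have "[r * r = 1] (mod 2 ^ k)"
        proof -
          have "[r * r + r = 0] (mod 2 ^ k)"
            using cong_mult[OF cong_refl[of r] r0] by (simp add: algebra_simps)
          then have "[r * r + r = 1 + r] (mod 2 ^ k)"
            using cong_trans[OF _ cong_sym[OF r0]] by (simp only: add.commute[of 1])
          then show ?thesis by (simp only: cong_add_rcancel_nat)
        qed
        then have "(x [^] r) [^] r = x"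
          using pow_eq_iff_cong[OF fin x(1), of "r * r" 1] x(1) k(1) p2 by (simp add: nat_pow_pow)
        moreover have "(x [^] r) [^] r \<otimes> (inv g \<otimes> a) = (inv g \<otimes> a) \<otimes> (x [^] r) [^] r"
          using pow_mult_swap[of "x [^] r" "inv g \<otimes> a" 1 r 1] comm x(1) g(1) a by simp
        ultimately show "x \<otimes> (inv g \<otimes> a) = (inv g \<otimes> a) \<otimes> x" by simp
      qed (use g a in auto)
      moreover have "a = g [^] (1::nat) \<otimes> (inv g \<otimes> a)" using g(1) a by (simp flip: m_assoc)
      ultimately show ?thesis by (meson one_less_numeral_iff semiring_norm(76))
    qed
    have span: "\<exists>(j::nat) (i::nat). a = g [^] j \<otimes> x [^] i" if "a \<in> carrier G" for a
      using coset[OF that] mem_generate_singleton_iff[OF fin x(1)] by metis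
    have "inv g \<otimes> h \<otimes> g \<in> ?A" if "h \<in> ?A" for h
      using normal.inv_op_closed1[OF x(2) g(1) that] .
    then have "card ((\<lambda>(j, h). g [^] j \<otimes> h) ` ({..<2::nat} \<times> ?A)) = 2 * card ?A"
      using subgroup_extension(2)[OF _ fin subA g, of 2] square[OF g] by auto
    moreover have "(\<lambda>(j, h). g [^] (j::nat) \<otimes> h) ` ({..<2::nat} \<times> ?A) = carrier G"
      using coset g(1) subgroup.mem_carrier[OF subA] by force
    ultimately have "2 ^ n = 2 * (2::nat) ^ k"
      using G k(1) p2 generate_pow_card[OF x(1)] by (simp add: order_def)
    then have "2 ^ n = (2::nat) ^ Suc k" by simp
    then have n: "n = Suc k" by (rule power_inject_exp[THEN iffD1, rotated]) simp
    have "[r = 2 ^ k - 1] (mod 2 ^ k)"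
    proof -
      have "[r + 1 = (2 ^ k - 1) + 1] (mod 2 ^ k)" using r0 by (simp add: cong_def)
      then show ?thesis by (simp only: cong_add_rcancel_nat)
    qed
    then have "x [^] r = x [^] ((2::nat) ^ k - 1)"
      using pow_eq_iff_cong[OF fin x(1)] k(1) p2 by simp
    then have "metacyclic_gens G 2 (2 ^ k) (2 ^ k - 1) (2 ^ (k - 1)) x g"
      using x(1) g(1) r g2 span pow_ord_eq_1[OF x(1)] k(1) p2 by (auto simp: metacyclic_gens_def)
    then show ?thesis using p2 k2 n by auto
  qed
qed

end

section \<open>Many solutions of $g^{p^k} = 1$\<close>

context group
begin

text \<open>One step of the chain adjoins an element outside \<open>H\<close> that normalizes \<open>H\<close> and has its \<open>p\<close>-th power in \<open>H\<close>.\<close>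

lemma ex_intermediate_subgroup:
  assumes p: "prime p" and G: "order G = p ^ n"
    and E: "subgroup E G" "card E = p ^ e" and k: "e \<le> k" "k \<le> n"
  shows "\<exists>H. subgroup H G \<and> E \<subseteq> H \<and> card H = p ^ k"
  using k
proof (induction k rule: dec_induct)
  case (step k)
  then obtain H where H: "subgroup H G" "E \<subseteq> H" "card H = p ^ k" by auto
  have fin: "finite (carrier G)" by (rule finite_if_prime_power_order[OF p G])
  have "p ^ k < p ^ n" using step.prems step.hyps prime_gt_1_nat[OF p] by (intro power_strict_increasing) auto
  then have "H \<noteq> carrier G" using H(3) G by (auto simp: order_def)
  then obtain g where g: "g \<in> carrier G" "g \<notin> H" "g [^] p \<in> H" "\<And>h. h \<in> H \<Longrightarrow> inv g \<otimes> h \<otimes> g \<in> H"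
    using ex_normalizing_outside_proper_subgroup[OF p G H(1)] by blast
  let ?K = "(\<lambda>(j, h). g [^] j \<otimes> h) ` ({..<p} \<times> H)"
  have "subgroup ?K G" "card ?K = p * card H"
    using subgroup_extension[OF p fin H(1) g] by auto
  moreover have "H \<subseteq> ?K"
  proof
    fix h assume h: "h \<in> H"
    then have "h = g [^] (0::nat) \<otimes> h" using subgroup.mem_carrier[OF H(1)] by simp
    then show "h \<in> ?K" using h prime_gt_0_nat[OF p] by (intro image_eqI[of _ _ "(0, h)"]) auto
  qed
  ultimately show ?case using H by (intro exI[of _ ?K]) auto
qed (use E in auto)

text \<open>A central element \<open>z\<close> of order \<open>p\<close> and another solution \<open>g\<close> of \<open>g ^ p = 1\<close> span a subgroup \<open>E\<close> with \<open>p\<^sup>2\<close>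
  elements, all of which satisfy \<open>a ^ p = 1\<close>. A cyclic group has only \<open>p\<close> such elements, so a subgroup of order \<open>p ^ (k + 1)\<close>
  that contains \<open>E\<close> is not cyclic, and all its elements solve \<open>h ^ (p ^ k) = 1\<close>.\<close>

lemma card_roots_of_one_ge:
  assumes p: "prime p" and G: "order G = p ^ n" and many: "card (roots_of_one G p) > p"
    and k: "1 \<le> k" "k < n"
  shows "card (roots_of_one G (p ^ k)) \<ge> p ^ (k + 1)"
proof -
  have fin: "finite (carrier G)" by (rule finite_if_prime_power_order[OF p G])
  have p1: "p > 1" using p by (rule prime_gt_1_nat)
  have "1 < p ^ n" using p1 k by (intro one_less_power) auto
  then have "carrier G \<noteq> {\<one>}" 
    using G order_one_triv_iff by force
  then have "{\<one>} \<subset> carrier G" by auto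
  moreover have "carrier G \<lhd> G" by (auto simp: normal_inv_iff intro: subgroup_self)
  ultimately obtain z where "z \<in> carrier G - {\<one>}" "z [^] p \<in> {\<one>}"
    "\<forall>g\<in>carrier G. g \<otimes> z \<otimes> inv g \<in> {\<one>} #> z"
    using ex_central_mod_normal[OF p G one_is_normal, of "carrier G"] by auto
  then have z: "z \<in> carrier G" "z \<noteq> \<one>" "z [^] p = \<one>"
    "\<And>g. g \<in> carrier G \<Longrightarrow> g \<otimes> z \<otimes> inv g \<in> {\<one>} #> z" by auto
  have central: "z \<otimes> g = g \<otimes> z" if g: "g \<in> carrier G" for g
  proof -
    have "g \<otimes> z \<otimes> inv g = z" using z(1) z(4)[OF g] by (auto simp: r_coset_def)
    then show ?thesis using g z(1) by (metis inv_solve_right' m_closed)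
  qed
  let ?H = "generate G {z}"
  have subH: "subgroup ?H G" by (rule subgroup_generate_singleton[OF z(1)])
  have "ord z dvd p" using z by (simp add: pow_eq_id)
  then have "ord z = p" using p z(2) ord_eq_1[OF z(1)] by (auto simp: prime_nat_iff)
  then have cardH: "card ?H = p" using generate_pow_card[OF z(1)] by simp
  have finH: "finite ?H" using subgroup.subset[OF subH] fin finite_subset by blast
  have "\<not> roots_of_one G p \<subseteq> ?H"
    using many cardH card_mono[OF finH, of "roots_of_one G p"] by auto
  then obtain g where g: "g \<in> carrier G" "g [^] p = \<one>" "g \<notin> ?H" by (auto simp: roots_of_one_def)
  have Hz: "\<exists>i::nat. h = z [^] i" if "h \<in> ?H" for h
    using that mem_generate_singleton_iff[OF fin z(1)] by blast
  let ?E = "(\<lambda>(j, h). g [^] j \<otimes> h) ` ({..<p} \<times> ?H)"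
  have norm: "inv g \<otimes> h \<otimes> g \<in> ?H" if h: "h \<in> ?H" for h
  proof -
    obtain i :: nat where i: "h = z [^] i" using Hz[OF h] by blast
    have "h \<otimes> g = g \<otimes> h"
      using pow_mult_swap[of z g 1 i 1] central[OF g(1)] i z(1) g(1) by simp
    then have "inv g \<otimes> h \<otimes> g = h" using g(1) i z(1) by (simp add: m_assoc) (simp flip: m_assoc)
    then show ?thesis using h by simp
  qed
  have gp: "g [^] p \<in> ?H" using g(2) subgroup.one_closed[OF subH] by simp
  have E: "subgroup ?E G" "card ?E = p ^ 2"
    using subgroup_extension[OF p fin subH g(1,3) gp norm] cardH by (auto simp: power2_eq_square)
  have rootE: "a [^] p = \<one>" if "a \<in> ?E" for a
  proof -
    obtain j h where jh: "h \<in> ?H" "a = g [^] (j::nat) \<otimes> h" using \<open>a \<in> ?E\<close> by auto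
    then obtain i :: nat where i: "h = z [^] i" using Hz by blast
    have "z \<otimes> g [^] j = g [^] j \<otimes> z [^] (1::nat)" using central z(1) g(1) by simp
    then have "a [^] p = (g [^] j) [^] p \<otimes> z [^] (i * (\<Sum>t<p. 1 ^ t))"
      using normal_form_pow[of z "g [^] j" 1 i p] z(1) g(1) jh i by simp
    also have "\<dots> = (g [^] p) [^] j \<otimes> (z [^] p) [^] i"
      using g(1) z(1) by (simp add: nat_pow_pow mult.commute)
    finally show ?thesis using g z by simp
  qed
  obtain H where H: "subgroup H G" "?E \<subseteq> H" "card H = p ^ (k + 1)"
    using ex_intermediate_subgroup[OF p G E, of "k + 1"] k by auto
  have "H \<subseteq> roots_of_one G (p ^ k)"
  proof
    fix h assume h: "h \<in> H"
    then have hG: "h \<in> carrier G" using subgroup.mem_carrier[OF H(1)] by blast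
    have sub: "generate G {h} \<subseteq> H" using h by (rule generate_singleton_subset[OF H(1)])
    have "group (G\<lparr>carrier := H\<rparr>)" using H(1) by (rule subgroup_imp_group)
    then have "h [^]\<^bsub>G\<lparr>carrier := H\<rparr>\<^esub> card H = \<one>"
      using group.pow_order_eq_1[of "G\<lparr>carrier := H\<rparr>" h] h by (simp add: order_def)
    then have "h [^] (p ^ (k + 1)) = \<one>" using H(3) by (simp flip: nat_pow_consistent)
    then have "ord h dvd p ^ (k + 1)" using hG by (simp add: pow_eq_id)
    then obtain i where i: "ord h = p ^ i" "i \<le> k + 1" unfolding divides_primepow_nat[OF p] by blast
    have "i \<noteq> k + 1"
    proof
      assume "i = k + 1"
      then have "card (generate G {h}) = card H" using i H(3) generate_pow_card[OF hG] by simp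
      then have "generate G {h} = H"
        using sub fin subgroup.subset[OF H(1)] by (metis card_subset_eq finite_subset)
      then have "?E \<subseteq> {g \<in> generate G {h}. g [^] p = \<one>}" using H(2) rootE by blast
      moreover have "card {g \<in> generate G {h}. g [^] p = \<one>} = p"
        using card_roots_of_one_in_cyclic[OF fin hG, of p] i \<open>i = k + 1\<close> by simp
      ultimately have "card ?E \<le> p" using p1 by (metis (no_types, lifting) card_mono card_ge_0_finite less_trans zero_less_one)
      then show False using E(2) p1 by (simp add: power2_eq_square)
    qed
    then have "ord h dvd p ^ k" using i by (simp add: le_imp_power_dvd)
    then show "h \<in> roots_of_one G (p ^ k)" using hG by (simp add: roots_of_one_def pow_eq_id)
  qed
  then show ?thesis using H(3) fin card_mono[of "roots_of_one G (p ^ k)" H]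
    by (simp add: roots_of_one_def)
qed

end

section \<open>Metacyclic groups are determined by their parameters\<close>

text \<open>The pair \<open>(j, i)\<close> stands for \<open>y ^ j * x ^ i\<close>. When the exponents of \<open>y\<close> overflow, \<open>y ^ p = x ^ s\<close> contributes
  the carry \<open>s * ((j + j') div p)\<close>.\<close>

definition metacyclic_op :: "nat \<Rightarrow> nat \<Rightarrow> nat \<Rightarrow> nat \<Rightarrow> nat \<times> nat \<Rightarrow> nat \<times> nat \<Rightarrow> nat \<times> nat" where
  "metacyclic_op p m r s = (\<lambda>(j, i) (j', i').
     ((j + j') mod p, (i * r ^ j' + i' + s * ((j + j') div p)) mod m))"

definition metacyclic_model :: "nat \<Rightarrow> nat \<Rightarrow> nat \<Rightarrow> nat \<Rightarrow> (nat \<times> nat) monoid" where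
  "metacyclic_model p m r s =
     \<lparr>carrier = {..<p} \<times> {..<m}, monoid.mult = metacyclic_op p m r s, one = (0, 0)\<rparr>"

lemma pow_cong_1_reduce:
  fixes r p m :: nat
  assumes "[r ^ p = 1] (mod m)"
  shows "[r ^ (a mod p) = r ^ a] (mod m)"
proof -
  have "[(r ^ p) ^ (a div p) * r ^ (a mod p) = 1 ^ (a div p) * r ^ (a mod p)] (mod m)"
    by (intro cong_mult cong_pow assms cong_refl)
  then show ?thesis by (simp add: cong_sym_eq flip: power_mult power_add)
qed

text \<open>Both sides are \<open>(a + b + c) div p\<close>: the carries of a sum do not depend on the order of the additions.\<close>

lemma carry_assoc:
  fixes a b c p :: nat
  shows "(a + b) div p + ((a + b) mod p + c) div p = (b + c) div p + (a + (b + c) mod p) div p"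
proof (cases "p = 0")
  case False
  have "(a + b + c) div p = (a + b) div p + ((a + b) mod p + c) div p"
    using div_mult_self1[of p "(a + b) mod p + c" "(a + b) div p"] False
    by (metis add.commute add.left_commute div_mult_mod_eq)
  moreover have "(a + b + c) div p = (b + c) div p + (a + (b + c) mod p) div p"
    using div_mult_self1[of p "a + (b + c) mod p" "(b + c) div p"] False
    by (metis add.commute add.left_commute div_mult_mod_eq)
  ultimately show ?thesis by simp
qed simp

text \<open>The two congruences say that conjugation by \<open>y ^ p = x ^ s\<close> is trivial on \<open>x\<close> and that \<open>y\<close> commutes with its own power
  \<open>y ^ p\<close>.\<close>

lemma group_metacyclic_model:
  assumes pm: "p > 0" "m > 0" and r: "[r ^ p = 1] (mod m)" and s: "[s * r = s] (mod m)"
  shows "group (metacyclic_model p m r s)"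
proof (rule groupI)
  have srt: "[s * r ^ t = s] (mod m)" for t
  proof (induction t)
    case (Suc t)
    have "[s * r ^ t * r = s * r] (mod m)" using Suc by (rule cong_mult) simp
    then show ?case using s by (metis cong_trans mult.assoc power_Suc2)
  qed simp
  fix a b c
  assume abc: "a \<in> carrier (metacyclic_model p m r s)" "b \<in> carrier (metacyclic_model p m r s)"
    "c \<in> carrier (metacyclic_model p m r s)"
  obtain j i j' i' k l where e: "a = (j, i)" "b = (j', i')" "c = (k, l)"
    by (metis surj_pair)
  let ?u = "i * r ^ j' + i' + s * ((j + j') div p)"
  let ?v = "i' * r ^ k + l + s * ((j' + k) div p)"
  have "[(?u mod m) * r ^ k + l + s * (((j + j') mod p + k) div p)
      = ?u * r ^ k + l + s * (((j + j') mod p + k) div p)] (mod m)"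
    by (intro cong_add cong_mult cong_refl) (simp add: cong_def)
  also have "?u * r ^ k + l + s * (((j + j') mod p + k) div p)
      = i * r ^ (j' + k) + i' * r ^ k + l + (s * r ^ k) * ((j + j') div p) + s * (((j + j') mod p + k) div p)"
    by (simp add: algebra_simps power_add)
  also have "[\<dots> = i * r ^ (j' + k) + i' * r ^ k + l + s * ((j + j') div p) + s * (((j + j') mod p + k) div p)] (mod m)"
    by (intro cong_add cong_mult cong_refl srt)
  also have "i * r ^ (j' + k) + i' * r ^ k + l + s * ((j + j') div p) + s * (((j + j') mod p + k) div p)
      = i * r ^ (j' + k) + ?v + s * ((j + (j' + k) mod p) div p)"
    using carry_assoc[of j j' p k] by (simp add: add.assoc flip: add_mult_distrib2)
  also have "[\<dots> = i * r ^ ((j' + k) mod p) + (?v mod m) + s * ((j + (j' + k) mod p) div p)] (mod m)"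
    by (intro cong_add cong_mult cong_refl cong_sym[OF pow_cong_1_reduce[OF r]]) (simp add: cong_def)
  finally show "a \<otimes>\<^bsub>metacyclic_model p m r s\<^esub> b \<otimes>\<^bsub>metacyclic_model p m r s\<^esub> c =
      a \<otimes>\<^bsub>metacyclic_model p m r s\<^esub> (b \<otimes>\<^bsub>metacyclic_model p m r s\<^esub> c)"
    by (simp add: e metacyclic_model_def metacyclic_op_def cong_def mod_add_left_eq mod_add_right_eq add.assoc)
next
  fix a assume a: "a \<in> carrier (metacyclic_model p m r s)"
  obtain j i where e: "a = (j, i)" "j < p" "i < m" using a by (auto simp: metacyclic_model_def)
  let ?j = "(p - j) mod p"
  let ?z = "i + s * ((?j + j) div p)"
  \<comment> \<open>The inverse of \<open>r ^ j\<close> modulo \<open>m\<close> is \<open>r ^ (p - j)\<close>, and \<open>m - 1\<close> stands for \<open>-1\<close>.\<close>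
  let ?i = "((m - 1) * ?z * r ^ (p - j)) mod m"
  have "[?i * r ^ j + ?z = (m - 1) * ?z * r ^ (p - j) * r ^ j + ?z] (mod m)"
    by (intro cong_add cong_mult cong_refl) (simp add: cong_def)
  also have "(m - 1) * ?z * r ^ (p - j) * r ^ j = (m - 1) * ?z * r ^ p"
    using e by (simp add: mult.assoc flip: power_add)
  also have "[\<dots> + ?z = (m - 1) * ?z * 1 + ?z] (mod m)"
    by (intro cong_add cong_mult cong_refl r)
  also have "(m - 1) * ?z * 1 + ?z = m * ?z"
    using pm(2) by (cases m) auto
  finally have "(?i * r ^ j + ?z) mod m = 0" by (simp add: cong_def)
  moreover have "(?j + j) mod p = 0" using e by (simp add: mod_add_left_eq)
  ultimately have "(?j, ?i) \<otimes>\<^bsub>metacyclic_model p m r s\<^esub> a = \<one>\<^bsub>metacyclic_model p m r s\<^esub>"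
    using e by (simp add: metacyclic_model_def metacyclic_op_def add.assoc)
  moreover have "(?j, ?i) \<in> carrier (metacyclic_model p m r s)"
    using pm by (simp add: metacyclic_model_def)
  ultimately show "\<exists>b\<in>carrier (metacyclic_model p m r s).
      b \<otimes>\<^bsub>metacyclic_model p m r s\<^esub> a = \<one>\<^bsub>metacyclic_model p m r s\<^esub>" by blast
qed (use pm in \<open>auto simp: metacyclic_model_def metacyclic_op_def\<close>)

lemma metacyclic_gens_model:
  assumes pm: "p > 1" "m > 1" and r: "[r ^ p = 1] (mod m)" and s: "[s * r = s] (mod m)"
  shows "metacyclic_gens (metacyclic_model p m r s) p m r s (0, 1) (1, 0)"
    and "order (metacyclic_model p m r s) = p * m"
proof -
  let ?K = "metacyclic_model p m r s"
  interpret K: group ?K using pm by (intro group_metacyclic_model r s) auto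
  have xp: "(0, 1) [^]\<^bsub>?K\<^esub> k = (0, k mod m)" for k :: nat
    by (induction k) (use pm in \<open>auto simp: metacyclic_model_def metacyclic_op_def mod_Suc_eq\<close>)
  have yp: "(1, 0) [^]\<^bsub>?K\<^esub> k = (k, 0)" if "k < p" for k :: nat
    using that
    by (induction k) (use pm in \<open>auto simp: metacyclic_model_def metacyclic_op_def\<close>)
  have ypp: "(1, 0) [^]\<^bsub>?K\<^esub> p = (0, s mod m)"
    using yp[of "p - 1"] K.nat_pow_Suc[of "(1, 0)" "p - 1"] pm
    by (simp add: metacyclic_model_def metacyclic_op_def)
  show "metacyclic_gens ?K p m r s (0, 1) (1, 0)"
    unfolding metacyclic_gens_def xp ypp
  proof (intro conjI ballI)
    fix g assume "g \<in> carrier ?K"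
    then obtain j i where g: "g = (j, i)" "j < p" "i < m" by (auto simp: metacyclic_model_def)
    then have "g = (1, 0) [^]\<^bsub>?K\<^esub> j \<otimes>\<^bsub>?K\<^esub> (0, i mod m)"
      using yp[of j] by (simp add: metacyclic_model_def metacyclic_op_def)
    then show "\<exists>(j::nat) (i::nat). g = (1, 0) [^]\<^bsub>?K\<^esub> j \<otimes>\<^bsub>?K\<^esub> (0, i mod m)" by blast
  qed (use pm in \<open>auto simp: metacyclic_model_def metacyclic_op_def\<close>)
  show "order ?K = p * m" by (simp add: order_def metacyclic_model_def card_cartesian_product)
qed

context group
begin

context
  fixes p m r s :: nat and x y
  assumes gens: "metacyclic_gens G p m r s x y" and pm: "p > 0" "m > 0"
begin

lemma metacyclic_closed: "x \<in> carrier G" "y \<in> carrier G"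
  and metacyclic_rel: "x [^] m = \<one>" "y [^] p = x [^] s" "x \<otimes> y = y \<otimes> x [^] r"
  using gens by (auto simp: metacyclic_gens_def)

definition normal_form :: "nat \<times> nat \<Rightarrow> 'a" where
  "normal_form = (\<lambda>(j, i). y [^] j \<otimes> x [^] i)"

lemma normal_form_reduce:
  "y [^] (a::nat) \<otimes> x [^] (b::nat) = y [^] (a mod p) \<otimes> x [^] ((b + s * (a div p)) mod m)"
proof -
  have "y [^] a = y [^] (a mod p + p * (a div p))" by simp
  also have "\<dots> = y [^] (a mod p) \<otimes> (y [^] p) [^] (a div p)"
    using metacyclic_closed by (simp only: nat_pow_mult nat_pow_pow)
  also have "\<dots> = y [^] (a mod p) \<otimes> x [^] (s * (a div p))"
    using metacyclic_closed by (simp only: metacyclic_rel(2) nat_pow_pow)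
  finally have "y [^] a \<otimes> x [^] b = y [^] (a mod p) \<otimes> x [^] (b + s * (a div p))"
    using metacyclic_closed by (simp add: m_assoc nat_pow_mult add.commute)
  also have "x [^] (b + s * (a div p)) = x [^] ((b + s * (a div p)) mod m)"
    by (rule pow_cong[OF metacyclic_closed(1) metacyclic_rel(1)]) (simp add: cong_def)
  finally show ?thesis .
qed

lemma normal_form_image: "normal_form ` ({..<p} \<times> {..<m}) = carrier G"
proof (intro equalityI subsetI)
  fix g assume "g \<in> carrier G"
  then obtain a b where "g = y [^] (a::nat) \<otimes> x [^] (b::nat)"
    using gens unfolding metacyclic_gens_def by blast
  then have "g = normal_form (a mod p, (b + s * (a div p)) mod m)"
    using normal_form_reduce by (simp add: normal_form_def)
  then show "g \<in> normal_form ` ({..<p} \<times> {..<m})" using pm by (intro image_eqI) auto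
qed (use metacyclic_closed in \<open>auto simp: normal_form_def\<close>)

lemma normal_form_op:
  "normal_form a \<otimes> normal_form b = normal_form (metacyclic_op p m r s a b)"
proof -
  obtain j i where a: "a = (j, i)" by (cases a)
  obtain j' i' where b: "b = (j', i')" by (cases b)
  note ab = a b
  have "normal_form a \<otimes> normal_form b = y [^] (j + j') \<otimes> x [^] (i * r ^ j' + i')"
    unfolding ab normal_form_def prod.case
    by (rule normal_form_mult[OF metacyclic_closed metacyclic_rel(3)])
  also have "\<dots> = normal_form (metacyclic_op p m r s a b)"
    unfolding ab normal_form_def metacyclic_op_def prod.case by (rule normal_form_reduce)
  finally show ?thesis .
qed

lemma normal_form_bij:
  assumes "order G = p * m"
  shows "bij_betw normal_form ({..<p} \<times> {..<m}) (carrier G)"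
  using normal_form_image assms
  by (auto simp: bij_betw_def order_def card_cartesian_product intro!: eq_card_imp_inj_on)

lemma metacyclic_order_le: "order G \<le> p * m"
  using card_image_le[of "{..<p} \<times> {..<m}" normal_form] normal_form_image
  by (simp add: order_def card_cartesian_product)

lemma metacyclic_finite: "finite (carrier G)"
  using normal_form_image by (metis finite_cartesian_product finite_imageI finite_lessThan)

text \<open>The powers \<open>x ^ i\<close> with \<open>i < m\<close> are distinct normal forms.\<close>

lemma metacyclic_ord:
  assumes "order G = p * m"
  shows "ord x = m"
proof -
  have "ord x dvd m" using metacyclic_closed metacyclic_rel by (simp add: pow_eq_id)
  moreover have "ord x \<ge> m"
  proof (rule ccontr)
    assume "\<not> ord x \<ge> m"
    moreover have "normal_form (0, ord x) = normal_form (0, 0)"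
      using metacyclic_closed by (simp add: normal_form_def pow_ord_eq_1)
    ultimately have "(0::nat, ord x) = (0, 0)"
      using bij_betw_imp_inj_on[OF normal_form_bij[OF assms]] pm by (auto dest: inj_onD)
    then show False using ord_pos[OF metacyclic_finite metacyclic_closed(1)] by simp
  qed
  ultimately show ?thesis using pm by (simp add: dvd_imp_le le_antisym)
qed

end

text \<open>Both groups are in bijection with the pairs \<open>(j, i)\<close>, and in both the product is given by \<open>metacyclic_op\<close>.\<close>

lemma metacyclic_iso:
  assumes G: "metacyclic_gens G p m r s x y" "order G = p * m" and pm: "p > 0" "m > 0"
    and H: "group H" "metacyclic_gens H p m r s x' y'" "order H = p * m"
  shows "G \<cong> H"
proof -
  interpret H: group H by fact
  let ?D = "{..<p} \<times> {..<m}"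
  let ?f = "normal_form x y" and ?g = "H.normal_form x' y'"
  have f: "bij_betw ?f ?D (carrier G)" by (rule normal_form_bij[OF G(1) pm G(2)])
  have g: "bij_betw ?g ?D (carrier H)" by (rule H.normal_form_bij[OF H(2) pm H(3)])
  let ?h = "\<lambda>a. ?g (the_inv_into ?D ?f a)"
  have h: "?h (?f d) = ?g d" if "d \<in> ?D" for d
    using that f by (simp add: the_inv_into_f_f bij_betw_def)
  have op: "metacyclic_op p m r s a b \<in> ?D" for a b
    using pm by (cases a; cases b) (simp add: metacyclic_op_def)
  have "bij_betw ?h (carrier G) (carrier H)"
    using bij_betw_trans[OF bij_betw_the_inv_into[OF f] g] by (simp add: comp_def)
  moreover have "?h \<in> hom G H"
  proof (rule homI)
    fix a b assume ab: "a \<in> carrier G" "b \<in> carrier G"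
    then have "a \<in> ?f ` ?D" "b \<in> ?f ` ?D"
      by (simp_all only: normal_form_image[OF G(1) pm])
    then obtain c d where cd: "c \<in> ?D" "d \<in> ?D" "a = ?f c" "b = ?f d"
      by (elim imageE) (rule that)
    then have "?h (a \<otimes> b) = ?g (metacyclic_op p m r s c d)"
      using h[OF op] normal_form_op[OF G(1) pm] by simp
    also have "\<dots> = ?h a \<otimes>\<^bsub>H\<^esub> ?h b"
      using h cd H.normal_form_op[OF H(2) pm] by simp
    finally show "?h (a \<otimes> b) = ?h a \<otimes>\<^bsub>H\<^esub> ?h b" .
  qed (use \<open>bij_betw ?h _ _\<close> in \<open>auto simp: bij_betw_def\<close>)
  ultimately show ?thesis by (auto simp: is_iso_def iso_def)
qed

end

lemma metacyclic_gens_integer_mod_groups: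
  assumes pm: "p > 1" "m > 1"
  shows "metacyclic_gens (integer_mod_group p \<times>\<times> integer_mod_group m) p m 1 0 (0, 1) (1, 0)"
    and "order (integer_mod_group p \<times>\<times> integer_mod_group m) = p * m"
proof -
  let ?G = "integer_mod_group p \<times>\<times> integer_mod_group m"
  have pow: "(a, b) [^]\<^bsub>?G\<^esub> k = (a [^]\<^bsub>integer_mod_group p\<^esub> k, b [^]\<^bsub>integer_mod_group m\<^esub> k)"
    for a b and k :: nat
    by (induction k) (auto simp del: pow_integer_mod_group)
  show "metacyclic_gens ?G p m 1 0 (0, 1) (1, 0)"
    unfolding metacyclic_gens_def pow
  proof (intro conjI ballI)
    fix g assume "g \<in> carrier ?G"
    then obtain j i where g: "g = (j, i)" "0 \<le> j" "j < int p" "0 \<le> i" "i < int m"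
      using pm by (auto simp: DirProd_def carrier_integer_mod_group)
    then show "\<exists>(j::nat) (i::nat). g = (1 [^]\<^bsub>integer_mod_group p\<^esub> j, 0 [^]\<^bsub>integer_mod_group m\<^esub> j)
        \<otimes>\<^bsub>?G\<^esub> (0 [^]\<^bsub>integer_mod_group p\<^esub> i, 1 [^]\<^bsub>integer_mod_group m\<^esub> i)"
      by (intro exI[of _ "nat j"] exI[of _ "nat i"]) simp
  qed (use pm in \<open>auto simp: DirProd_def carrier_integer_mod_group\<close>)
  show "order ?G = p * m"
    using pm by (simp add: order_def DirProd_def carrier_integer_mod_group card_cartesian_product)
qed

section \<open>The presented groups\<close>

definition word_val :: "('a, 'b) monoid_scheme \<Rightarrow> ('g \<Rightarrow> 'a) \<Rightarrow> 'g word \<Rightarrow> 'a" where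
  "word_val G f w = foldr (\<lambda>(g, b) z. (if b then f g else inv\<^bsub>G\<^esub> f g) \<otimes>\<^bsub>G\<^esub> z) w \<one>\<^bsub>G\<^esub>"

lemma word_val_simps [simp]:
  "word_val G f [] = \<one>\<^bsub>G\<^esub>"
  "word_val G f ((g, b) # w) = (if b then f g else inv\<^bsub>G\<^esub> f g) \<otimes>\<^bsub>G\<^esub> word_val G f w"
  by (simp_all add: word_val_def)

context group
begin

lemma word_val_closed: "(\<And>g. f g \<in> carrier G) \<Longrightarrow> word_val G f w \<in> carrier G"
  by (induction w) auto

lemma word_val_append:
  "(\<And>g. f g \<in> carrier G) \<Longrightarrow> word_val G f (u @ v) = word_val G f u \<otimes> word_val G f v"
  by (induction u) (auto simp: word_val_closed m_assoc)

lemma word_val_pow: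
  "(\<And>g. f g \<in> carrier G) \<Longrightarrow> word_val G f (word_pow w k) = word_val G f w [^] k"
  by (induction k) (simp_all add: word_pow_def word_val_append word_val_closed mult_pow_comm)

text \<open>The universal property of a presentation, on the level of words.\<close>

lemma word_val_eq_if_word_eq:
  assumes "word_eq R u v" "\<And>g. f g \<in> carrier G"
    and "\<And>u v. (u, v) \<in> R \<Longrightarrow> word_val G f u = word_val G f v"
  shows "word_val G f u = word_val G f v"
  using assms(1) by induction (use assms(2,3) in \<open>auto simp: word_val_append\<close>)

end

context
  fixes R :: "('g word \<times> 'g word) set"
begin

interpretation P: group "presented_group R" by (rule group_presented_group)

abbreviation "cls w \<equiv> word_rel R `` {w}"

lemma cls_carrier: "cls w \<in> carrier (presented_group R)"
  by (auto simp: presented_group_def quotient_def)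

lemma ex_word_if_presented:
  assumes "A \<in> carrier (presented_group R)"
  shows "\<exists>w. A = cls w"
  using assms by (auto simp: presented_group_def quotient_def)

lemma cls_Nil: "cls [] = \<one>\<^bsub>presented_group R\<^esub>"
  by (simp add: presented_group_def)

lemma cls_append: "cls (u @ v) = cls u \<otimes>\<^bsub>presented_group R\<^esub> cls v"
  by (simp add: presented_group_mult)

lemma cls_eq: "word_eq R u v \<Longrightarrow> cls u = cls v"
  by (rule equiv_class_eq[OF equiv_word_rel]) (simp add: word_rel_def)

lemma cls_inv: "cls [(g, False)] = inv\<^bsub>presented_group R\<^esub> cls [(g, True)]"
proof (rule P.inv_equality[symmetric])
  show "cls [(g, False)] \<otimes>\<^bsub>presented_group R\<^esub> cls [(g, True)] = \<one>\<^bsub>presented_group R\<^esub>"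
    using cls_eq[OF word_eq_cancel[of R g False]] by (simp add: cls_Nil flip: cls_append)
qed (rule cls_carrier)+

lemma cls_pow: "cls (word_pow w k) = cls w [^]\<^bsub>presented_group R\<^esub> k"
  by (induction k)
    (simp_all add: word_pow_def cls_Nil cls_append cls_carrier P.mult_pow_comm)

text \<open>A group \<open>K\<close> that satisfies the relations and is generated by the images of the generators is a quotient of the
  presented group. For the order it is enough to use the map that evaluates a representative of each class.\<close>

lemma order_presented_group_ge:
  assumes K: "group K" "\<And>g. f g \<in> carrier K"
    and rel: "\<And>u v. (u, v) \<in> R \<Longrightarrow> word_val K f u = word_val K f v"
    and span: "carrier K \<subseteq> range (word_val K f)"
    and fin: "finite (carrier (presented_group R))"
  shows "order K \<le> order (presented_group R)"
proof -
  interpret K: group K by fact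
  let ?h = "\<lambda>A. word_val K f (SOME u. u \<in> A)"
  have h: "?h (cls w) = word_val K f w" for w
  proof -
    have "w \<in> cls w" using equiv_class_self[OF equiv_word_rel] by blast
    then have "(SOME u. u \<in> cls w) \<in> cls w" by (rule someI)
    then have "word_eq R w (SOME u. u \<in> cls w)" by (simp add: word_rel_def)
    then show ?thesis using K.word_val_eq_if_word_eq[OF _ K(2) rel] by metis
  qed
  have "carrier K \<subseteq> ?h ` carrier (presented_group R)"
  proof
    fix a assume "a \<in> carrier K"
    then obtain w where "a = word_val K f w" using span by blast
    then have "a = ?h (cls w)" by (simp only: h)
    then show "a \<in> ?h ` carrier (presented_group R)" using cls_carrier by (rule image_eqI)
  qed
  then show ?thesis using fin unfolding order_def by (rule surj_card_le[rotated])
qed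

end

text \<open>Products of normal forms are normal forms, so it remains to check the four letters. The inverse letters are positive powers
  because \<open>x ^ m = 1\<close> and \<open>y ^ (p * m) = x ^ (s * m) = 1\<close>.\<close>

lemma two_gens_presented_metacyclic:
  fixes R :: "(two_gens word \<times> two_gens word) set"
  defines "x \<equiv> word_rel R `` {word_x}" and "y \<equiv> word_rel R `` {word_y}"
  assumes pm: "p > 0" "m > 0"
    and rel: "x [^]\<^bsub>presented_group R\<^esub> m = \<one>\<^bsub>presented_group R\<^esub>"
      "y [^]\<^bsub>presented_group R\<^esub> p = x [^]\<^bsub>presented_group R\<^esub> s"
      "x \<otimes>\<^bsub>presented_group R\<^esub> y = y \<otimes>\<^bsub>presented_group R\<^esub> x [^]\<^bsub>presented_group R\<^esub> r"
  shows "metacyclic_gens (presented_group R) p m r s x y"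
proof -
  let ?P = "presented_group R"
  interpret P: group ?P by (rule group_presented_group)
  have c: "x \<in> carrier ?P" "y \<in> carrier ?P" by (simp_all add: x_def y_def cls_carrier)
  have yo: "y [^]\<^bsub>?P\<^esub> (p * m) = \<one>\<^bsub>?P\<^esub>"
  proof -
    have "y [^]\<^bsub>?P\<^esub> (p * m) = (y [^]\<^bsub>?P\<^esub> p) [^]\<^bsub>?P\<^esub> m" using c by (simp only: P.nat_pow_pow)
    also have "\<dots> = (x [^]\<^bsub>?P\<^esub> m) [^]\<^bsub>?P\<^esub> s"
      using c by (simp only: rel(2) P.nat_pow_pow mult.commute)
    finally show ?thesis using rel(1) by simp
  qed
  have letter: "\<exists>(j::nat) (i::nat). word_rel R `` {[l]} = y [^]\<^bsub>?P\<^esub> j \<otimes>\<^bsub>?P\<^esub> x [^]\<^bsub>?P\<^esub> i" for l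
  proof -
    obtain g b where l: "l = (g, b)" by (cases l)
    consider "l = (Gen_x, True)" | "l = (Gen_y, True)" | "l = (Gen_x, False)" | "l = (Gen_y, False)"
      using l by (cases g; cases b) auto
    then show ?thesis
    proof cases
      case 1
      then show ?thesis using c by (intro exI[of _ 0] exI[of _ 1]) (simp add: x_def)
    next
      case 2
      then show ?thesis using c by (intro exI[of _ 1] exI[of _ 0]) (simp add: y_def)
    next
      case 3
      then show ?thesis using c P.inv_eq_pow[OF c(1) rel(1) pm(2)]
        by (intro exI[of _ 0] exI[of _ "m - 1"]) (simp add: cls_inv x_def)
    next
      case 4
      then show ?thesis using c P.inv_eq_pow[OF c(2) yo] pm
        by (intro exI[of _ "p * m - 1"] exI[of _ 0]) (simp add: cls_inv y_def)
    qed
  qed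
  have word: "\<exists>(j::nat) (i::nat). word_rel R `` {w} = y [^]\<^bsub>?P\<^esub> j \<otimes>\<^bsub>?P\<^esub> x [^]\<^bsub>?P\<^esub> i" for w
  proof (induction w rule: rev_induct)
    case Nil
    then show ?case by (intro exI[of _ 0]) (simp add: cls_Nil)
  next
    case (snoc l w)
    then obtain j i :: nat where 1: "word_rel R `` {w} = y [^]\<^bsub>?P\<^esub> j \<otimes>\<^bsub>?P\<^esub> x [^]\<^bsub>?P\<^esub> i" by blast
    obtain j' i' :: nat where 2: "word_rel R `` {[l]} = y [^]\<^bsub>?P\<^esub> j' \<otimes>\<^bsub>?P\<^esub> x [^]\<^bsub>?P\<^esub> i'"
      using letter by blast
    show ?case unfolding cls_append 1 2 P.normal_form_mult[OF c rel(3)] by blast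
  qed
  show ?thesis
    unfolding metacyclic_gens_def using c rel word ex_word_if_presented[of _ R] by metis
qed

text \<open>There are at most \<open>p * m\<close> normal forms, and the model is a quotient with \<open>p * m\<close> elements.\<close>

lemma order_metacyclic_presentation:
  fixes R :: "(two_gens word \<times> two_gens word) set"
  assumes pm: "p > 1" "m > 1" and r: "[r ^ p = 1] (mod m)" and s: "[s * r = s] (mod m)"
    and gens: "metacyclic_gens (presented_group R) p m r s x y"
    and rel: "\<And>u v. (u, v) \<in> R \<Longrightarrow>
      word_val (metacyclic_model p m r s) (case_two_gens (0, 1) (1, 0)) u =
      word_val (metacyclic_model p m r s) (case_two_gens (0, 1) (1, 0)) v"
  shows "order (presented_group R) = p * m"
proof (rule antisym)
  let ?K = "metacyclic_model p m r s" and ?P = "presented_group R"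
  let ?f = "case_two_gens (0, 1) (1, 0) :: two_gens \<Rightarrow> nat \<times> nat"
  interpret K: group ?K using pm by (intro group_metacyclic_model r s) auto
  interpret P: group ?P by (rule group_presented_group)
  note K = metacyclic_gens_model[OF pm r s]
  have pm0: "p > 0" "m > 0" using pm by auto
  show "order ?P \<le> p * m" by (rule P.metacyclic_order_le[OF gens pm0])
  have c: "(0, 1) \<in> carrier ?K" "(1, 0) \<in> carrier ?K"
    using K by (auto simp: metacyclic_gens_def)
  have f: "?f g \<in> carrier ?K" for g using c by (cases g) auto
  have "order ?K \<le> order ?P"
  proof (rule order_presented_group_ge[OF K.is_group f rel])
    show "carrier ?K \<subseteq> range (word_val ?K ?f)"
    proof
      fix a assume "a \<in> carrier ?K"
      then obtain j i :: nat where "a = (1, 0) [^]\<^bsub>?K\<^esub> j \<otimes>\<^bsub>?K\<^esub> (0, 1) [^]\<^bsub>?K\<^esub> i"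
        using K(1) unfolding metacyclic_gens_def by blast
      then have "a = word_val ?K ?f (word_pow word_y j @ word_pow word_x i)"
        using c by (simp only: K.word_val_append[of ?f, OF f] K.word_val_pow[of ?f, OF f]) simp
      then show "a \<in> range (word_val ?K ?f)" by blast
    qed
    show "finite (carrier ?P)" by (rule P.metacyclic_finite[OF gens pm0])
  qed
  then show "p * m \<le> order ?P" using K(2) by simp
qed

text \<open>The model exists because \<open>(1 + p ^ (n - 2)) ^ p = 1 + p ^ (n - 1)\<close> modulo \<open>p ^ (n - 1)\<close>.\<close>

lemma modular_group_metacyclic:
  assumes p: "prime p" and n: "n \<ge> 3"
  shows "\<exists>x y. metacyclic_gens (modular_group p n) p (p ^ (n - 1)) (1 + p ^ (n - 2)) 0 x y"
    and "order (modular_group p n) = p * p ^ (n - 1)"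
proof -
  define R where "R = {(word_pow word_x (p ^ (n - 1)), []), (word_pow word_y p, []),
     (word_y_inv @ word_x @ word_y, word_pow word_x (1 + p ^ (n - 2)))}"
  have M: "modular_group p n = presented_group R" by (simp only: R_def modular_group_def)
  let ?m = "p ^ (n - 1)" and ?r = "1 + p ^ (n - 2)"
  let ?x = "word_rel R `` {word_x}" and ?y = "word_rel R `` {word_y}"
  let ?P = "presented_group R"
  interpret P: group ?P by (rule group_presented_group)
  have c: "?x \<in> carrier ?P" "?y \<in> carrier ?P" by (simp_all add: cls_carrier)
  have pm: "p > 1" "?m > 1" using n prime_gt_1_nat[OF p] one_less_power[of p "n - 1"] by simp_all
  have R: "word_rel R `` {u} = word_rel R `` {v}" if "(u, v) \<in> R" for u v
    using that by (intro cls_eq word_eq_rel)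
  have "?x [^]\<^bsub>?P\<^esub> ?m = \<one>\<^bsub>?P\<^esub>" "?y [^]\<^bsub>?P\<^esub> p = \<one>\<^bsub>?P\<^esub>"
    using R[of "word_pow word_x ?m" "[]"] R[of "word_pow word_y p" "[]"]
    by (auto simp: R_def cls_pow cls_Nil)
  moreover have "inv\<^bsub>?P\<^esub> ?y \<otimes>\<^bsub>?P\<^esub> (?x \<otimes>\<^bsub>?P\<^esub> ?y) = ?x [^]\<^bsub>?P\<^esub> ?r"
    using R[of "word_y_inv @ word_x @ word_y" "word_pow word_x ?r"]
    unfolding cls_append cls_inv cls_pow by (auto simp: R_def)
  then have "?x \<otimes>\<^bsub>?P\<^esub> ?y = ?y \<otimes>\<^bsub>?P\<^esub> ?x [^]\<^bsub>?P\<^esub> ?r"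
    using c by (metis P.inv_solve_left P.m_closed P.nat_pow_closed)
  ultimately have gens: "metacyclic_gens ?P p ?m ?r 0 ?x ?y"
    using pm by (intro two_gens_presented_metacyclic) auto
  then show "\<exists>x y. metacyclic_gens (modular_group p n) p ?m ?r 0 x y" unfolding M by blast
  have Suc: "Suc (n - 2) = n - 1" using n by simp
  have "[?r ^ p = 1 + p ^ Suc (n - 2)] (mod p ^ Suc (n - 2))"
    using one_plus_pow_cong[of "n - 2" 1 p p] n by simp
  also have "[1 + p ^ Suc (n - 2) = 1] (mod p ^ Suc (n - 2))" by (simp only: cong_def mod_add_self2)
  finally have r: "[?r ^ p = 1] (mod ?m)" unfolding Suc .
  define K where "K = metacyclic_model p ?m ?r 0"
  let ?f = "case_two_gens (0, 1) (1, 0) :: two_gens \<Rightarrow> nat \<times> nat"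
  interpret K: group K unfolding K_def using pm by (intro group_metacyclic_model r) auto
  have K: "metacyclic_gens K p ?m ?r 0 (0, 1) (1, 0)" using metacyclic_gens_model(1)[OF pm r] unfolding K_def by simp
  then have f: "?f g \<in> carrier K" for g by (cases g) (auto simp: metacyclic_gens_def)
  have val: "word_val K ?f (word_pow word_x k) = (0, 1) [^]\<^bsub>K\<^esub> k"
    "word_val K ?f (word_pow word_y k) = (1, 0) [^]\<^bsub>K\<^esub> k" for k
    using f[of Gen_x] f[of Gen_y] unfolding K.word_val_pow[of ?f, OF f] by simp_all
  show "order (modular_group p n) = p * ?m"
    unfolding M
  proof (rule order_metacyclic_presentation[OF pm r _ gens])
    fix u v assume "(u, v) \<in> R"
    then consider "u = word_pow word_x ?m" "v = []" | "u = word_pow word_y p" "v = []"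
      | "u = word_y_inv @ word_x @ word_y" "v = word_pow word_x ?r"
      by (auto simp: R_def)
    then have "word_val K ?f u = word_val K ?f v"
    proof cases
      case 3
      have "inv\<^bsub>K\<^esub> (1, 0) \<otimes>\<^bsub>K\<^esub> ((0, 1) \<otimes>\<^bsub>K\<^esub> (1, 0)) = (0, 1) [^]\<^bsub>K\<^esub> ?r"
        using K f[of Gen_x] f[of Gen_y] unfolding metacyclic_gens_def
        by (metis K.inv_solve_left K.m_closed K.nat_pow_closed)
      then show ?thesis using f[of Gen_x] f[of Gen_y] unfolding 3 val by simp
    next
      case 1
      then show ?thesis using K by (simp only: val word_val_simps metacyclic_gens_def)
    next
      case 2
      then show ?thesis using K by (simp only: val word_val_simps metacyclic_gens_def nat_pow_0 K.nat_pow_0)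
    qed
    then show "word_val (metacyclic_model p ?m ?r 0) ?f u = word_val (metacyclic_model p ?m ?r 0) ?f v"
      unfolding K_def .
  qed simp
qed

text \<open>The relation \<open>y x y\<^sup>-\<^sup>1 = x\<^sup>-\<^sup>1\<close> is equivalent to \<open>x y = y x\<^sup>-\<^sup>1\<close>, and \<open>x\<^sup>-\<^sup>1\<close> is the power of \<open>x\<close>
  with exponent \<open>2 ^ (n - 1) - 1\<close>.\<close>

lemma quaternion_group_metacyclic:
  assumes n: "n \<ge> 3"
  shows "\<exists>x y. metacyclic_gens (quaternion_group n) 2 (2 ^ (n - 1)) (2 ^ (n - 1) - 1) (2 ^ (n - 2)) x y"
    and "order (quaternion_group n) = 2 * 2 ^ (n - 1)"
proof -
  define R where "R = {(word_pow word_x (2 ^ (n - 1)), []),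
     (word_pow word_y 2, word_pow word_x (2 ^ (n - 2))),
     (word_y @ word_x @ word_y_inv, word_x_inv)}"
  have M: "quaternion_group n = presented_group R" by (simp only: R_def quaternion_group_def)
  let ?m = "2 ^ (n - 1) :: nat" and ?r = "2 ^ (n - 1) - 1 :: nat" and ?s = "2 ^ (n - 2) :: nat"
  let ?x = "word_rel R `` {word_x}" and ?y = "word_rel R `` {word_y}"
  let ?P = "presented_group R"
  interpret P: group ?P by (rule group_presented_group)
  have c: "?x \<in> carrier ?P" "?y \<in> carrier ?P" by (simp_all add: cls_carrier)
  have m1: "?m > 1" using n by (intro one_less_power) auto
  have ms: "?m = 2 * ?s" using n by (simp flip: power_Suc)
  have R: "word_rel R `` {u} = word_rel R `` {v}" if "(u, v) \<in> R" for u v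
    using that by (intro cls_eq word_eq_rel)
  have xm: "?x [^]\<^bsub>?P\<^esub> ?m = \<one>\<^bsub>?P\<^esub>" and ys: "?y [^]\<^bsub>?P\<^esub> (2::nat) = ?x [^]\<^bsub>?P\<^esub> ?s"
    using R[of "word_pow word_x ?m" "[]"] R[of "word_pow word_y 2" "word_pow word_x ?s"]
    unfolding cls_append cls_inv cls_pow cls_Nil by (auto simp: R_def)
  have "?y \<otimes>\<^bsub>?P\<^esub> (?x \<otimes>\<^bsub>?P\<^esub> inv\<^bsub>?P\<^esub> ?y) = inv\<^bsub>?P\<^esub> ?x"
    using R[of "word_y @ word_x @ word_y_inv" "word_x_inv"]
    unfolding cls_append cls_inv cls_pow by (auto simp: R_def)
  then have "?y \<otimes>\<^bsub>?P\<^esub> ?x = inv\<^bsub>?P\<^esub> ?x \<otimes>\<^bsub>?P\<^esub> ?y"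
    using c by (metis P.inv_closed P.inv_solve_right' P.m_assoc P.m_closed)
  then have "?x \<otimes>\<^bsub>?P\<^esub> ?y = ?y \<otimes>\<^bsub>?P\<^esub> inv\<^bsub>?P\<^esub> ?x"
    using c by (metis P.inv_closed P.inv_solve_left P.inv_solve_right' P.m_assoc P.m_closed)
  moreover have "inv\<^bsub>?P\<^esub> ?x = ?x [^]\<^bsub>?P\<^esub> ?r"
    by (rule P.inv_eq_pow[OF c(1) xm]) simp
  ultimately have gens: "metacyclic_gens ?P 2 ?m ?r ?s ?x ?y"
    using xm ys by (intro two_gens_presented_metacyclic) auto
  then show "\<exists>x y. metacyclic_gens (quaternion_group n) 2 ?m ?r ?s x y" unfolding M by blast
  have r: "[?r ^ 2 = 1] (mod ?m)"
  proof -
    have "?r ^ 2 + 2 * ?m = 1 + ?m * ?m"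
    proof -
      obtain k where "?m = Suc k" using m1 by (cases ?m) auto
      then show ?thesis by (simp add: power2_eq_square)
    qed
    then have "[?r ^ 2 = 1 + ?m * ?m] (mod ?m)" by (metis cong_def mod_mult_self1)
    also have "[1 + ?m * ?m = 1] (mod ?m)" by (simp only: cong_def mod_mult_self2)
    finally show ?thesis .
  qed
  have s: "[?s * ?r = ?s] (mod ?m)"
  proof -
    have "?s \<ge> 1" by simp
    then have "?r = 1 + 2 * (?s - 1)" unfolding ms by linarith
    moreover have "a * (1 + 2 * b) = a + 2 * a * b" for a b :: nat by (simp add: algebra_simps)
    ultimately have "?s * ?r = ?s + ?m * (?s - 1)" by (simp only: ms)
    then show ?thesis by (simp only: cong_def mod_mult_self2)
  qed
  define K where "K = metacyclic_model 2 ?m ?r ?s"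
  let ?f = "case_two_gens (0, 1) (1, 0) :: two_gens \<Rightarrow> nat \<times> nat"
  interpret K: group K unfolding K_def using m1 by (intro group_metacyclic_model r s) auto
  have K: "metacyclic_gens K 2 ?m ?r ?s (0, 1) (1, 0)" using metacyclic_gens_model(1)[OF _ m1 r s] unfolding K_def by simp
  then have f: "?f g \<in> carrier K" for g by (cases g) (auto simp: metacyclic_gens_def)
  have val: "word_val K ?f (word_pow word_x k) = (0, 1) [^]\<^bsub>K\<^esub> k"
    "word_val K ?f (word_pow word_y k) = (1, 0) [^]\<^bsub>K\<^esub> k" for k
    using f[of Gen_x] f[of Gen_y] unfolding K.word_val_pow[of ?f, OF f] by simp_all
  have "order ?P = 2 * ?m"
  proof (rule order_metacyclic_presentation[OF _ m1 r s gens])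
    fix u v assume "(u, v) \<in> R"
    then consider "u = word_pow word_x ?m" "v = []" | "u = word_pow word_y 2" "v = word_pow word_x ?s"
      | "u = word_y @ word_x @ word_y_inv" "v = word_x_inv"
      by (auto simp: R_def)
    then have "word_val K ?f u = word_val K ?f v"
    proof cases
      case 3
      let ?a = "(0, 1) :: nat \<times> nat" and ?b = "(1, 0) :: nat \<times> nat"
      have ab: "?a \<in> carrier K" "?b \<in> carrier K" using f[of Gen_x] f[of Gen_y] by auto
      have "inv\<^bsub>K\<^esub> ?a = ?a [^]\<^bsub>K\<^esub> ?r"
        using K by (intro K.inv_eq_pow[OF ab(1)]) (simp_all add: metacyclic_gens_def)
      then have "?a \<otimes>\<^bsub>K\<^esub> ?b = ?b \<otimes>\<^bsub>K\<^esub> inv\<^bsub>K\<^esub> ?a" using K by (simp add: metacyclic_gens_def)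
      then have "?b \<otimes>\<^bsub>K\<^esub> ?a = inv\<^bsub>K\<^esub> ?a \<otimes>\<^bsub>K\<^esub> ?b"
        using ab by (metis K.inv_closed K.inv_solve_left K.inv_solve_right' K.m_assoc K.m_closed)
      then have "?b \<otimes>\<^bsub>K\<^esub> (?a \<otimes>\<^bsub>K\<^esub> inv\<^bsub>K\<^esub> ?b) = inv\<^bsub>K\<^esub> ?a"
        using ab by (metis K.inv_closed K.inv_solve_right' K.m_assoc K.m_closed)
      then show ?thesis using ab unfolding 3 by simp
    next
      case 1
      then show ?thesis using K by (simp only: val word_val_simps metacyclic_gens_def)
    next
      case 2
      then show ?thesis using K by (simp only: val word_val_simps metacyclic_gens_def nat_pow_0 K.nat_pow_0)
    qed
    then show "word_val (metacyclic_model 2 ?m ?r ?s) ?f u = word_val (metacyclic_model 2 ?m ?r ?s) ?f v"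
      unfolding K_def .
  qed simp
  then show "order (quaternion_group n) = 2 * ?m" unfolding M .
qed

section \<open>Solutions of $g^{p^k} = 1$ in metacyclic groups\<close>

context group
begin

text \<open>By \<open>sum_powers_eq_prime_times_unit\<close>, \<open>(y ^ j * x ^ i) ^ (p ^ k) = x ^ (p ^ k * i * u)\<close> with \<open>u\<close> prime to \<open>p\<close>. So
  \<open>j\<close> is arbitrary, and \<open>i\<close> has to be a multiple of \<open>p ^ (m - k)\<close>.\<close>

lemma card_roots_of_one_split_metacyclic:
  assumes p: "prime p" and gens: "metacyclic_gens G p (p ^ m) r 0 x y" and G: "order G = p * p ^ m"
    and r: "[r = 1] (mod p)" and r4: "p = 2 \<Longrightarrow> [r = 1] (mod 4)" and k: "1 \<le> k" "k \<le> m"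
  shows "card (roots_of_one G (p ^ k)) = p ^ (k + 1)"
proof -
  have p0: "p > 0" "p ^ m > 0" using p by (simp_all add: prime_gt_0_nat)
  note xy = metacyclic_closed[OF gens p0]
  have rel: "y [^] p = \<one>" "x \<otimes> y = y \<otimes> x [^] r"
    using metacyclic_rel(2,3)[OF gens p0] by simp_all
  have ox: "ord x = p ^ m" by (rule metacyclic_ord[OF gens p0 G])
  have root: "(y [^] j \<otimes> x [^] i) [^] (p ^ k) = \<one> \<longleftrightarrow> p ^ (m - k) dvd i" for i j :: nat
  proof -
    have "[r ^ j = 1] (mod p)" using cong_pow[OF r, of j] by simp
    moreover have "[r ^ j = 1] (mod 4)" if "p = 2" using cong_pow[OF r4[OF that], of j] by simp
    ultimately obtain u where u: "(\<Sum>t<p. (r ^ j) ^ t) = p * u" "coprime u p"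
      using sum_powers_eq_prime_times_unit[OF p] by blast
    have "x \<otimes> y [^] j = y [^] j \<otimes> x [^] (r ^ j)" using pow_mult_swap[OF xy rel(2), of 1 j] xy by simp
    then have "(y [^] j \<otimes> x [^] i) [^] p = (y [^] j) [^] p \<otimes> x [^] (i * (p * u))"
      using normal_form_pow[of x "y [^] j" "r ^ j" i p] xy u by simp
    also have "(y [^] j) [^] p = (y [^] p) [^] j" using xy by (simp only: nat_pow_pow mult.commute)
    finally have "(y [^] j \<otimes> x [^] i) [^] p = x [^] (i * (p * u))" using xy rel by simp
    moreover have pk: "p ^ k = p * p ^ (k - 1)" using k by (cases k) auto
    then have "(y [^] j \<otimes> x [^] i) [^] (p ^ k) = ((y [^] j \<otimes> x [^] i) [^] p) [^] (p ^ (k - 1))"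
      using xy by (simp add: nat_pow_pow)
    ultimately have "(y [^] j \<otimes> x [^] i) [^] (p ^ k) = x [^] (i * (p * u) * p ^ (k - 1))"
      using xy by (simp only: nat_pow_pow)
    also have "i * (p * u) * p ^ (k - 1) = p ^ k * (i * u)" unfolding pk by (simp only: mult_ac)
    finally have "(y [^] j \<otimes> x [^] i) [^] (p ^ k) = \<one> \<longleftrightarrow> p ^ m dvd p ^ k * (i * u)"
      using xy ox by (simp add: pow_eq_id)
    also have "p ^ m = p ^ k * p ^ (m - k)" using k by (simp flip: power_add)
    also have "p ^ k * p ^ (m - k) dvd p ^ k * (i * u) \<longleftrightarrow> p ^ (m - k) dvd i * u" using p0 by simp
    also have "\<dots> \<longleftrightarrow> p ^ (m - k) dvd i"
      using u(2) by (intro coprime_dvd_mult_left_iff) (simp add: coprime_commute)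
    finally show ?thesis .
  qed
  let ?I = "{i. i < p ^ (m - k) * p ^ k \<and> p ^ (m - k) dvd i}"
  have pm: "p ^ m = p ^ (m - k) * p ^ k" using k by (simp flip: power_add)
  note bij = normal_form_bij[OF gens p0 G]
  have "roots_of_one G (p ^ k) = normal_form x y ` ({..<p} \<times> ?I)"
  proof (intro equalityI subsetI)
    fix g assume g: "g \<in> roots_of_one G (p ^ k)"
    then have "g \<in> normal_form x y ` ({..<p} \<times> {..<p ^ m})"
      using bij by (simp add: bij_betw_def roots_of_one_def)
    then obtain j i where "j < p" "i < p ^ m" "g = normal_form x y (j, i)" by auto
    then show "g \<in> normal_form x y ` ({..<p} \<times> ?I)"
      using g root[of j i] pm by (intro image_eqI[of _ _ "(j, i)"])
        (auto simp: normal_form_def[OF gens p0] roots_of_one_def)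
  next
    fix g assume "g \<in> normal_form x y ` ({..<p} \<times> ?I)"
    then show "g \<in> roots_of_one G (p ^ k)"
      using root xy by (auto simp: normal_form_def[OF gens p0] roots_of_one_def)
  qed
  moreover have "inj_on (normal_form x y) ({..<p} \<times> ?I)"
    by (rule inj_on_subset[OF bij_betw_imp_inj_on[OF bij]]) (use pm in auto)
  ultimately show ?thesis
    using card_multiples_below[of "p ^ (m - k)" "p ^ k"] p0
    by (simp add: card_image card_cartesian_product)
qed

text \<open>Inside \<open>\<langle>x\<rangle>\<close> there are \<open>2 ^ k\<close> solutions. All elements outside have order \<open>4\<close>, since
  \<open>(y * x ^ i)\<^sup>2 = y\<^sup>2\<close> is the involution of \<open>\<langle>x\<rangle>\<close>.\<close>

lemma card_roots_of_one_quaternion: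
  assumes gens: "metacyclic_gens G 2 (2 ^ m) (2 ^ m - 1) (2 ^ (m - 1)) x y"
    and G: "order G = 2 * 2 ^ m" and m: "m \<ge> 2" and k: "1 \<le> k" "k \<le> m"
  shows "card (roots_of_one G (2 ^ k)) = 2 ^ k + (if k = 1 then 0 else 2 ^ m)"
proof -
  have p0: "(2::nat) > 0" "(2::nat) ^ m > 0" by simp_all
  note xy = metacyclic_closed[OF gens p0]
  note rel = metacyclic_rel[OF gens p0]
  have ox: "ord x = 2 ^ m" by (rule metacyclic_ord[OF gens p0 G])
  have root0: "(x [^] i) [^] ((2::nat) ^ k) = \<one> \<longleftrightarrow> 2 ^ (m - k) dvd i" for i :: nat
  proof -
    have "(x [^] i) [^] ((2::nat) ^ k) = \<one> \<longleftrightarrow> 2 ^ m dvd i * 2 ^ k"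
      using xy ox by (simp add: pow_eq_id nat_pow_pow)
    also have "(2::nat) ^ m = 2 ^ (m - k) * 2 ^ k" using k by (simp flip: power_add)
    finally show ?thesis by simp
  qed
  have root1: "(y \<otimes> x [^] i) [^] ((2::nat) ^ k) = \<one> \<longleftrightarrow> k \<noteq> 1" for i :: nat
  proof -
    have sq: "(y \<otimes> x [^] i) [^] (2::nat) = x [^] ((2::nat) ^ (m - 1))"
    proof -
      have "(\<Sum>t<2. (2 ^ m - 1) ^ t) = (2::nat) ^ m" by (simp add: numeral_2_eq_2)
      then have "(y \<otimes> x [^] i) [^] (2::nat) = y [^] (2::nat) \<otimes> x [^] (i * 2 ^ m)"
        using normal_form_pow[OF xy rel(3), of i 2] by simp
      also have "x [^] (i * 2 ^ m) = \<one>" using xy ox by (simp add: pow_eq_id)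
      finally show ?thesis using xy rel(2) by simp
    qed
    have "(y \<otimes> x [^] i) [^] ((2::nat) ^ k) = ((y \<otimes> x [^] i) [^] (2::nat)) [^] ((2::nat) ^ (k - 1))"
      using xy k by (cases k) (auto simp: nat_pow_pow)
    also have "\<dots> = \<one> \<longleftrightarrow> 2 ^ m dvd (2::nat) ^ (m - 1 + (k - 1))"
      unfolding sq using xy ox by (simp add: pow_eq_id nat_pow_pow power_add)
    also have "\<dots> \<longleftrightarrow> m \<le> m - 1 + (k - 1)" by (rule dvd_power_iff_le) simp
    also have "\<dots> \<longleftrightarrow> k \<noteq> 1" using m k by auto
    finally show ?thesis .
  qed
  let ?I = "{i. i < 2 ^ (m - k) * 2 ^ k \<and> (2::nat) ^ (m - k) dvd i}"
  let ?J = "if k = 1 then {} else {..<(2::nat) ^ m}"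
  let ?D = "{0} \<times> ?I \<union> {1} \<times> ?J :: (nat \<times> nat) set"
  have pm: "(2::nat) ^ m = 2 ^ (m - k) * 2 ^ k" using k by (simp flip: power_add)
  note bij = normal_form_bij[OF gens p0 G]
  have D: "?D \<subseteq> {..<2} \<times> {..<2 ^ m}" using pm by auto
  have nf: "normal_form x y (0, i) = x [^] i" "normal_form x y (1, i) = y \<otimes> x [^] i" for i
    using xy by (simp_all add: normal_form_def[OF gens p0])
  have "roots_of_one G (2 ^ k) = normal_form x y ` ?D"
  proof (intro equalityI subsetI)
    fix g assume g: "g \<in> roots_of_one G (2 ^ k)"
    then have "g \<in> normal_form x y ` ({..<2} \<times> {..<2 ^ m})"
      using bij by (simp add: bij_betw_def roots_of_one_def)
    then obtain j i where ji: "j < 2" "i < 2 ^ m" "g = normal_form x y (j, i)" by auto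
    then consider "j = 0" | "j = 1" by linarith
    then have "(j, i) \<in> ?D"
    proof cases
      case 1
      then show ?thesis using g ji root0[of i] pm unfolding nf by (simp add: nf roots_of_one_def)
    next
      case 2
      then have "g = y \<otimes> x [^] i" using ji nf(2) by simp
      then have "k \<noteq> 1" using g root1[of i] by (simp add: roots_of_one_def)
      then show ?thesis using ji 2 by simp
    qed
    then show "g \<in> normal_form x y ` ?D" using ji(3) by (rule image_eqI[rotated])
  next
    fix g assume "g \<in> normal_form x y ` ?D"
    then obtain i where "i \<in> ?I \<and> g = x [^] i \<or> i \<in> ?J \<and> g = y \<otimes> x [^] i"
      using nf by (auto simp del: One_nat_def)
    then show "g \<in> roots_of_one G (2 ^ k)"
      using root0[of i] root1[of i] xy by (auto simp: roots_of_one_def split: if_splits)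
  qed
  moreover have "inj_on (normal_form x y) ?D"
    by (rule inj_on_subset[OF bij_betw_imp_inj_on[OF bij] D])
  ultimately have "card (roots_of_one G (2 ^ k)) = card ?D" by (simp only: card_image)
  also have "\<dots> = card ({0::nat} \<times> ?I) + card ({1::nat} \<times> ?J)"
    using finite_subset[OF D] by (intro card_Un_disjoint) auto
  also have "\<dots> = 2 ^ k + (if k = 1 then 0 else 2 ^ m)"
    using card_multiples_below[of "2 ^ (m - k)" "2 ^ k"] by (simp add: card_cartesian_product)
  finally show ?thesis .
qed

end

section \<open>Recognizing the groups with the fewest solutions\<close>

context group
begin

lemma metacyclic_gens_if_complement:
  assumes p: "prime p" and G: "order G = p * ord x" "finite (carrier G)"
    and xy: "x \<in> carrier G" "y \<in> carrier G" "x \<otimes> y = y \<otimes> x [^] (r::nat)"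
    and y: "y \<notin> generate G {x}" "y [^] p = \<one>"
  shows "metacyclic_gens G p (ord x) r 0 x y"
proof -
  have "y [^] p \<in> generate G {x}" using y(2) by (simp add: generate.one)
  then show ?thesis
    using carrier_eq_normal_forms[OF p G xy y(1)] xy y pow_ord_eq_1[OF xy(1)]
    by (auto simp: metacyclic_gens_def)
qed

text \<open>Not all elements satisfy \<open>g ^ (p ^ (n - 2)) = 1\<close>, so some \<open>x\<close> has order \<open>p ^ (n - 1)\<close>; order \<open>p ^ n\<close> is impossible since a
  cyclic group has only \<open>p\<close> solutions of \<open>g ^ p = 1\<close>. For the same reason one of the \<open>p\<^sup>2\<close> solutions lies outside
  \<open>\<langle>x\<rangle>\<close>; call it \<open>y\<close>. It acts on \<open>\<langle>x\<rangle>\<close> by \<open>x y = y x ^ r\<close>. For \<open>p = 2\<close>, the case \<open>r = 3\<close>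
  modulo \<open>4\<close>, which occurs in dihedral and semidihedral groups, is excluded by the involutions \<open>y * x ^ (2 * i)\<close>: together with
  \<open>1\<close> they are more than \<open>4\<close> solutions of \<open>g\<^sup>2 = 1\<close> as soon as \<open>n \<ge> 4\<close>. Hence \<open>r = 1 + a * p ^ (n - 2)\<close>, and if
  \<open>p\<close> does not divide \<open>a\<close>, a power of \<open>y\<close> acts with \<open>a = 1\<close>.\<close>

lemma split_metacyclic_if_minimal_roots:
  assumes p: "prime p" and n: "n \<ge> 3" "p = 2 \<Longrightarrow> n \<ge> 4" and G: "order G = p ^ n"
    and roots: "\<And>k. 1 \<le> k \<Longrightarrow> k < n \<Longrightarrow> card (roots_of_one G (p ^ k)) = p ^ (k + 1)"
  shows "\<exists>x y. metacyclic_gens G p (p ^ (n - 1)) 1 0 x y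
    \<or> metacyclic_gens G p (p ^ (n - 1)) (1 + p ^ (n - 2)) 0 x y"
proof -
  have fin: "finite (carrier G)" by (rule finite_if_prime_power_order[OF p G])
  have p1: "p > 1" using p by (rule prime_gt_1_nat)
  have Gn: "order G = p * p ^ (n - 1)" using G n by (cases n) auto
  have n2: "n - 1 = Suc (n - 2)" using n by simp
  have N1: "card (roots_of_one G p) = p ^ 2" using roots[of 1] n by (simp add: power2_eq_square)
  have pp: "p < p ^ 2" using p1 by (simp add: power2_eq_square)
  have "p ^ (n - 2 + 1) < p ^ n" using p1 n by (intro power_strict_increasing) auto
  then have "card (roots_of_one G (p ^ (n - 2))) < card (carrier G)"
    using roots[of "n - 2"] G n by (simp add: order_def)
  then have "roots_of_one G (p ^ (n - 2)) \<noteq> carrier G" by auto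
  then obtain x where x: "x \<in> carrier G" "x [^] (p ^ (n - 2)) \<noteq> \<one>"
    by (auto simp: roots_of_one_def)
  have few: "card {h \<in> generate G {x}. h [^] p = \<one>} = p"
    if "p dvd ord x" using card_roots_of_one_in_cyclic[OF fin x(1) that] .
  obtain e where e: "ord x = p ^ e" "e \<le> n"
    using ord_dvd_group_order[OF x(1)] G divides_primepow_nat[OF p] by auto
  have "\<not> e \<le> n - 2"
  proof
    assume "e \<le> n - 2"
    then have "ord x dvd p ^ (n - 2)" using e by (simp add: le_imp_power_dvd)
    then show False using x by (simp add: pow_eq_id)
  qed
  then have po: "p dvd ord x" using e n by simp
  have outside: "\<exists>y\<in>roots_of_one G p. y \<notin> generate G {x}"
  proof (rule ccontr)
    assume "\<not> ?thesis"
    then have "roots_of_one G p \<subseteq> {h \<in> generate G {x}. h [^] p = \<one>}" by (auto simp: roots_of_one_def)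
    then have "card (roots_of_one G p) \<le> p"
      using few[OF po] p1 by (metis (no_types, lifting) card.infinite card_mono not_one_less_zero)
    then show False using N1 pp by simp
  qed
  then obtain y where y: "y \<in> carrier G" "y [^] p = \<one>" "y \<notin> generate G {x}"
    by (auto simp: roots_of_one_def)
  have subH: "subgroup (generate G {x}) G" by (rule subgroup_generate_singleton[OF x(1)])
  have "e \<noteq> n"
  proof
    assume "e = n"
    then have "generate G {x} = carrier G"
      using e G generate_pow_card[OF x(1)] fin subgroup.subset[OF subH]
      by (intro card_subset_eq) (auto simp: order_def)
    then show False using y by simp
  qed
  with \<open>\<not> e \<le> n - 2\<close> e(2) have "e = n - 1" by linarith
  then have ox: "ord x = p ^ (n - 1)" using e by simp
  then have Gx: "order G = p * ord x" using Gn by simp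
  have "generate G {x} \<noteq> carrier G" using y by blast
  then obtain g where g: "g \<in> carrier G" "g \<notin> generate G {x}" "g [^] p \<in> generate G {x}"
    "inv g \<otimes> x \<otimes> g \<in> generate G {x}"
    using ex_normalizing_outside_proper_subgroup[OF p G subH] generate.incl[of x "{x}" G] by auto
  then obtain q :: nat where "inv g \<otimes> x \<otimes> g = x [^] q"
    using mem_generate_singleton_iff[OF fin x(1)] by auto
  then have q: "x \<otimes> g = g \<otimes> x [^] q"
    using x(1) g(1) by (metis inv_solve_left m_assoc inv_closed m_closed)
  obtain j i :: nat where ji: "y = g [^] j \<otimes> x [^] i"
    using carrier_eq_normal_forms[OF p Gx fin x(1) g(1) q g(2,3) y(1)] by blast
  \<comment> \<open>The element \<open>g\<close> normalizes \<open>\<langle>x\<rangle>\<close>; since \<open>y\<close> is a normal form in \<open>g\<close> and \<open>x\<close>, so does \<open>y\<close>.\<close>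
  define r where "r = q ^ j"
  have r: "x \<otimes> y = y \<otimes> x [^] r"
  proof -
    have "x \<otimes> y = (x \<otimes> g [^] j) \<otimes> x [^] i" using ji x(1) g(1) by (simp add: m_assoc)
    also have "x \<otimes> g [^] j = g [^] j \<otimes> x [^] r"
      using pow_mult_swap[OF x(1) g(1) q, of 1 j] x(1) by (simp add: r_def)
    also have "g [^] j \<otimes> x [^] r \<otimes> x [^] i = y \<otimes> x [^] r"
      using ji x(1) g(1) by (simp add: m_assoc nat_pow_mult add.commute)
    finally show ?thesis .
  qed
  have "x [^] (r ^ p) = x [^] (1::nat)"
    using pow_mult_swap[OF x(1) y(1) r, of 1 p] x(1) y(2) by simp
  then have rp: "[r ^ p = 1] (mod p ^ (n - 1))"
    by (simp only: pow_eq_iff_cong[OF fin x(1)] ox)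
  then have r1: "[r = 1] (mod p)" using cong_1_if_pow_prime_cong_1[OF p] n by auto
  have r4: "[r = 1] (mod 4)" if p2: "p = 2"
  proof (rule ccontr)
    assume "\<not> [r = 1] (mod 4)"
    then have "r mod 2 = 1" "r mod 4 \<noteq> 1" using r1 p2 by (auto simp: cong_def)
    then have "r mod 4 = 3" by presburger
    then have r3: "2 ^ (n - 2) dvd r + 1"
      using dvd_Suc_if_square_cong_1[of r "n - 2"] rp p2 n2 by simp
    let ?h = "\<lambda>i. y \<otimes> x [^] (2 * i :: nat)"
    have inj: "inj_on ?h {..<2 ^ (n - 2)}"
    proof (rule inj_onI)
      fix i k assume ik: "i \<in> {..<(2::nat) ^ (n - 2)}" "k \<in> {..<(2::nat) ^ (n - 2)}" "?h i = ?h k"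
      then have "x [^] (2 * i) = x [^] (2 * k)" using x(1) y(1) by simp
      then have "[2 * i = 2 * k] (mod 2 * 2 ^ (n - 2))"
        using pow_eq_iff_cong[OF fin x(1), of "2 * i" "2 * k"] ox p2 n2 by simp
      then show "i = k" using ik by (simp add: cong_def)
    qed
    have root: "?h i \<in> roots_of_one G 2" for i
    proof -
      have "(\<Sum>t<2. r ^ t) = r + 1" by (simp add: numeral_2_eq_2)
      then have "?h i [^] (2::nat) = y [^] (2::nat) \<otimes> x [^] (2 * i * (r + 1))"
        using normal_form_pow[OF x(1) y(1) r, of "2 * i" 2] by (simp only:)
      moreover have "2 * 2 ^ (n - 2) dvd 2 * (i * (r + 1))"
        using r3 by (intro mult_dvd_mono dvd_mult) auto
      then have "ord x dvd 2 * i * (r + 1)" using ox p2 n2 by (simp add: mult.assoc)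
      then have "x [^] (2 * i * (r + 1)) = \<one>" using x(1) by (simp only: pow_eq_id)
      ultimately show ?thesis using x(1) y(1,2) p2 by (simp add: roots_of_one_def)
    qed
    have "\<one> \<notin> ?h ` {..<2 ^ (n - 2)}"
    proof
      assume "\<one> \<in> ?h ` {..<2 ^ (n - 2)}"
      then obtain i where "\<one> = y \<otimes> x [^] (2 * i :: nat)" by blast
      then have "y \<otimes> x [^] (2 * i) \<in> generate G {x}" by (metis generate.one)
      moreover have "x [^] (2 * i) \<in> generate G {x}"
        using mem_generate_singleton_iff[OF fin x(1)] by blast
      ultimately show False using coset_mem_cancel[OF subH _ y(1)] y(3) by blast
    qed
    then have "card (insert \<one> (?h ` {..<2 ^ (n - 2)})) = Suc (2 ^ (n - 2))"
      using inj by (simp add: card_image)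
    moreover have "insert \<one> (?h ` {..<2 ^ (n - 2)}) \<subseteq> roots_of_one G 2"
      using root by (auto simp: roots_of_one_def)
    then have "card (insert \<one> (?h ` {..<2 ^ (n - 2)})) \<le> card (roots_of_one G 2)"
      using fin by (intro card_mono) (auto simp: roots_of_one_def)
    moreover have "(2::nat) ^ 2 \<le> 2 ^ (n - 2)" using n(2)[OF p2] by (intro power_increasing) auto
    ultimately show False using N1 p2 by simp
  qed
  have rn: "[r = 1] (mod p ^ (n - 2))"
    using cong_1_if_prime_power_cong_1[OF p r1 r4, of "n - 2"] rp n2 by simp
  have "r \<ge> 1" using r1 p1 by (cases "r = 0") (auto simp: cong_def)
  then obtain a where a: "r = 1 + a * p ^ (n - 2)"
    using cong_to_1_nat[OF rn] by (metis dvdE le_add_diff_inverse mult.commute)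
  show ?thesis
  proof (cases "p dvd a")
    case True
    then obtain b where "a = p * b" by blast
    then have "r = 1 + p ^ (n - 1) * b" using a n2 by (simp add: mult_ac)
    then have "[r = 1] (mod p ^ (n - 1))" by (simp only: cong_def mod_mult_self2)
    then have "x [^] r = x [^] (1::nat)" by (simp only: pow_eq_iff_cong[OF fin x(1)] ox)
    then have "x \<otimes> y = y \<otimes> x [^] (1::nat)" using r by (simp only:)
    then have "metacyclic_gens G p (p ^ (n - 1)) 1 0 x y"
      using metacyclic_gens_if_complement[OF p Gx fin x(1) y(1) _ y(3,2)] ox by simp
    then show ?thesis by blast
  next
    case False
    then have "coprime a p" using p by (metis coprime_commute prime_imp_coprime)
    then obtain b where b: "[a * b = 1] (mod p)" using cong_solve_coprime_nat[of a p] by auto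
    \<comment> \<open>The power \<open>y ^ b\<close> acts by \<open>r ^ b = 1 + a * b * p ^ (n - 2)\<close>, where \<open>a * b = 1\<close> modulo \<open>p\<close>.\<close>
    let ?y = "y [^] b"
    have pb: "\<not> p dvd b"
    proof
      assume "p dvd b"
      then have "p dvd a * b" by simp
      then show False using b p1 by (simp add: cong_def dvd_eq_mod_eq_0)
    qed
    have "y [^] p \<in> generate G {x}" using y(2) by (simp add: generate.one)
    then have yb: "?y \<notin> generate G {x}" by (rule pow_notin_subgroup[OF p subH y(1,3) _ pb])
    have ybp: "?y [^] p = \<one>"
    proof -
      have "?y [^] p = (y [^] p) [^] b" using y(1) by (simp only: nat_pow_pow mult.commute)
      then show ?thesis using y(2) by simp
    qed
    have "[r ^ b = 1 + b * a * p ^ (n - 2)] (mod p ^ (n - 1))"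
      unfolding a n2 using one_plus_pow_cong[of "n - 2" a p b] n by simp
    moreover have "[b * a * p ^ (n - 2) = 1 * p ^ (n - 2)] (mod p * p ^ (n - 2))"
      using b unfolding cong_def by (simp only: mult.commute[of b] mod_mult_mult2)
    then have "[1 + b * a * p ^ (n - 2) = 1 + p ^ (n - 2)] (mod p ^ (n - 1))"
      unfolding n2 power_Suc by (simp only: cong_add_lcancel_nat mult_1_left)
    ultimately have "[r ^ b = 1 + p ^ (n - 2)] (mod p ^ (n - 1))" by (rule cong_trans)
    then have "x [^] (r ^ b) = x [^] (1 + p ^ (n - 2))"
      by (simp only: pow_eq_iff_cong[OF fin x(1)] ox)
    moreover have "x \<otimes> ?y = ?y \<otimes> x [^] (r ^ b)"
      using pow_mult_swap[OF x(1) y(1) r, of 1 b] x(1) by simp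
    ultimately have "x \<otimes> ?y = ?y \<otimes> x [^] (1 + p ^ (n - 2))" by (simp only:)
    then have "metacyclic_gens G p (p ^ (n - 1)) (1 + p ^ (n - 2)) 0 x ?y"
      using metacyclic_gens_if_complement[OF p Gx fin x(1) _ _ yb ybp] y(1) ox by simp
    then show ?thesis by blast
  qed
qed

end

section \<open>Counting cyclic subgroups\<close>

lemma (in group) cyclic_subgroups_eq:
  "cyclic_subgroups G = (\<lambda>x. generate G {x}) ` carrier G"
proof (intro equalityI subsetI)
  fix H assume "H \<in> cyclic_subgroups G"
  then have H: "subgroup H G" and "cyclic_group (G\<lparr>carrier := H\<rparr>)"
    by (auto simp: cyclic_subgroups_def)
  then obtain x where x: "x \<in> H" "subgroup_generated (G\<lparr>carrier := H\<rparr>) {x} = G\<lparr>carrier := H\<rparr>"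
    unfolding cyclic_group_def by auto
  then have "carrier (subgroup_generated (G\<lparr>carrier := H\<rparr>) {x}) = H" by simp
  then have "generate (G\<lparr>carrier := H\<rparr>) {x} = H"
    using x(1) by (simp add: subgroup_generated_def)
  then have "generate G {x} = H" using generate_consistent[of "{x}" H] H x(1) by simp
  then show "H \<in> (\<lambda>x. generate G {x}) ` carrier G"
    using x(1) subgroup.mem_carrier[OF H] by blast
next
  fix H assume "H \<in> (\<lambda>x. generate G {x}) ` carrier G"
  then obtain x where x: "x \<in> carrier G" "H = generate G {x}" by blast
  then have H: "subgroup H G" and xH: "x \<in> H"
    by (auto intro: subgroup_generate_singleton generate.incl)
  have "generate (G\<lparr>carrier := H\<rparr>) {x} = H"
    using generate_consistent[of "{x}" H] H xH x(2) by simp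
  then have "subgroup_generated (G\<lparr>carrier := H\<rparr>) {x} = G\<lparr>carrier := H\<rparr>"
    using xH by (simp add: subgroup_generated_def)
  then show "H \<in> cyclic_subgroups G"
    using H xH by (auto simp: cyclic_subgroups_def cyclic_group_def)
qed

lemma (in group) card_generators_of_cyclic:
  assumes p: "prime p" and fin: "finite (carrier G)" and x: "x \<in> carrier G" "ord x = p ^ Suc k"
  shows "card {g \<in> carrier G. generate G {g} = generate G {x}} = p ^ k * (p - 1)"
proof -
  let ?H = "generate G {x}"
  have H: "subgroup ?H G" by (rule subgroup_generate_singleton[OF x(1)])
  have finH: "finite ?H" using fin subgroup.subset[OF H] finite_subset by blast
  have cardH: "card ?H = p ^ Suc k" using generate_pow_card[OF x(1)] x(2) by simp
  have "{g \<in> carrier G. generate G {g} = ?H} = ?H - {g \<in> ?H. g [^] (p ^ k) = \<one>}"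
  proof (intro equalityI subsetI)
    fix g assume "g \<in> {g \<in> carrier G. generate G {g} = ?H}"
    then have g: "g \<in> carrier G" "generate G {g} = ?H" by auto
    then have "ord g = p ^ Suc k" using generate_pow_card[OF g(1)] cardH by simp
    then have "\<not> ord g dvd p ^ k" using prime_gt_1_nat[OF p] by (simp add: dvd_power_iff_le)
    then show "g \<in> ?H - {g \<in> ?H. g [^] (p ^ k) = \<one>}"
      using g generate.incl[of g "{g}" G] by (auto simp: pow_eq_id)
  next
    fix g assume g: "g \<in> ?H - {g \<in> ?H. g [^] (p ^ k) = \<one>}"
    then have gG: "g \<in> carrier G" using subgroup.mem_carrier[OF H] by blast
    obtain i :: nat where "g = x [^] i" using g mem_generate_singleton_iff[OF fin x(1)] by auto
    then have "g [^] (p ^ Suc k) = (x [^] ord x) [^] i"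
      using x by (simp only: nat_pow_pow mult.commute)
    then have "ord g dvd p ^ Suc k" using gG x(1) by (simp add: pow_eq_id pow_ord_eq_1)
    then obtain l where l: "ord g = p ^ l" "l \<le> Suc k" unfolding divides_primepow_nat[OF p] by blast
    have "\<not> ord g dvd p ^ k" using g gG by (simp add: pow_eq_id)
    then have "\<not> l \<le> k" using l(1) by (auto simp: le_imp_power_dvd)
    then have "ord g = card ?H" using l cardH by (simp add: le_Suc_eq)
    then have "card (generate G {g}) = card ?H" using generate_pow_card[OF gG] by simp
    moreover have "generate G {g} \<subseteq> ?H" using g by (intro generate_singleton_subset[OF H]) simp
    ultimately show "g \<in> {g \<in> carrier G. generate G {g} = ?H}"
      using gG finH by (simp add: card_subset_eq)
  qed
  also have "card \<dots> = p ^ Suc k - p ^ k"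
    using finH cardH card_roots_of_one_in_cyclic[OF fin x(1), of "p ^ k"] x(2)
    by (subst card_Diff_subset) auto
  finally show ?thesis by (simp add: diff_mult_distrib2 mult.commute)
qed

text \<open>The elements of order \<open>p ^ (k + 1)\<close> are distributed over the cyclic subgroups of this order according to what they
  generate.\<close>

lemma (in group) card_cyclic_subgroups:
  assumes p: "prime p" and G: "order G = p ^ n"
  shows "real (card (cyclic_subgroups G)) = 1 + (\<Sum>k<n.
    (real (card (roots_of_one G (p ^ Suc k))) - real (card (roots_of_one G (p ^ k)))) / real (p ^ k * (p - 1)))"
proof -
  have fin: "finite (carrier G)" by (rule finite_if_prime_power_order[OF p G])
  have p1: "p > 1" using p by (rule prime_gt_1_nat)
  have finr: "finite (roots_of_one G m)" for m using fin by (simp add: roots_of_one_def)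
  define C where "C k = {H \<in> cyclic_subgroups G. card H = p ^ k}" for k
  have finC: "finite (cyclic_subgroups G)" using fin by (simp add: cyclic_subgroups_eq)
  have "cyclic_subgroups G = (\<Union>k\<le>n. C k)"
  proof (intro equalityI subsetI)
    fix H assume H: "H \<in> cyclic_subgroups G"
    then obtain x where x: "x \<in> carrier G" "H = generate G {x}" by (auto simp: cyclic_subgroups_eq)
    have "ord x dvd p ^ n" using ord_dvd_group_order[OF x(1)] G by simp
    then obtain k where "ord x = p ^ k" "k \<le> n" unfolding divides_primepow_nat[OF p] by blast
    then show "H \<in> (\<Union>k\<le>n. C k)" using H x generate_pow_card[OF x(1)] by (auto simp: C_def)
  qed (auto simp: C_def)
  then have "card (cyclic_subgroups G) = card (\<Union>k\<in>{..n}. C k)" by simp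
  also have "\<dots> = (\<Sum>k\<le>n. card (C k))"
    by (rule card_UN_disjoint) (use finC p1 in \<open>auto simp: C_def\<close>)
  also have "\<dots> = card (C 0) + (\<Sum>k<n. card (C (Suc k)))"
    by (subst sum.atMost_shift) simp
  also have "C 0 = {{\<one>}}"
  proof (intro equalityI subsetI)
    fix H assume "H \<in> C 0"
    then obtain x where x: "x \<in> carrier G" "H = generate G {x}" "card H = 1"
      by (auto simp: C_def cyclic_subgroups_eq)
    then have "x = \<one>" using generate_pow_card[OF x(1)] ord_eq_1[OF x(1)] by simp
    then show "H \<in> {{\<one>}}" using x by (simp add: generate_one)
  next
    fix H assume "H \<in> {{\<one>}}"
    then have "H = generate G {\<one>}" "card H = 1" by (auto simp: generate_one)
    then show "H \<in> C 0" by (auto simp: C_def cyclic_subgroups_eq)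
  qed
  also have "card {{\<one>}} = 1" by simp
  finally have card: "card (cyclic_subgroups G) = 1 + (\<Sum>k<n. card (C (Suc k)))" .
  have "real (card (C (Suc k))) = (real (card (roots_of_one G (p ^ Suc k))) - real (card (roots_of_one G (p ^ k)))) / real (p ^ k * (p - 1))" for k
  proof -
    let ?F = "\<lambda>H. {g \<in> carrier G. generate G {g} = H}"
    have sub: "roots_of_one G (p ^ k) \<subseteq> roots_of_one G (p ^ Suc k)"
      by (auto simp: roots_of_one_def pow_eq_id intro: dvd_mult)
    have "roots_of_one G (p ^ Suc k) - roots_of_one G (p ^ k) = (\<Union>H\<in>C (Suc k). ?F H)"
    proof (intro equalityI subsetI)
      fix g assume "g \<in> roots_of_one G (p ^ Suc k) - roots_of_one G (p ^ k)"
      then have g: "g \<in> carrier G" "ord g dvd p ^ Suc k" "\<not> ord g dvd p ^ k"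
        by (auto simp: roots_of_one_def pow_eq_id)
      obtain l where l: "ord g = p ^ l" "l \<le> Suc k" using g(2) unfolding divides_primepow_nat[OF p] by blast
      then have "l = Suc k" using g(3) by (metis le_SucE le_imp_power_dvd)
      then have "generate G {g} \<in> C (Suc k)"
        using g l generate_pow_card[OF g(1)] by (auto simp: C_def cyclic_subgroups_eq)
      then show "g \<in> (\<Union>H\<in>C (Suc k). ?F H)" using g(1) by blast
    next
      fix g assume "g \<in> (\<Union>H\<in>C (Suc k). ?F H)"
      then have g: "g \<in> carrier G" "ord g = p ^ Suc k" 
        using generate_pow_card by (auto simp: C_def)
      have "\<not> ord g dvd p ^ k" unfolding g(2) using p1 by (simp add: dvd_power_iff_le)
      then show "g \<in> roots_of_one G (p ^ Suc k) - roots_of_one G (p ^ k)"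
        using g by (auto simp: roots_of_one_def pow_eq_id)
    qed
    then have "card (roots_of_one G (p ^ Suc k) - roots_of_one G (p ^ k)) = card (\<Union>H\<in>C (Suc k). ?F H)"
      by simp
    also have "\<dots> = (\<Sum>H\<in>C (Suc k). card (?F H))"
      by (rule card_UN_disjoint) (use fin finC in \<open>auto simp: C_def\<close>)
    also have "\<dots> = (\<Sum>H\<in>C (Suc k). p ^ k * (p - 1))"
    proof (rule sum.cong[OF refl])
      fix H assume "H \<in> C (Suc k)"
      then obtain x where x: "x \<in> carrier G" "H = generate G {x}" "card H = p ^ Suc k"
        by (auto simp: C_def cyclic_subgroups_eq)
      then have "ord x = p ^ Suc k" using generate_pow_card[OF x(1)] by simp
      then show "card (?F H) = p ^ k * (p - 1)"
        using card_generators_of_cyclic[OF p fin x(1)] x(2) by simp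
    qed
    finally have "card (roots_of_one G (p ^ Suc k)) - card (roots_of_one G (p ^ k)) = card (C (Suc k)) * (p ^ k * (p - 1))"
      using card_Diff_subset[OF finr sub] by simp
    then have "real (card (roots_of_one G (p ^ Suc k))) - real (card (roots_of_one G (p ^ k))) = real (card (C (Suc k))) * real (p ^ k * (p - 1))"
      using card_mono[OF finr sub] by (simp flip: of_nat_diff of_nat_mult)
    moreover have "real (p ^ k * (p - 1)) \<noteq> 0" using p1 by simp
    ultimately show ?thesis by (simp add: field_simps)
  qed
  then show ?thesis unfolding card by simp
qed

lemma abel_summation:
  fixes D a :: "nat \<Rightarrow> real"
  assumes "D 0 = 0"
  shows "(\<Sum>k<m. (D (Suc k) - D k) * a k) = D m * a m + (\<Sum>k<m. D (Suc k) * (a k - a (Suc k)))"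
  by (induction m) (use assms in \<open>simp_all add: algebra_simps\<close>)

text \<open>The number of solutions of \<open>g ^ (p ^ k) = 1\<close> in \<open>C\<^sub>p \<times> C\<^sub>m\<close> with \<open>m = p ^ (n - 1)\<close>, for \<open>k < n\<close>.\<close>

definition minimal_roots :: "nat \<Rightarrow> nat \<Rightarrow> nat" where
  "minimal_roots p k = (if k = 0 then 1 else p ^ (k + 1))"

lemma sum_minimal_roots:
  assumes "p > 1"
  shows "1 + (\<Sum>k<Suc m. (real (minimal_roots p (Suc k)) - real (minimal_roots p k)) / real (p ^ k * (p - 1)))
    = real (Suc m * p + 2)"
proof (induction m)
  case 0
  have "real p * real p - 1 = (real p + 1) * (real p - 1)" by (simp add: algebra_simps)
  moreover have "real (p - 1) = real p - 1" "real p - 1 \<noteq> 0" using assms by (simp_all add: of_nat_diff)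
  ultimately show ?case by (simp add: minimal_roots_def)
next
  case (Suc m)
  have "real (p ^ (m + 3)) - real (p ^ (m + 2)) = real p * real (p ^ (m + 1) * (p - 1))"
    using assms by (simp add: of_nat_diff algebra_simps power_add numeral_3_eq_3 numeral_2_eq_2)
  moreover have "real (p ^ (m + 1) * (p - 1)) \<noteq> 0" using assms by simp
  ultimately have "(real (p ^ (m + 3)) - real (p ^ (m + 2))) / real (p ^ (m + 1) * (p - 1)) = real p"
    by (metis nonzero_mult_div_cancel_right)
  then have "(real (minimal_roots p (Suc (Suc m))) - real (minimal_roots p (Suc m))) / real (p ^ Suc m * (p - 1)) = real p"
    by (simp add: minimal_roots_def numeral_3_eq_3)
  then show ?case using Suc by simp
qed

text \<open>The excess \<open>D k\<close> of \<open>N k\<close> over the minimal value vanishes for \<open>k = 0\<close> and for \<open>k = n - 1\<close>. After Abel summation the excess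
  in the number of cyclic subgroups is the sum of the nonnegative \<open>D k\<close> with positive coefficients \<open>a (k - 1) - a k\<close>.\<close>

lemma (in group) card_cyclic_subgroups_ge:
  assumes p: "prime p" and n: "n \<ge> 2" and G: "order G = p ^ n"
    and roots: "\<And>k. 1 \<le> k \<Longrightarrow> k < n \<Longrightarrow> card (roots_of_one G (p ^ k)) \<ge> p ^ (k + 1)"
  shows "card (cyclic_subgroups G) \<ge> (n - 1) * p + 2"
    and "card (cyclic_subgroups G) = (n - 1) * p + 2 \<longleftrightarrow>
      (\<forall>k. 1 \<le> k \<and> k < n \<longrightarrow> card (roots_of_one G (p ^ k)) = p ^ (k + 1))"
proof -
  have p1: "p > 1" using p by (rule prime_gt_1_nat)
  have fin: "finite (carrier G)" by (rule finite_if_prime_power_order[OF p G])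
  define N where "N k = card (roots_of_one G (p ^ k))" for k
  define D where "D k = real (N k) - real (minimal_roots p k)" for k
  define a where "a k = 1 / real (p ^ k * (p - 1))" for k
  obtain m where m: "n = Suc (Suc m)" using n by (metis Suc_le_D numeral_2_eq_2 Suc_le_mono)
  have N0: "N 0 = 1"
  proof -
    have "roots_of_one G 1 = {\<one>}" by (auto simp: roots_of_one_def)
    then show ?thesis by (simp add: N_def)
  qed
  have le: "N k \<le> p ^ n" for k
    using fin G card_mono[of "carrier G" "roots_of_one G (p ^ k)"] by (simp add: N_def order_def roots_of_one_def)
  have Nn: "N n = p ^ n"
  proof -
    have "roots_of_one G (p ^ n) = carrier G" using pow_order_eq_1 G by (auto simp: roots_of_one_def)
    then show ?thesis using G by (simp add: N_def order_def)
  qed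
  have Nm: "N (Suc m) = p ^ n" using roots[of "Suc m"] le[of "Suc m"] m by (simp add: N_def)
  have D0: "D 0 = 0" by (simp add: D_def N0 minimal_roots_def)
  have Dm: "D (Suc m) = 0" using Nm m by (simp add: D_def minimal_roots_def)
  have "real (card (cyclic_subgroups G)) = 1 + (\<Sum>k<n. (real (N (Suc k)) - real (N k)) / real (p ^ k * (p - 1)))"
    using card_cyclic_subgroups[OF p G] by (simp only: N_def)
  \<comment> \<open>The last term vanishes: the bound for \<open>N (n - 1)\<close> already says that all elements are solutions.\<close>
  also have "\<dots> = 1 + (\<Sum>k<Suc m. (real (N (Suc k)) - real (N k)) / real (p ^ k * (p - 1)))"
    using Nn Nm unfolding m by (subst sum.lessThan_Suc) simp
  also have "\<dots> = 1 + (\<Sum>k<Suc m. (real (minimal_roots p (Suc k)) - real (minimal_roots p k)) / real (p ^ k * (p - 1))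
      + (D (Suc k) - D k) * a k)"
    by (simp only: D_def a_def) (simp add: diff_divide_distrib)
  also have "\<dots> = real (Suc m * p + 2) + (\<Sum>k<Suc m. (D (Suc k) - D k) * a k)"
    using sum_minimal_roots[OF p1, of m] by (simp only: sum.distrib)
  also have "(\<Sum>k<Suc m. (D (Suc k) - D k) * a k) = (\<Sum>k<Suc m. D (Suc k) * (a k - a (Suc k)))"
    using abel_summation[of D a "Suc m", OF D0] Dm by simp
  finally have eq: "real (card (cyclic_subgroups G)) = real (Suc m * p + 2) + (\<Sum>k<Suc m. D (Suc k) * (a k - a (Suc k)))" .
  have a: "a k - a (Suc k) > 0" for k
  proof -
    have "p ^ k * (p - 1) < p ^ Suc k * (p - 1)" "p ^ k * (p - 1) > 0" using p1 by simp_all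
    then have "1 / real (p ^ Suc k * (p - 1)) < 1 / real (p ^ k * (p - 1))"
      by (intro divide_strict_left_mono) (simp_all only: of_nat_less_iff of_nat_0_less_iff mult_pos_pos zero_less_one)
    then show ?thesis unfolding a_def by (simp only: diff_gt_0_iff_gt)
  qed
  have Dpos: "D (Suc k) \<ge> 0" if "k < Suc m" for k
    using roots[of "Suc k"] that m by (simp add: D_def N_def minimal_roots_def flip: of_nat_power of_nat_mult)
  have Da: "D (Suc k) * (a k - a (Suc k)) \<ge> 0" if "k < Suc m" for k
    by (intro mult_nonneg_nonneg Dpos that less_imp_le[OF a])
  have nonneg: "(\<Sum>k<Suc m. D (Suc k) * (a k - a (Suc k))) \<ge> 0"
    using Da by (intro sum_nonneg) simp
  show "card (cyclic_subgroups G) \<ge> (n - 1) * p + 2"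
  proof -
    have "real (card (cyclic_subgroups G)) \<ge> real (Suc m * p + 2)" using eq nonneg by linarith
    then show ?thesis unfolding m by (simp only: of_nat_le_iff diff_Suc_1)
  qed
  have "card (cyclic_subgroups G) = (n - 1) * p + 2 \<longleftrightarrow> real (card (cyclic_subgroups G)) = real (Suc m * p + 2)"
    unfolding m by (simp only: of_nat_eq_iff diff_Suc_1)
  also have "\<dots> \<longleftrightarrow> (\<Sum>k<Suc m. D (Suc k) * (a k - a (Suc k))) = 0" unfolding eq by linarith
  also have "\<dots> \<longleftrightarrow> (\<forall>k<Suc m. D (Suc k) * (a k - a (Suc k)) = 0)"
    using Da by (subst sum_nonneg_eq_0_iff) auto
  also have "\<dots> \<longleftrightarrow> (\<forall>k<Suc m. D (Suc k) = 0)" using a by (metis less_irrefl mult_eq_0_iff)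
  also have "\<dots> \<longleftrightarrow> (\<forall>k. 1 \<le> k \<and> k < n \<longrightarrow> N k = p ^ (k + 1))"
  proof -
    have "D (Suc k) = 0 \<longleftrightarrow> N (Suc k) = p ^ (Suc k + 1)" for k
      unfolding D_def minimal_roots_def by (simp flip: of_nat_power of_nat_mult)
    then show ?thesis unfolding m by (metis Suc_le_D Suc_less_eq One_nat_def le_add1 plus_1_eq_Suc)
  qed
  finally show "card (cyclic_subgroups G) = (n - 1) * p + 2 \<longleftrightarrow>
      (\<forall>k. 1 \<le> k \<and> k < n \<longrightarrow> card (roots_of_one G (p ^ k)) = p ^ (k + 1))"
    by (simp only: N_def)
qed

lemma (in group) card_cyclic_subgroups_split_metacyclic:
  assumes p: "prime p" and n: "n \<ge> 2" and gens: "metacyclic_gens G p (p ^ (n - 1)) r 0 x y"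
    and G: "order G = p * p ^ (n - 1)"
    and r: "[r = 1] (mod p)" "p = 2 \<Longrightarrow> [r = 1] (mod 4)"
  shows "card (cyclic_subgroups G) = (n - 1) * p + 2"
proof -
  have roots: "card (roots_of_one G (p ^ k)) = p ^ (k + 1)" if "1 \<le> k" "k < n" for k
    using card_roots_of_one_split_metacyclic[OF p gens G r] that by simp
  have "order G = p ^ n" using G n by (cases n) auto
  then show ?thesis using card_cyclic_subgroups_ge(2)[OF p n] roots by simp
qed

text \<open>The terms of the sum are \<open>1\<close> for \<open>k = 0\<close>, \<open>1 + 2 ^ (n - 2)\<close> for \<open>k = 1\<close>, then \<open>n - 3\<close> times \<open>1\<close>, and \<open>0\<close> for
  \<open>k = n - 1\<close>.\<close>

lemma (in group) card_cyclic_subgroups_quaternion: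
  assumes n: "n \<ge> 3"
    and gens: "metacyclic_gens G 2 (2 ^ (n - 1)) (2 ^ (n - 1) - 1) (2 ^ (n - 2)) x y"
    and G: "order G = 2 * 2 ^ (n - 1)"
  shows "card (cyclic_subgroups G) = n + 2 ^ (n - 2)"
proof -
  obtain m where m: "n = Suc (Suc (Suc m))" using n by (metis Suc_le_D numeral_3_eq_3 Suc_le_mono)
  have Gn: "order G = 2 ^ n" using G m by simp
  define N where "N k = card (roots_of_one G (2 ^ k))" for k
  have N: "N k = 2 ^ k + (if k = 1 then 0 else 4 * 2 ^ m)" if "1 \<le> k" "k < n" for k
    using card_roots_of_one_quaternion[of "n - 1" x y k] gens G that m by (simp add: N_def)
  have N0: "N 0 = 1"
  proof -
    have "roots_of_one G 1 = {\<one>}" by (auto simp: roots_of_one_def)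
    then show ?thesis by (simp add: N_def)
  qed
  have Nn: "N n = 2 ^ n"
  proof -
    have "roots_of_one G (2 ^ n) = carrier G" using pow_order_eq_1 Gn by (auto simp: roots_of_one_def)
    then show ?thesis using Gn by (simp add: N_def order_def)
  qed
  let ?t = "\<lambda>k. (real (N (Suc k)) - real (N k)) / real (2 ^ k * (2 - 1))"
  have last: "?t (n - 1) = 0" using N[of "n - 1"] Nn m by simp
  have t0: "?t 0 = 1" using N[of 1] N0 n by simp
  have t1: "?t 1 = 1 + 2 * 2 ^ m" using N[of 1] N[of 2] m by (simp add: numeral_2_eq_2)
  have t: "?t (Suc (Suc k)) = 1" if "k < m" for k
    using N[of "Suc (Suc k)"] N[of "Suc (Suc (Suc k))"] that m by simp
  have "real (card (cyclic_subgroups G)) = 1 + (\<Sum>k<n. ?t k)"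
    using card_cyclic_subgroups[OF two_is_prime_nat Gn] by (simp only: N_def)
  also have "(\<Sum>k<n. ?t k) = (\<Sum>k<Suc (Suc m). ?t k)"
    using last unfolding m by (subst sum.lessThan_Suc) simp
  also have "\<dots> = ?t 0 + ?t 1 + (\<Sum>k<m. ?t (Suc (Suc k)))"
    by (simp only: sum.lessThan_Suc_shift One_nat_def add.assoc)
  also have "(\<Sum>k<m. ?t (Suc (Suc k))) = (\<Sum>k<m. 1)" by (rule sum.cong[OF refl]) (simp only: lessThan_iff t)
  finally have "real (card (cyclic_subgroups G)) = real (n + 2 ^ (n - 2))"
    unfolding t0 t1 by (simp add: m)
  then show ?thesis by (simp only: of_nat_eq_iff)
qed

section \<open>Comparison of the groups of order $p^n$\<close>

text \<open>The count depends only on the numbers of solutions of \<open>g ^ m = 1\<close>, which an isomorphism preserves.\<close>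

lemma card_cyclic_subgroups_iso:
  assumes "group G" "group H" "G \<cong> H" "prime p" "order G = p ^ n"
  shows "card (cyclic_subgroups G) = card (cyclic_subgroups H)" and "order H = p ^ n"
proof -
  interpret G: group G by fact
  interpret H: group H by fact
  obtain h where h: "h \<in> hom G H" "bij_betw h (carrier G) (carrier H)"
    using assms(3) by (auto simp: is_iso_def iso_def)
  interpret group_hom G H h by unfold_locales (rule h)
  show oH: "order H = p ^ n" using assms(5) bij_betw_same_card[OF h(2)] by (simp add: order_def)
  have "card (roots_of_one G m) = card (roots_of_one H m)" for m
  proof -
    have "roots_of_one H m = h ` roots_of_one G m"
    proof (intro equalityI subsetI)
      fix b assume b: "b \<in> roots_of_one H m"
      then obtain a where a: "a \<in> carrier G" "b = h a" using h(2) by (auto simp: roots_of_one_def bij_betw_def)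
      then have "h (a [^]\<^bsub>G\<^esub> m) = h \<one>\<^bsub>G\<^esub>" using b by (simp add: roots_of_one_def hom_nat_pow)
      then have "a [^]\<^bsub>G\<^esub> m = \<one>\<^bsub>G\<^esub>" 
        using inj_onD[OF bij_betw_imp_inj_on[OF h(2)]] a(1) by simp
      then show "b \<in> h ` roots_of_one G m" using a by (auto simp: roots_of_one_def)
    next
      fix b assume "b \<in> h ` roots_of_one G m"
      then show "b \<in> roots_of_one H m" by (auto simp: roots_of_one_def simp flip: hom_nat_pow)
    qed
    moreover have "inj_on h (roots_of_one G m)"
      using h(2) by (auto simp: bij_betw_def roots_of_one_def intro: inj_on_subset)
    ultimately show ?thesis by (simp add: card_image)
  qed
  then have "real (card (cyclic_subgroups G)) = real (card (cyclic_subgroups H))"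
    using G.card_cyclic_subgroups[OF assms(4,5)] H.card_cyclic_subgroups[OF assms(4) oH] by simp
  then show "card (cyclic_subgroups G) = card (cyclic_subgroups H)" by simp
qed

text \<open>A cyclic group is metacyclic with \<open>p = 1\<close> and \<open>y = 1\<close>.\<close>

lemma (in group) cyclic_iso_integer_mod_group:
  assumes x: "x \<in> carrier G" "ord x = order G" and m: "order G > 0"
  shows "G \<cong> integer_mod_group (order G)"
proof -
  let ?m = "order G" and ?Z = "integer_mod_group (order G)"
  have fin: "finite (carrier G)" using m by (simp add: order_gt_0_iff_finite)
  have "generate G {x} = carrier G"
    using generate_pow_card[OF x(1)] x(2) fin subgroup.subset[OF subgroup_generate_singleton[OF x(1)]]
    by (intro card_subset_eq) (auto simp: order_def)
  then have "\<exists>i::nat. g = x [^] i" if "g \<in> carrier G" for g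
    using that mem_generate_singleton_iff[OF fin x(1)] by auto
  then have G: "metacyclic_gens G 1 ?m 1 0 x \<one>"
    using x pow_ord_eq_1[OF x(1)] unfolding metacyclic_gens_def by auto
  have "metacyclic_gens ?Z 1 ?m 1 0 (1 mod int ?m) 0"
    unfolding metacyclic_gens_def
  proof (intro conjI ballI)
    fix g assume "g \<in> carrier ?Z"
    then have "0 \<le> g" "g < int ?m" using m by (auto simp: carrier_integer_mod_group)
    then obtain i :: nat where "g = int i" "i < ?m" by (metis nonneg_int_cases of_nat_less_iff)
    then have "g = 0 [^]\<^bsub>?Z\<^esub> (0::nat) \<otimes>\<^bsub>?Z\<^esub> (1 mod int ?m) [^]\<^bsub>?Z\<^esub> i"
      by (simp add: mod_mult_right_eq)
    then show "\<exists>(j::nat) (i::nat). g = 0 [^]\<^bsub>?Z\<^esub> j \<otimes>\<^bsub>?Z\<^esub> (1 mod int ?m) [^]\<^bsub>?Z\<^esub> i"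
      by blast
  qed (use m in \<open>auto simp: carrier_integer_mod_group mod_mult_right_eq\<close>)
  moreover have "order ?Z = 1 * ?m" using m by (simp add: order_def[of ?Z] carrier_integer_mod_group)
  ultimately show ?thesis
    using metacyclic_iso[OF G _ zero_less_one m group_integer_mod_group] by simp
qed

lemma alpha_le_iff:
  assumes "order H = order K" "order K > 0"
  shows "alpha H \<le> alpha K \<longleftrightarrow> card (cyclic_subgroups H) \<le> card (cyclic_subgroups K)"
  using assms by (simp add: alpha_def divide_le_cancel)

lemma alpha_eq_iff:
  assumes "order H = order K" "order K > 0"
  shows "alpha H = alpha K \<longleftrightarrow> card (cyclic_subgroups H) = card (cyclic_subgroups K)"
  using assms by (simp add: alpha_def)

theorem theorem2p3:
  fixes G :: "('a, 'b) monoid_scheme" and p n :: nat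
  assumes "prime p" and "n \<ge> 3"
    and "group G" and "order G = p ^ n"
    and "\<not> G \<cong> integer_mod_group (p ^ n)"
  shows
    "(odd p \<longrightarrow>
        alpha G \<ge> alpha (integer_mod_group p \<times>\<times> integer_mod_group (p ^ (n - 1)))
      \<and> alpha (integer_mod_group p \<times>\<times> integer_mod_group (p ^ (n - 1))) = alpha (modular_group p n)
      \<and> (alpha G = alpha (integer_mod_group p \<times>\<times> integer_mod_group (p ^ (n - 1))) \<longleftrightarrow>
           G \<cong> (integer_mod_group p \<times>\<times> integer_mod_group (p ^ (n - 1))) \<or> G \<cong> modular_group p n))
   \<and> (p = 2 \<longrightarrow>
        (n = 3 \<longrightarrow>
            alpha G \<ge> alpha (quaternion_group 3)
          \<and> (alpha G = alpha (quaternion_group 3) \<longleftrightarrow> G \<cong> quaternion_group 3))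
      \<and> (n = 4 \<longrightarrow>
            alpha G \<ge> alpha (integer_mod_group 2 \<times>\<times> integer_mod_group 8)
          \<and> alpha (integer_mod_group 2 \<times>\<times> integer_mod_group 8) = alpha (modular_group 2 4)
          \<and> alpha (modular_group 2 4) = alpha (quaternion_group 4)
          \<and> (alpha G = alpha (integer_mod_group 2 \<times>\<times> integer_mod_group 8) \<longleftrightarrow>
               G \<cong> (integer_mod_group 2 \<times>\<times> integer_mod_group 8)
             \<or> G \<cong> modular_group 2 4
             \<or> G \<cong> quaternion_group 4))
      \<and> (n \<ge> 5 \<longrightarrow>
            alpha G \<ge> alpha (integer_mod_group 2 \<times>\<times> integer_mod_group (2 ^ (n - 1)))
          \<and> alpha (integer_mod_group 2 \<times>\<times> integer_mod_group (2 ^ (n - 1))) = alpha (modular_group 2 n)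
          \<and> (alpha G = alpha (integer_mod_group 2 \<times>\<times> integer_mod_group (2 ^ (n - 1))) \<longleftrightarrow>
               G \<cong> (integer_mod_group 2 \<times>\<times> integer_mod_group (2 ^ (n - 1))) \<or> G \<cong> modular_group 2 n)))"
proof -
  note p = assms(1) and n = assms(2) and G = assms(4)
  interpret G: group G by fact
  let ?A = "integer_mod_group p \<times>\<times> integer_mod_group (p ^ (n - 1))"
  let ?M = "modular_group p n" and ?Q = "quaternion_group n"
  let ?c = "\<lambda>H. card (cyclic_subgroups H)"
  have p1: "p > 1" using p by (rule prime_gt_1_nat)
  have pm: "p ^ (n - 1) > 1" "p ^ (n - 1) > 0" using p1 n one_less_power[of p "n - 1"] by simp_all
  have pn: "p * p ^ (n - 1) = p ^ n" using n by (cases n) auto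
  have A: "group ?A" by (intro DirProd_group group_integer_mod_group)
  have M: "group ?M" and Q: "group ?Q"
    by (simp_all only: modular_group_def quaternion_group_def group_presented_group)
  note genA = metacyclic_gens_integer_mod_groups[OF p1 pm(1)]
  note genM = modular_group_metacyclic[OF p n]
  note genQ = quaternion_group_metacyclic[OF n]
  have cA: "?c ?A = (n - 1) * p + 2"
    using group.card_cyclic_subgroups_split_metacyclic[OF A p _ genA] n by simp
  have cM: "?c ?M = (n - 1) * p + 2" if n4: "p = 2 \<Longrightarrow> n \<ge> 4"
  proof -
    have "[1 + p ^ (n - 2) = 1] (mod p)"
    proof -
      have "n - 2 = Suc (n - 3)" using n by simp
      then have "p ^ (n - 2) = p * p ^ (n - 3)" by simp
      then show ?thesis by (simp only: cong_def mod_mult_self2)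
    qed
    moreover have "[1 + p ^ (n - 2) = 1] (mod 4)" if "p = 2"
    proof -
      have "2 ^ 2 dvd (2::nat) ^ (n - 2)" using n4[OF that] by (intro le_imp_power_dvd) simp
      then have "4 dvd p ^ (n - 2)" using that by simp
      then show ?thesis by (auto simp: cong_def)
    qed
    ultimately show ?thesis
      using genM group.card_cyclic_subgroups_split_metacyclic[OF M p, of n "1 + p ^ (n - 2)"] n by auto
  qed
  have cQ: "?c ?Q = n + 2 ^ (n - 2)"
    using genQ group.card_cyclic_subgroups_quaternion[OF Q n] by blast
  have oA: "order ?A = p ^ n" and oM: "order ?M = p ^ n" and oQ: "p = 2 \<Longrightarrow> order ?Q = p ^ n"
    using genA(2) genM(2) genQ(2) pn by auto
  have isoA: "G \<cong> ?A \<Longrightarrow> ?c G = ?c ?A" and isoM: "G \<cong> ?M \<Longrightarrow> ?c G = ?c ?M"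
    and isoQ: "G \<cong> ?Q \<Longrightarrow> ?c G = ?c ?Q"
    using card_cyclic_subgroups_iso(1)[OF assms(3) _ _ p G] A M Q by auto
  have quat_or_ge: "p = 2 \<and> G \<cong> ?Q \<or> ?c G \<ge> (n - 1) * p + 2 \<and>
    ((p = 2 \<longrightarrow> n \<ge> 4) \<longrightarrow> ?c G = (n - 1) * p + 2 \<longrightarrow> G \<cong> ?A \<or> G \<cong> ?M)"
  proof (cases "card (roots_of_one G p) \<le> p")
    case True
    have "\<not> (\<exists>x\<in>carrier G. G.ord x = p ^ n)"
      using G.cyclic_iso_integer_mod_group assms(5) G pm p1 by auto
    then obtain x y where p2: "p = 2" and
      gens: "metacyclic_gens G 2 (2 ^ (n - 1)) (2 ^ (n - 1) - 1) (2 ^ (n - 2)) x y"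
      using G.cyclic_or_quaternion_if_few_roots[OF p G True] by blast
    moreover have "order G = 2 * 2 ^ (n - 1)" using G pn p2 by simp
    ultimately show ?thesis
      using genQ G.metacyclic_iso[OF gens _ _ _ Q] by auto
  next
    case False
    have ge: "card (roots_of_one G (p ^ k)) \<ge> p ^ (k + 1)" if "1 \<le> k" "k < n" for k
      using G.card_roots_of_one_ge[OF p G _ that] False by simp
    have n2: "n \<ge> 2" using n by simp
    note count = G.card_cyclic_subgroups_ge[OF p n2 G ge]
    have "G \<cong> ?A \<or> G \<cong> ?M" if n4: "p = 2 \<longrightarrow> n \<ge> 4" and eq: "?c G = (n - 1) * p + 2"
    proof -
      have Gn: "order G = p * p ^ (n - 1)" using G pn by simp
      have p0: "p > 0" using p1 by simp
      obtain x y where "metacyclic_gens G p (p ^ (n - 1)) 1 0 x y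
        \<or> metacyclic_gens G p (p ^ (n - 1)) (1 + p ^ (n - 2)) 0 x y"
        using G.split_metacyclic_if_minimal_roots[OF p n _ G] n4 eq count(2) by blast
      then show ?thesis
        using G.metacyclic_iso[OF _ Gn p0 pm(2) A genA] G.metacyclic_iso[OF _ Gn p0 pm(2) M _ genM(2)] genM(1)
        by blast
    qed
    then show ?thesis using count(1) by blast
  qed
  have alA: "alpha ?A \<le> alpha G \<longleftrightarrow> ?c ?A \<le> ?c G" "alpha G = alpha ?A \<longleftrightarrow> ?c G = ?c ?A"
    using alpha_le_iff[of ?A G] alpha_eq_iff[of G ?A] oA G p1 by simp_all
  have alAM: "alpha ?A = alpha ?M \<longleftrightarrow> ?c ?A = ?c ?M"
    using alpha_eq_iff[of ?A ?M] oA oM p1 by simp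
  have alQ: "alpha ?Q \<le> alpha G \<longleftrightarrow> ?c ?Q \<le> ?c G" "alpha G = alpha ?Q \<longleftrightarrow> ?c G = ?c ?Q"
    "alpha ?M = alpha ?Q \<longleftrightarrow> ?c ?M = ?c ?Q" if "p = 2"
    using alpha_le_iff[of ?Q G] alpha_eq_iff[of G ?Q] alpha_eq_iff[of ?M ?Q] oM oQ[OF that] G p1 by simp_all
  have generic: "alpha ?A \<le> alpha G \<and> alpha ?A = alpha ?M \<and>
      (alpha G = alpha ?A \<longleftrightarrow> G \<cong> ?A \<or> G \<cong> ?M)" if n5: "p = 2 \<Longrightarrow> n \<ge> 5"
  proof -
    have n4: "p = 2 \<Longrightarrow> n \<ge> 4" using n5 by simp
    have "?c G > (n - 1) * p + 2" if "p = 2" "G \<cong> ?Q"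
    proof -
      have "n < 2 ^ (n - 2)" using n5[OF \<open>p = 2\<close>]
      proof (induction n rule: dec_induct)
        case (step k)
        then have "Suc k - 2 = Suc (k - 2)" by simp
        then have "2 ^ (Suc k - 2) = 2 * (2::nat) ^ (k - 2)" by (simp only: power_Suc)
        then show ?case using step by linarith
      qed simp
      then show ?thesis using isoQ that cQ n by simp
    qed
    then have ge: "?c G \<ge> (n - 1) * p + 2" and eq: "?c G = (n - 1) * p + 2 \<Longrightarrow> G \<cong> ?A \<or> G \<cong> ?M"
      using quat_or_ge n4 by fastforce+
    then show ?thesis unfolding alA alAM using cA cM[OF n4] isoA isoM by auto
  qed
  have three: "alpha ?Q \<le> alpha G \<and> (alpha G = alpha ?Q \<longleftrightarrow> G \<cong> ?Q)" if "p = 2" "n = 3"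
    unfolding alQ[OF \<open>p = 2\<close>] using quat_or_ge isoQ cQ that by auto
  have four: "alpha ?A \<le> alpha G \<and> alpha ?A = alpha ?M \<and> alpha ?M = alpha ?Q \<and>
      (alpha G = alpha ?A \<longleftrightarrow> G \<cong> ?A \<or> G \<cong> ?M \<or> G \<cong> ?Q)" if "p = 2" "n = 4"
  proof -
    have "?c ?A = 8" "?c ?M = 8" "?c ?Q = 8" using cA cM cQ that by simp_all
    moreover from this have "?c G \<ge> 8" "?c G = 8 \<longleftrightarrow> G \<cong> ?A \<or> G \<cong> ?M \<or> G \<cong> ?Q"
      using quat_or_ge isoA isoM isoQ that by auto
    ultimately show ?thesis unfolding alA alAM alQ[OF \<open>p = 2\<close>] by simp
  qed
  show ?thesis
  proof (intro conjI[of "odd p \<longrightarrow> _"] impI)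
    assume "odd p"
    then have "p \<noteq> 2" by auto
    then show "alpha ?A \<le> alpha G \<and> alpha ?A = alpha ?M \<and>
      (alpha G = alpha ?A \<longleftrightarrow> G \<cong> ?A \<or> G \<cong> ?M)" using generic by blast
  next
    assume p2: "p = 2"
    have "(2::nat) ^ (4 - 1) = 8" by simp
    then show "(n = 3 \<longrightarrow>
            alpha G \<ge> alpha (quaternion_group 3)
          \<and> (alpha G = alpha (quaternion_group 3) \<longleftrightarrow> G \<cong> quaternion_group 3))
      \<and> (n = 4 \<longrightarrow>
            alpha G \<ge> alpha (integer_mod_group 2 \<times>\<times> integer_mod_group 8)
          \<and> alpha (integer_mod_group 2 \<times>\<times> integer_mod_group 8) = alpha (modular_group 2 4)
          \<and> alpha (modular_group 2 4) = alpha (quaternion_group 4)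
          \<and> (alpha G = alpha (integer_mod_group 2 \<times>\<times> integer_mod_group 8) \<longleftrightarrow>
               G \<cong> (integer_mod_group 2 \<times>\<times> integer_mod_group 8)
             \<or> G \<cong> modular_group 2 4
             \<or> G \<cong> quaternion_group 4))
      \<and> (n \<ge> 5 \<longrightarrow>
            alpha G \<ge> alpha (integer_mod_group 2 \<times>\<times> integer_mod_group (2 ^ (n - 1)))
          \<and> alpha (integer_mod_group 2 \<times>\<times> integer_mod_group (2 ^ (n - 1))) = alpha (modular_group 2 n)
          \<and> (alpha G = alpha (integer_mod_group 2 \<times>\<times> integer_mod_group (2 ^ (n - 1))) \<longleftrightarrow>
               G \<cong> (integer_mod_group 2 \<times>\<times> integer_mod_group (2 ^ (n - 1))) \<or> G \<cong> modular_group 2 n))"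
      using generic three four p2 by metis
  qed
qed

end
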